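(* Let $f:S^2\to S^2$ be a continuous map of degree $d$ with $|d|>1$. Suppose $f$ has two (distinct) attracting fixed points, denoted $N$ and $S$, and let $A=S^2\setminus\{N,S\}$. Assume that whenever a loop $\gamma\subset f^{-1}(A)$ is homotopically trivial in $A$, the loop $f(\gamma)$ is also homotopically trivial in $A$. Then $$\limsup_{n\to\infty}\frac1n\log N_nf\;\geq\;\log|d|,$$ where $N_nf$ is the number of fixed points of $f^n$.
   Context: $f^n$ denotes the $n$-th iterate of $f$, and $N_nf=\#\{x\in S^2: f^n(x)=x\}$ (if this number is infinite, $\log N_nf=+\infty$). The fixed points $N$ and $S$ are attracting in the following sense: there exist disjoint open sets $V_N,V_S\subset S^2$ with $N\in V_N$, $S\in V_S$, $f(\overline{V_N})\subset V_N$ and $f(\overline{V_S})\subset V_S$. Since $N$ and $S$ are fixed, $f^{-1}(A)\subset A$, so a loop in $f^{-1}(A)$ is a loop in $A$; $f$ need not map $A$ into $A$. *)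

theory Defs
  imports "HOL-Analysis.Analysis" "HOL-Homology.Homology"
begin

(* The 2-sphere is the library's nsphere 2, whose points have type nat => real.  The Euclidean_space
   topology is the one induced by the product topology, which is also the type class topology on
   nat => real (euclidean_product_topology).  Hence path and homotopic_loops, applied to subsets of
   S2, refer to the same topology as nsphere 2. *)

abbreviation S2 :: "(nat \<Rightarrow> real) set"
  where "S2 \<equiv> topspace (nsphere 2)"

definition loop_in :: "'a::topological_space set \<Rightarrow> (real \<Rightarrow> 'a) \<Rightarrow> bool"
  where "loop_in B \<gamma> \<longleftrightarrow> path \<gamma> \<and> path_image \<gamma> \<subseteq> B \<and> pathfinish \<gamma> = pathstart \<gamma>"

definition homotopically_trivial_in :: "'a::topological_space set \<Rightarrow> (real \<Rightarrow> 'a) \<Rightarrow> bool"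
  where "homotopically_trivial_in B \<gamma> \<longleftrightarrow> (\<exists>a. homotopic_loops B \<gamma> (\<lambda>_. a))"

definition attracting_fixed_pair :: "'a topology \<Rightarrow> ('a \<Rightarrow> 'a) \<Rightarrow> 'a \<Rightarrow> 'a \<Rightarrow> bool"
  where "attracting_fixed_pair X f p q \<longleftrightarrow>
    f p = p \<and> f q = q \<and>
    (\<exists>U V. openin X U \<and> openin X V \<and> U \<inter> V = {} \<and> p \<in> U \<and> q \<in> V \<and>
           f ` (X closure_of U) \<subseteq> U \<and> f ` (X closure_of V) \<subseteq> V)"

definition periodic_points :: "'a set \<Rightarrow> ('a \<Rightarrow> 'a) \<Rightarrow> nat \<Rightarrow> 'a set"
  where "periodic_points B f n = {x \<in> B. (f ^^ n) x = x}"

(* The case distinction is needed because card is 0 on infinite sets. *)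
definition log_card :: "'a set \<Rightarrow> ereal"
  where "log_card B =
    (if infinite B then \<infinity> else if B = {} then -\<infinity> else ereal (ln (real (card B))))"

end

(* All hypotheses pass from f to its iterates, whose degrees are d^n, so it suffices that a map F of
   degree d satisfying them has at least |d - 1| fixed points.

   Put N and S at the poles of the unit sphere of complex * real and write F = (sqrt (1 - tau^2) eta, tau)
   with tau the height of F and eta circle-valued on U = {|tau| < 1}, the preimage of A.  For fixed tau the
   degree of (sqrt (1 - tau^2) u, tau) is additive in u, hence a sum over the components W of U.  Let zeta
   be the angular coordinate x |-> sgn (fst x), for which this degree is 1, while for eta it is d.

   By hypothesis a loop in W that does not wind around the poles has an image that does not wind either.
   Hence on W, up to factors exp (i theta), zeta = r^k and eta = r^a for a common circle-valued r.  Let t be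
   the degree contributed by r on W, so W contributes k t to 1 and a t to d.  If t is nonzero, then W separates
   the poles; comparison with a map of constant height on the two complementary components K0, K1 of W
   containing the poles gives k = |t| = 1 and tau takes opposite values 1, -1 on the boundaries of K0 and K1.
   In that case the ring between K0 and K1 contains |a - 1| fixed points, one for each branch of a root of
   order |a - 1| of F / id in the stereographic chart: a map c = z^e exp g with e = 1 or -1 on a plane ring such
   that 1 - c has a logarithm on one boundary component and 1 - 1/c on the other takes the value 1.  The rings
   of different W are disjoint, and the sum of t (a - 1) over all W is d - 1. *)

theory Submission
  imports Defs "HOL-Complex_Analysis.Complex_Analysis"
begin

section \<open>Variation of the logarithm along chains\<close>

text \<open>The height can be wild: \<open>U\<close> may have infinitely many components with
  irregular boundaries, so neither regular values nor local degrees are at hand. Instead, for a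
  given height, one singular 1-cycle in \<open>U\<close> is fixed, a Mayer-Vietoris image of a class
  of the sphere; the degree attached to a circle-valued u is the variation of log u along it,
  divided by 2 pi i. Additivity is then the law log(uv) = log u + log v. Components without points
  of height 0 drop out because the corresponding maps omit a point, which leaves a finite sum. Fixed
  points are not counted by indices, which could cancel. In each ring the branches of the root act
  as Nielsen classes: different branches have different solutions, and existence of a solution is a
  question about logarithms on plane sets, which asks no regularity of the boundaries. The
  attracting neighbourhoods supply the boundary conditions for it, both when the two ends of a ring
  keep their heights and when they exchange them. The unit subtracted from d is harmless for the
  growth rate.\<close>

definition log_var :: "(real \<Rightarrow> complex) \<Rightarrow> complex"
  where "log_var \<phi> = (SOME v. \<exists>g. continuous_on {0..1} g \<and> (\<forall>t\<in>{0..1}. \<phi> t = exp (g t)) \<and> v = g 1 - g 0)"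

text \<open>The difference of two logarithms takes values in the discrete set 2 pi i Z, whose points
  are at least 2 pi apart, so it is constant on a connected set.\<close>

lemma exp_eq_imp_const_diff:
  fixes g h :: "'a::topological_space \<Rightarrow> complex"
  assumes "connected S" "continuous_on S g" "continuous_on S h"
    and "\<And>x. x \<in> S \<Longrightarrow> exp (g x) = exp (h x)"
  shows "\<exists>n::int. \<forall>x\<in>S. g x - h x = 2 * of_int n * of_real pi * \<i>"
proof -
  have "(\<lambda>x. g x - h x) constant_on S"
  proof (rule continuous_discrete_range_constant [OF assms(1)])
    show "continuous_on S (\<lambda>x. g x - h x)"
      using assms by (intro continuous_intros)
    fix x assume x: "x \<in> S"
    show "\<exists>e>0. \<forall>y. y \<in> S \<and> g y - h y \<noteq> g x - h x \<longrightarrow> e \<le> norm (g y - h y - (g x - h x))"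
    proof (intro exI conjI allI impI)
      show "2 * pi > 0" by simp
      fix y assume y: "y \<in> S \<and> g y - h y \<noteq> g x - h x"
      obtain m n :: int where m: "g y = h y + (of_int (2 * m) * pi) * \<i>" and n: "g x = h x + (of_int (2 * n) * pi) * \<i>"
        using assms(4)[of x] assms(4)[of y] x y unfolding exp_eq by blast
      have eq: "g y - h y - (g x - h x) = of_int (2 * (m - n)) * of_real pi * \<i>"
        by (simp add: m n algebra_simps)
      have "m \<noteq> n"
        using y m n by auto
      then have "1 \<le> \<bar>real_of_int (m - n)\<bar>" by linarith
      moreover have "norm (of_int (2 * (m - n)) :: complex) = \<bar>real_of_int (2 * (m - n))\<bar>"
        by (rule norm_of_int)
      ultimately show "2 * pi \<le> norm (g y - h y - (g x - h x))"
        using eq by (simp only: norm_mult norm_ii norm_of_real) simp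
    qed
  qed
  then obtain c where c: "\<And>x. x \<in> S \<Longrightarrow> g x - h x = c"
    by (auto simp: constant_on_def)
  show ?thesis
  proof (cases "S = {}")
    case False
    then obtain x where x: "x \<in> S" by blast
    obtain n :: int where "g x = h x + (of_int (2 * n) * pi) * \<i>"
      using assms(4)[OF x] unfolding exp_eq by blast
    then have "c = 2 * of_int n * of_real pi * \<i>"
      using c[OF x] by simp
    then show ?thesis using c by blast
  qed auto
qed

text \<open>Two continuous logarithms of one function differ by a constant, so the choice made in
  \<open>log_var\<close> is harmless. For a loop the value is 2 pi i times the winding number about
  0.\<close>

lemma log_var_eq:
  assumes "continuous_on {0..1} g" "\<And>t. t \<in> {0..1} \<Longrightarrow> \<phi> t = exp (g t)"
  shows "log_var \<phi> = g 1 - g 0"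
  unfolding log_var_def
proof (rule some_equality)
  show "\<exists>h. continuous_on {0..1} h \<and> (\<forall>t\<in>{0..1}. \<phi> t = exp (h t)) \<and> g 1 - g 0 = h 1 - h 0"
    using assms by blast
next
  fix v
  assume "\<exists>h. continuous_on {0..1} h \<and> (\<forall>t\<in>{0..1}. \<phi> t = exp (h t)) \<and> v = h 1 - h 0"
  then obtain h where h: "continuous_on {0..1} h" "\<And>t. t \<in> {0..1} \<Longrightarrow> \<phi> t = exp (h t)" "v = h 1 - h 0"
    by blast
  have "\<exists>n::int. \<forall>x\<in>{0..1::real}. h x - g x = 2 * of_int n * of_real pi * \<i>"
    by (rule exp_eq_imp_const_diff) (use assms h in auto)
  then obtain n :: int where "\<And>x. x \<in> {0..1::real} \<Longrightarrow> h x - g x = 2 * of_int n * of_real pi * \<i>"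
    by blast
  from this[of 0] this[of 1] show "v = g 1 - g 0"
    using h(3) by (simp add: algebra_simps)
qed

lemma continuous_log_on_interval:
  fixes \<phi> :: "real \<Rightarrow> complex"
  assumes "continuous_on {0..1} \<phi>" "\<And>t. t \<in> {0..1} \<Longrightarrow> \<phi> t \<noteq> 0"
  obtains g where "continuous_on {0..1} g" "\<And>t. t \<in> {0..1} \<Longrightarrow> \<phi> t = exp (g t)"
  using continuous_logarithm_on_contractible [of "{0..1::real}" \<phi>] assms
  by (metis convex_imp_contractible convex_real_interval(5))

lemma log_var_mult:
  assumes "continuous_on {0..1} \<phi>" "\<And>t. t \<in> {0..1} \<Longrightarrow> \<phi> t \<noteq> 0"
    and "continuous_on {0..1} \<psi>" "\<And>t. t \<in> {0..1} \<Longrightarrow> \<psi> t \<noteq> 0"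
  shows "log_var (\<lambda>t. \<phi> t * \<psi> t) = log_var \<phi> + log_var \<psi>"
proof -
  obtain g h where g: "continuous_on {0..1} g" "\<And>t. t \<in> {0..1} \<Longrightarrow> \<phi> t = exp (g t)"
    and h: "continuous_on {0..1} h" "\<And>t. t \<in> {0..1} \<Longrightarrow> \<psi> t = exp (h t)"
    using continuous_log_on_interval assms by metis
  have "log_var (\<lambda>t. \<phi> t * \<psi> t) = (g 1 + h 1) - (g 0 + h 0)"
    by (rule log_var_eq) (auto intro!: continuous_intros g h simp: g h exp_add)
  then show ?thesis
    using log_var_eq[OF g] log_var_eq[OF h] by simp
qed

text \<open>Barycentric coordinates of the point at time \<open>t\<close> on the standard 1-simplex;
  composing with it turns a singular 1-simplex into a path on the unit interval.\<close>

definition simplex_edge :: "real \<Rightarrow> nat \<Rightarrow> real"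
  where "simplex_edge t = (\<lambda>j. if j = 0 then 1 - t else if j = 1 then t else 0)"

lemma simplex_edge_in: "t \<in> {0..1} \<Longrightarrow> simplex_edge t \<in> standard_simplex (Suc 0)"
  by (auto simp: simplex_edge_def standard_simplex_def)

lemma continuous_simplex_edge: "continuous_on A simplex_edge"
proof (rule continuous_on_coordinatewise_then_product)
  show "continuous_on A (\<lambda>t. simplex_edge t i)" for i
    unfolding simplex_edge_def
    by (cases "i = 0"; cases "i = 1") (auto intro!: continuous_intros)
qed

lemma singular_simplex_euclidean:
  "singular_simplex p X s \<Longrightarrow> continuous_map (top_of_set (standard_simplex p)) X s"
  by (simp add: singular_simplex_def euclidean_product_topology)

lemma singular_simplex_edge:
  assumes "singular_simplex (Suc 0) X s"
  shows "continuous_map (top_of_set {0..1}) X (s \<circ> simplex_edge)"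
  by (rule continuous_map_compose [OF _ singular_simplex_euclidean[OF assms]])
    (auto simp: continuous_simplex_edge simplex_edge_in image_subset_iff)

text \<open>The integral of du/u over the chain, defined without differentiability; it is meaningful
  for chains that avoid the zeros of \<open>u\<close>.\<close>

definition chain_log_var :: "('a \<Rightarrow> complex) \<Rightarrow> 'a chain \<Rightarrow> complex"
  where "chain_log_var u c =
    (\<Sum>s\<in>Poly_Mapping.keys c. of_int (Poly_Mapping.lookup c s) * log_var (u \<circ> s \<circ> simplex_edge))"

lemma chain_log_var_superset:
  assumes "finite A" "Poly_Mapping.keys c \<subseteq> A"
  shows "chain_log_var u c = (\<Sum>s\<in>A. of_int (Poly_Mapping.lookup c s) * log_var (u \<circ> s \<circ> simplex_edge))"
  unfolding chain_log_var_def
  by (rule sum.mono_neutral_left) (use assms in \<open>auto simp: in_keys_iff\<close>)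

lemma chain_log_var_0 [simp]: "chain_log_var u 0 = 0"
  by (simp add: chain_log_var_def)

lemma chain_log_var_of [simp]: "chain_log_var u (frag_of s) = log_var (u \<circ> s \<circ> simplex_edge)"
  by (simp add: chain_log_var_def)

lemma chain_log_var_add: "chain_log_var u (a + b) = chain_log_var u a + chain_log_var u b"
proof -
  let ?A = "Poly_Mapping.keys a \<union> Poly_Mapping.keys b"
  have "chain_log_var u c = (\<Sum>s\<in>?A. of_int (Poly_Mapping.lookup c s) * log_var (u \<circ> s \<circ> simplex_edge))"
    if "c \<in> {a, b, a + b}" for c
    by (rule chain_log_var_superset) (use that Poly_Mapping.keys_add[of a b] in auto)
  then show ?thesis
    by (simp add: lookup_add distrib_right sum.distrib)
qed

lemma chain_log_var_minus: "chain_log_var u (- a) = - chain_log_var u a"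
  by (simp add: chain_log_var_def sum_negf)

lemma chain_log_var_diff: "chain_log_var u (a - b) = chain_log_var u a - chain_log_var u b"
  using chain_log_var_add[of u a "-b"] by (simp add: chain_log_var_minus)

lemma chain_log_var_chain_map:
  assumes "singular_chain (Suc 0) X c"
  shows "chain_log_var u (chain_map (Suc 0) k c) = chain_log_var (u \<circ> k) c"
  using assms unfolding singular_chain_def
proof (induction c rule: frag_induction)
  case (one s)
  \<comment> \<open>\<open>simplex_map\<close> is restricted to the standard simplex, but
    \<open>log_var\<close> looks only at times in the unit interval, so the restriction is invisible
    to it.\<close>
  have "log_var (u \<circ> simplex_map (Suc 0) k s \<circ> simplex_edge) = log_var (u \<circ> k \<circ> s \<circ> simplex_edge)"
    unfolding log_var_def simplex_map_def by (simp add: simplex_edge_in)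
  then show ?case by (simp only: chain_map_of chain_log_var_of)
qed (auto simp: chain_map_diff chain_log_var_diff)

lemma continuous_map_edge:
  assumes "singular_simplex (Suc 0) X s" "continuous_map X euclidean u"
  shows "continuous_on {0..1} (u \<circ> s \<circ> simplex_edge)"
  using continuous_map_compose [OF singular_simplex_edge[OF assms(1)] assms(2)]
  by (simp add: o_assoc)

lemma singular_simplex_edge_in:
  assumes "singular_simplex (Suc 0) X s" "t \<in> {0..1}"
  shows "s (simplex_edge t) \<in> topspace X"
  using singular_simplex_edge[OF assms(1)] assms(2)
  by (auto simp: continuous_map_def)

lemma chain_log_var_mult:
  assumes "singular_chain (Suc 0) X c"
    and "continuous_map X euclidean u" "\<And>x. x \<in> topspace X \<Longrightarrow> u x \<noteq> 0"
    and "continuous_map X euclidean v" "\<And>x. x \<in> topspace X \<Longrightarrow> v x \<noteq> 0"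
  shows "chain_log_var (\<lambda>x. u x * v x) c = chain_log_var u c + chain_log_var v c"
  using assms(1) unfolding singular_chain_def
proof (induction c rule: frag_induction)
  case (one s)
  then have s: "singular_simplex (Suc 0) X s" by simp
  have "log_var (\<lambda>t. (u \<circ> s \<circ> simplex_edge) t * (v \<circ> s \<circ> simplex_edge) t)
      = log_var (u \<circ> s \<circ> simplex_edge) + log_var (v \<circ> s \<circ> simplex_edge)"
    by (rule log_var_mult)
       (use continuous_map_edge[OF s] assms singular_simplex_edge_in[OF s] in auto)
  then show ?case by (simp add: o_def)
qed (auto simp: chain_log_var_diff)

text \<open>The simplex lies in a function space; the plane triangle \<open>T\<close>, to which the
  theorem on contractible subsets of normed spaces applies, parametrizes it through
  \<open>e\<close>, with inverse \<open>q\<close>.\<close>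

lemma continuous_log_on_simplex:
  fixes \<phi> :: "(nat \<Rightarrow> real) \<Rightarrow> complex"
  assumes "continuous_on (standard_simplex 2) \<phi>" "\<And>x. x \<in> standard_simplex 2 \<Longrightarrow> \<phi> x \<noteq> 0"
  obtains g where "continuous_on (standard_simplex 2) g" "\<And>x. x \<in> standard_simplex 2 \<Longrightarrow> \<phi> x = exp (g x)"
proof -
  define T where "T = {p::real\<times>real. 0 \<le> fst p \<and> 0 \<le> snd p \<and> fst p + snd p \<le> 1}"
  define e where "e = (\<lambda>p::real\<times>real. \<lambda>j::nat. if j = 0 then 1 - fst p - snd p else if j = 1 then fst p else if j = 2 then snd p else 0)"
  have conv: "convex T"
  proof (rule convexI)
    fix p q :: "real \<times> real" and u v :: real
    assume pq: "p \<in> T" "q \<in> T" and uv: "0 \<le> u" "0 \<le> v" "u + v = 1"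
    have "u * (fst p + snd p) + v * (fst q + snd q) \<le> u * 1 + v * 1"
      using pq uv by (intro add_mono mult_left_mono) (auto simp: T_def)
    then show "u *\<^sub>R p + v *\<^sub>R q \<in> T"
      using pq uv by (auto simp: T_def algebra_simps)
  qed
  have conte: "continuous_on T e"
  proof (rule continuous_on_coordinatewise_then_product)
    show "continuous_on T (\<lambda>p. e p i)" for i
      unfolding e_def
      by (cases "i = 0"; cases "i = 1"; cases "i = 2") (auto intro!: continuous_intros)
  qed
  have eT: "e ` T \<subseteq> standard_simplex 2"
    by (auto simp: e_def T_def standard_simplex_def numeral_2_eq_2)
  have "continuous_on T (\<phi> \<circ> e)"
    by (rule continuous_on_compose [OF conte]) (rule continuous_on_subset [OF assms(1) eT])
  moreover have "(\<phi> \<circ> e) p \<noteq> 0" if "p \<in> T" for p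
    using assms(2) eT that by auto
  ultimately obtain h where h: "continuous_on T h" "\<And>p. p \<in> T \<Longrightarrow> (\<phi> \<circ> e) p = exp (h p)"
    using continuous_logarithm_on_contractible [of T "\<phi> \<circ> e"] convex_imp_contractible[OF conv] by metis
  define q where "q = (\<lambda>x::nat\<Rightarrow>real. (x 1, x 2))"
  have contq: "continuous_on (standard_simplex 2) q"
    unfolding q_def by (intro continuous_intros continuous_on_product_then_coordinatewise[OF continuous_on_id])
  have qT: "q ` standard_simplex 2 \<subseteq> T"
  proof clarsimp
    fix x assume x: "x \<in> standard_simplex 2"
    then have "x 0 + x 1 + x 2 = 1" "0 \<le> x 0" "0 \<le> x 1" "0 \<le> x 2"
      by (auto simp: standard_simplex_def numeral_2_eq_2)
    then show "q x \<in> T"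
      by (auto simp: q_def T_def)
  qed
  have eq: "e (q x) = x" if "x \<in> standard_simplex 2" for x
  proof
    fix j :: nat
    have "x 0 + x 1 + x 2 = 1" "\<And>i. i > 2 \<Longrightarrow> x i = 0"
      using that by (auto simp: standard_simplex_def numeral_2_eq_2)
    moreover have "j = 0 \<or> j = 1 \<or> j = 2 \<or> j > 2" by linarith
    ultimately show "e (q x) j = x j"
      by (auto simp: e_def q_def)
  qed
  show ?thesis
  proof
    show "continuous_on (standard_simplex 2) (h \<circ> q)"
      by (rule continuous_on_compose [OF contq continuous_on_subset [OF h(1) qT]])
    show "\<phi> x = exp ((h \<circ> q) x)" if "x \<in> standard_simplex 2" for x
      using h(2)[of "q x"] qT eq[OF that] that by auto
  qed
qed

text \<open>A nonvanishing function has a logarithm on the whole 2-simplex, so the three edges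
  contribute differences of its values at the vertices, and these cancel. Hence
  \<open>chain_log_var\<close> of a cycle depends only on the homology class.\<close>

lemma chain_log_var_boundary:
  assumes "singular_chain 2 X c"
    and u: "continuous_map X euclidean u" "\<And>x. x \<in> topspace X \<Longrightarrow> u x \<noteq> 0"
  shows "chain_log_var u (chain_boundary 2 c) = 0"
  using assms(1) unfolding singular_chain_def
proof (induction c rule: frag_induction)
  case (one s)
  then have s: "singular_simplex 2 X s" by simp
  have cs: "continuous_map (top_of_set (standard_simplex 2)) X s"
    by (rule singular_simplex_euclidean[OF s])
  have "continuous_on (standard_simplex 2) (u \<circ> s)"
    using continuous_map_compose[OF cs u(1)] by simp
  moreover have "(u \<circ> s) x \<noteq> 0" if "x \<in> standard_simplex 2" for x
    using cs u(2) that by (auto simp: continuous_map_def)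
  ultimately obtain g where g: "continuous_on (standard_simplex 2) g"
      "\<And>x. x \<in> standard_simplex 2 \<Longrightarrow> (u \<circ> s) x = exp (g x)"
    using continuous_log_on_simplex by metis
  have face: "log_var (u \<circ> singular_face 2 k s \<circ> simplex_edge)
      = g (simplical_face k (simplex_edge 1)) - g (simplical_face k (simplex_edge 0))" if "k \<le> 2" for k
  proof -
    have in2: "simplical_face k (simplex_edge t) \<in> standard_simplex 2" if "t \<in> {0..1}" for t
      using simplical_face_in_standard_simplex[of 2 k "simplex_edge t"] simplex_edge_in[OF that] \<open>k \<le> 2\<close> by simp
    have cont: "continuous_on {0..1} (\<lambda>t. simplical_face k (simplex_edge t))"
    proof (rule continuous_on_coordinatewise_then_product)
      have "continuous_on {0..1} (\<lambda>t. simplex_edge t i)" for i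
        by (rule continuous_on_product_then_coordinatewise[OF continuous_simplex_edge])
      then show "continuous_on {0..1} (\<lambda>t. simplical_face k (simplex_edge t) i)" for i
        unfolding simplical_face_def by (cases "i < k"; cases "i = k") auto
    qed
    show ?thesis
    proof (rule log_var_eq)
      show "continuous_on {0..1} (\<lambda>t. g (simplical_face k (simplex_edge t)))"
        by (rule continuous_on_compose2 [OF g(1) cont]) (use in2 in auto)
      show "(u \<circ> singular_face 2 k s \<circ> simplex_edge) t = exp (g (simplical_face k (simplex_edge t)))"
        if "t \<in> {0..1}" for t
        using g(2)[OF in2[OF that]] simplex_edge_in[OF that] by (simp add: singular_face_def)
    qed
  qed
  have v: "simplical_face 0 (simplex_edge 0) = simplical_face 2 (simplex_edge 1)"
    "simplical_face 0 (simplex_edge 1) = simplical_face 1 (simplex_edge 1)"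
    "simplical_face 1 (simplex_edge 0) = simplical_face 2 (simplex_edge 0)"
    by (auto simp: simplical_face_def simplex_edge_def fun_eq_iff)
  have "chain_boundary 2 (frag_of s) = frag_of (singular_face 2 0 s) - frag_of (singular_face 2 1 s) + frag_of (singular_face 2 2 s)"
    by (simp add: chain_boundary_of numeral_2_eq_2)
  then show ?case
    using v by (simp add: chain_log_var_add chain_log_var_diff face)
qed (auto simp: chain_boundary_diff chain_log_var_diff)

section \<open>Homology of the complement of two disjoint closed sets\<close>

lemma homologous_rel_set_int_pow:
  assumes "singular_relcycle p X S c"
  shows "homologous_rel_set p X S c [^]\<^bsub>relative_homology_group (int p) X S\<^esub> (n::int) =
         homologous_rel_set p X S (frag_cmul n c)"
proof -
  let ?G = "relcycle_group p X S" and ?H = "relative_homology_group (int p) X S"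
  have "(\<lambda>a. singular_relboundary_set p X S #>\<^bsub>?G\<^esub> a) \<in> hom ?G (?G Mod singular_relboundary_set p X S)"
    using normal.r_coset_hom_Mod [OF normal_subgroup_singular_relboundary_relcycle] .
  then have "homologous_rel_set p X S \<in> hom ?G ?H"
    unfolding right_coset_singular_relboundary nontrivial_relative_homology_group by simp
  then interpret group_hom ?G ?H "homologous_rel_set p X S"
    by (simp add: group_hom_def group_hom_axioms_def)
  have c: "c \<in> carrier ?G"
    using assms by simp
  have "c [^]\<^bsub>?G\<^esub> n = frag_cmul n c"
  proof -
    have "c [^]\<^bsub>?G\<^esub> n = c [^]\<^bsub>chain_group p X\<^esub> n"
      unfolding relcycle_group_def
      by (rule group.int_pow_subgroup_generated) (use c in \<open>simp_all add: relcycle_group_def\<close>)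
    also have "\<dots> = frag_cmul n c"
      using assms by (simp add: chain_group_def int_pow_free_Abelian_group singular_relcycle singular_chain_def)
    finally show ?thesis .
  qed
  then show ?thesis
    using hom_int_pow[OF c, of n] by simp
qed

lemma trivial_homology_contractible:
  assumes "contractible_space X" "p \<noteq> 0"
  shows "trivial_group (homology_group p X)"
  using trivial_reduced_homology_group_contractible_space[OF assms(1), of p] assms(2)
  by (simp add: un_reduced_homology_group)

lemma exact_seq_trivial_surj:
  assumes "exact_seq ([C, B, A], [g, f])" "trivial_group C"
  shows "f ` carrier A = carrier B"
proof -
  have "f ` carrier A = kernel B C g" and g: "g \<in> hom B C"
    using assms(1) by (auto elim!: exact_seq.cases simp: group_hom_def group_hom_axioms_def)
  moreover have "kernel B C g = carrier B"
    using assms(2) g by (auto simp: kernel_def trivial_group_def hom_def Pi_iff)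
  ultimately show ?thesis by simp
qed

text \<open>Naturality of the Mayer-Vietoris connecting map \<open>H\<^sub>2(X) \<rightarrow> H\<^sub>1(X - P - Q)\<close>, written out through excision.\<close>

lemma Mayer_Vietoris_cycle:
  fixes X :: "'a topology" and D :: "('a \<Rightarrow> 'a) \<Rightarrow> int"
  assumes PQ: "closedin X P" "closedin X Q" "P \<inter> Q = {}"
    and PQ0: "closedin X P0" "closedin X Q0" "P0 \<inter> Q0 = {}"
    and contr: "contractible_space (subtopology X (topspace X - P0))" "contractible_space (subtopology X (topspace X - Q0))"
    and c0: "singular_relcycle 1 (subtopology X (topspace X - P0 - Q0)) {} c0"
    and D: "\<And>k x. continuous_map X X k \<Longrightarrow> x \<in> carrier (homology_group 2 X) \<Longrightarrow>
       hom_induced 2 X {} X {} k x = x [^]\<^bsub>homology_group 2 X\<^esub> (D k)"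
  obtains c where "singular_relcycle 1 (subtopology X (topspace X - P - Q)) {} c"
    "\<And>k. \<lbrakk>continuous_map X X k; k \<in> topspace X - P \<rightarrow> topspace X - P0; k \<in> topspace X - Q \<rightarrow> topspace X - Q0\<rbrakk> \<Longrightarrow>
       homologous_rel 1 (subtopology X (topspace X - P0 - Q0)) {} (chain_map 1 k c) (frag_cmul (D k) c0)"
proof -
  define XQ where "XQ = (\<lambda>Q. subtopology X (topspace X - Q))"
  define R where "R = (\<lambda>P Q. relative_homology_group 2 (XQ Q) (topspace X - P - Q))"
  define R' where "R' = (\<lambda>P. relative_homology_group 2 X (topspace X - P))"
  define inc where "inc = (\<lambda>P Q. hom_induced 2 (XQ Q) (topspace X - P - Q) X (topspace X - P) id)"
  define j where "j = (\<lambda>P. hom_induced 2 X {} X (topspace X - P) id)"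
  define bd where "bd = (\<lambda>P Q. hom_boundary 2 (XQ Q) (topspace X - P - Q))"
  have exc: "inc P Q \<in> iso (R P Q) (R' P)" if "closedin X P" "closedin X Q" "P \<inter> Q = {}" for P Q
  proof -
    have "Q \<subseteq> topspace X" using that closedin_subset by blast
    have "X closure_of Q \<subseteq> X interior_of (topspace X - P)"
      using that \<open>Q \<subseteq> topspace X\<close>
      by (simp add: closure_of_closedin interior_of_openin openin_diff) blast
    from homology_excision_axiom[OF this, of "topspace X" 2]
    show ?thesis
      by (simp add: inc_def R_def R'_def XQ_def)
  qed
  have sub: "subtopology (XQ Q) (topspace X - P - Q) = subtopology X (topspace X - P - Q)" for P Q
    unfolding XQ_def subtopology_subtopology by (rule arg_cong[where f="subtopology X"]) auto
  have bd: "bd P Q \<in> hom (R P Q) (homology_group 1 (subtopology X (topspace X - P - Q)))" for P Q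
    using hom_boundary_hom[of 2 "XQ Q" "topspace X - P - Q"] unfolding bd_def R_def sub by simp
  have j: "j P \<in> hom (homology_group 2 X) (R' P)" for P
    unfolding j_def R'_def by (rule hom_induced_hom)
  let ?H2 = "homology_group 2 X"
  let ?A = "subtopology X (topspace X - P0 - Q0)"
  define y0 where "y0 = homologous_rel_set 1 ?A {} c0"
  have y0: "y0 \<in> carrier (homology_group 1 ?A)"
    using c0 carrier_relative_homology_group[of 1 ?A "{}"] by (auto simp: y0_def)
  \<comment> \<open>\<open>X - Q0\<close> is contractible, so its first homology vanishes and
    exactness makes the boundary map onto.\<close>
  have "bd P0 Q0 ` carrier (R P0 Q0) = carrier (homology_group 1 ?A)"
  proof -
    have "exact_seq ([homology_group 1 (XQ Q0), homology_group 1 ?A, R P0 Q0],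
       [hom_induced 1 ?A {} (XQ Q0) {} id, bd P0 Q0])"
      using homology_exactness_axiom_2[of 2 "XQ Q0" "topspace X - P0 - Q0"]
      unfolding sub R_def bd_def by simp
    then show ?thesis
      by (rule exact_seq_trivial_surj) (simp add: trivial_homology_contractible contr XQ_def)
  qed
  then obtain \<xi>0 where \<xi>0: "\<xi>0 \<in> carrier (R P0 Q0)" "bd P0 Q0 \<xi>0 = y0"
    using y0 by (metis imageE)
  have "j P0 ` carrier ?H2 = carrier (R' P0)"
  proof -
    have "exact_seq ([homology_group 1 (XQ P0), R' P0, ?H2], [hom_boundary 2 X (topspace X - P0), j P0])"
      using homology_exactness_axiom_1[of 2 X "topspace X - P0"] unfolding XQ_def R'_def j_def by simp
    then show ?thesis
      by (rule exact_seq_trivial_surj) (simp add: trivial_homology_contractible contr XQ_def)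
  qed
  moreover have inc0: "inc P0 Q0 \<in> iso (R P0 Q0) (R' P0)"
    by (rule exc[OF PQ0])
  then have "inc P0 Q0 \<xi>0 \<in> carrier (R' P0)"
    using \<xi>0(1) by (auto simp: iso_def hom_def Pi_iff)
  ultimately obtain x where x: "x \<in> carrier ?H2" "j P0 x = inc P0 Q0 \<xi>0"
    by (metis imageE)
  \<comment> \<open>The class \<open>x\<close> and the cycle extracted from it are fixed before any
    map \<open>k\<close> is given, so the conclusion holds for all \<open>k\<close> with one and the
    same cycle.\<close>
  have inc: "inc P Q \<in> iso (R P Q) (R' P)"
    by (rule exc[OF PQ])
  moreover have "j P x \<in> carrier (R' P)"
    using j x(1) by (auto simp: hom_def Pi_iff)
  ultimately obtain \<xi> where \<xi>: "\<xi> \<in> carrier (R P Q)" "inc P Q \<xi> = j P x"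
    by (metis (no_types, lifting) bij_betw_imp_surj_on imageE iso_iff)
  let ?U = "subtopology X (topspace X - P - Q)"
  have "bd P Q \<xi> \<in> carrier (homology_group 1 ?U)"
    using bd \<xi>(1) by (auto simp: hom_def Pi_iff)
  then obtain c where c: "singular_relcycle 1 ?U {} c" "bd P Q \<xi> = homologous_rel_set 1 ?U {} c"
    using carrier_relative_homology_group[of 1 ?U "{}"] by auto
  show thesis
  proof (rule that[OF c(1)])
    fix k
    assume k: "continuous_map X X k" and kP: "k \<in> topspace X - P \<rightarrow> topspace X - P0"
      and kQ: "k \<in> topspace X - Q \<rightarrow> topspace X - Q0"
    have kPQ: "k \<in> topspace X - P - Q \<rightarrow> topspace X - P0 - Q0"
      using kP kQ by auto
    have kX: "continuous_map (XQ Q) (XQ Q0) k"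
      unfolding XQ_def using k kQ by (auto simp: continuous_map_in_subtopology continuous_map_from_subtopology)
    have kU: "continuous_map ?U ?A k"
      using k kPQ by (auto simp: continuous_map_in_subtopology continuous_map_from_subtopology)
    define kk where "kk = hom_induced 2 (XQ Q) (topspace X - P - Q) (XQ Q0) (topspace X - P0 - Q0) k"
    have kkR: "kk \<xi> \<in> carrier (R P0 Q0)"
      unfolding kk_def R_def by (rule hom_induced_carrier)
    \<comment> \<open>Inclusions commute with \<open>k\<close>, so after excision the class
      \<open>kk \<xi>\<close> becomes the image of \<open>k\<close> applied to \<open>x\<close>,
      where \<open>k\<close> acts as the power \<open>D k\<close>; injectivity of
      \<open>inc P0 Q0\<close> brings the equation back.\<close>
    have "inc P0 Q0 (kk \<xi>) = hom_induced 2 (XQ Q) (topspace X - P - Q) X (topspace X - P0) (id \<circ> k) \<xi>"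
      unfolding inc_def kk_def
      by (rule hom_induced_compose'[OF kX kPQ]) (auto simp: XQ_def continuous_map_from_subtopology)
    also have "\<dots> = hom_induced 2 X (topspace X - P) X (topspace X - P0) k (inc P Q \<xi>)"
      unfolding inc_def
      by (subst hom_induced_compose') (use k kP in \<open>auto simp: XQ_def continuous_map_from_subtopology\<close>)
    also have "\<dots> = hom_induced 2 X {} X (topspace X - P0) (k \<circ> id) x"
      unfolding \<xi>(2) j_def by (rule hom_induced_compose') (use k kP in auto)
    also have "\<dots> = j P0 (hom_induced 2 X {} X {} k x)"
      unfolding j_def by (subst hom_induced_compose') (use k in auto)
    also have "\<dots> = j P0 (x [^]\<^bsub>?H2\<^esub> D k)"
      using D[OF k x(1)] by simp
    also have "\<dots> = (j P0 x) [^]\<^bsub>R' P0\<^esub> D k"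
      by (rule group_hom.hom_int_pow) (use j x in \<open>auto simp: group_hom_def group_hom_axioms_def R'_def\<close>)
    also have "\<dots> = inc P0 Q0 (\<xi>0 [^]\<^bsub>R P0 Q0\<^esub> D k)"
      unfolding x(2)
      by (rule group_hom.hom_int_pow[symmetric])
         (use inc0 \<xi>0 in \<open>auto simp: group_hom_def group_hom_axioms_def R'_def R_def iso_def\<close>)
    finally have "inc P0 Q0 (kk \<xi>) = inc P0 Q0 (\<xi>0 [^]\<^bsub>R P0 Q0\<^esub> D k)" .
    moreover have "\<xi>0 [^]\<^bsub>R P0 Q0\<^esub> D k \<in> carrier (R P0 Q0)"
      by (rule group.int_pow_closed) (use \<xi>0 in \<open>auto simp: R_def\<close>)
    ultimately have kk: "kk \<xi> = \<xi>0 [^]\<^bsub>R P0 Q0\<^esub> D k"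
      using inc0 kkR by (auto simp: iso_def bij_betw_def inj_on_def)
    have "hom_induced 1 ?U {} ?A {} k (bd P Q \<xi>) = bd P0 Q0 (kk \<xi>)"
      using fun_cong[OF naturality_hom_induced[OF kX kPQ, of 2], of \<xi>]
      unfolding sub bd_def kk_def by simp
    also have "\<dots> = y0 [^]\<^bsub>homology_group 1 ?A\<^esub> D k"
      unfolding kk \<xi>0(2)[symmetric]
      by (rule group_hom.hom_int_pow) (use bd \<xi>0 in \<open>auto simp: group_hom_def group_hom_axioms_def R_def\<close>)
    also have "\<dots> = homologous_rel_set 1 ?A {} (frag_cmul (D k) c0)"
      using homologous_rel_set_int_pow[OF c0, of "D k"] unfolding y0_def by simp
    finally have "hom_induced 1 ?U {} ?A {} k (homologous_rel_set 1 ?U {} c) = homologous_rel_set 1 ?A {} (frag_cmul (D k) c0)"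
      unfolding c(2) .
    moreover have "hom_induced 1 ?U {} ?A {} k (homologous_rel_set 1 ?U {} c) = homologous_rel_set 1 ?A {} (chain_map 1 k c)"
      using hom_induced_chain_map[OF kU _ c(1), of "{}"] by simp
    ultimately show "homologous_rel 1 ?A {} (chain_map 1 k c) (frag_cmul (D k) c0)"
      using homologous_rel_set_eq by metis
  qed
qed

section \<open>Degree of self-maps of the unit sphere\<close>

definition Sph :: "(complex \<times> real) set"
  where "Sph = sphere 0 1"

lemma Sph_iff: "x \<in> Sph \<longleftrightarrow> (cmod (fst x))\<^sup>2 + (snd x)\<^sup>2 = 1"
  by (cases x) (simp add: Sph_def norm_prod_def)

lemma Sph_snd_le: assumes "x \<in> Sph" shows "\<bar>snd x\<bar> \<le> 1"
proof -
  have "(snd x)\<^sup>2 \<le> 1"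
    using assms zero_le_power2[of "cmod (fst x)"] unfolding Sph_iff by linarith
  then show ?thesis by (simp add: abs_square_le_1)
qed

lemma cmod_fst_Sph: assumes "x \<in> Sph" shows "cmod (fst x) = sqrt (1 - (snd x)\<^sup>2)"
  by (rule real_sqrt_unique[symmetric]) (use assms in \<open>auto simp: Sph_iff\<close>)

lemma pole_in_Sph [simp]: "(0, -1) \<in> Sph" "(0, 1) \<in> Sph"
  unfolding Sph_iff by simp_all

lemma Sph_snd_eq:
  assumes "x \<in> Sph"
  shows "snd x = 1 \<longleftrightarrow> x = (0, 1)" "snd x = -1 \<longleftrightarrow> x = (0, -1)"
  using cmod_fst_Sph[OF assms] by (auto simp: prod_eq_iff)

lemma Sph_fst_eq_0:
  assumes "x \<in> Sph"
  shows "fst x = 0 \<longleftrightarrow> x = (0, 1) \<or> x = (0, -1)"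
proof
  assume "fst x = 0"
  then have "(snd x)\<^sup>2 = 1" using assms unfolding Sph_iff by simp
  then show "x = (0, 1) \<or> x = (0, -1)"
    using Sph_snd_eq[OF assms] power2_eq_1_iff by blast
qed auto

lemma Sph_snd_less:
  assumes "x \<in> Sph"
  shows "\<bar>snd x\<bar> < 1 \<longleftrightarrow> x \<noteq> (0, 1) \<and> x \<noteq> (0, -1)"
proof -
  have "\<bar>snd x\<bar> < 1 \<longleftrightarrow> snd x \<noteq> 1 \<and> snd x \<noteq> -1"
    using Sph_snd_le[OF assms] by linarith
  then show ?thesis using Sph_snd_eq[OF assms] by simp
qed

definition nsphere_to_Sph :: "(nat \<Rightarrow> real) \<Rightarrow> complex \<times> real"
  where "nsphere_to_Sph x = (Complex (x 0) (x 1), x 2)"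

definition Sph_to_nsphere :: "complex \<times> real \<Rightarrow> nat \<Rightarrow> real"
  where "Sph_to_nsphere p = (\<lambda>i. if i = 0 then Re (fst p) else if i = 1 then Im (fst p) else if i = 2 then snd p else 0)"

lemma nsphere_2_euclidean:
  "nsphere 2 = top_of_set {x. (x 0)\<^sup>2 + (x 1)\<^sup>2 + (x 2)\<^sup>2 = 1 \<and> (\<forall>i>2. x i = (0::real))}"
  by (simp add: nsphere euclidean_product_topology numeral_2_eq_2)

lemma homeomorphic_maps_nsphere_Sph:
  "homeomorphic_maps (nsphere 2) (top_of_set Sph) nsphere_to_Sph Sph_to_nsphere"
  unfolding homeomorphic_maps_def
proof (intro conjI)
  show "continuous_map (nsphere 2) (top_of_set Sph) nsphere_to_Sph"
    unfolding nsphere_2_euclidean nsphere_to_Sph_def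
    by (auto intro!: continuous_intros continuous_on_product_then_coordinatewise[OF continuous_on_id]
        simp: Sph_iff cmod_power2 image_subset_iff)
  have "continuous_on Sph Sph_to_nsphere"
  proof (rule continuous_on_coordinatewise_then_product)
    show "continuous_on Sph (\<lambda>p. Sph_to_nsphere p i)" for i
      unfolding Sph_to_nsphere_def
      by (cases "i = 0"; cases "i = 1"; cases "i = 2") (auto intro!: continuous_intros)
  qed
  then show "continuous_map (top_of_set Sph) (nsphere 2) Sph_to_nsphere"
    unfolding nsphere_2_euclidean
    by (auto simp: Sph_iff cmod_power2 image_subset_iff Sph_to_nsphere_def)
  show "\<forall>x\<in>topspace (nsphere 2). Sph_to_nsphere (nsphere_to_Sph x) = x"
    unfolding nsphere_2_euclidean
  proof clarsimp
    fix x :: "nat \<Rightarrow> real" assume x: "\<forall>i>2. x i = 0"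
    show "Sph_to_nsphere (nsphere_to_Sph x) = x"
    proof
      fix j :: nat
      have "j = 0 \<or> j = 1 \<or> j = 2 \<or> j > 2" by linarith
      then show "Sph_to_nsphere (nsphere_to_Sph x) j = x j"
        using x by (auto simp: Sph_to_nsphere_def nsphere_to_Sph_def)
    qed
  qed
  show "\<forall>y\<in>topspace (top_of_set Sph). nsphere_to_Sph (Sph_to_nsphere y) = y"
    by (auto simp: Sph_to_nsphere_def nsphere_to_Sph_def complex_eq_iff)
qed

lemma continuous_map_nsphere_Sph:
  "continuous_map (nsphere 2) (top_of_set Sph) nsphere_to_Sph"
  "continuous_map (top_of_set Sph) (nsphere 2) Sph_to_nsphere"
  and nsphere_to_Sph_inverse: "x \<in> Sph \<Longrightarrow> nsphere_to_Sph (Sph_to_nsphere x) = x"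
  and Sph_to_nsphere_inverse: "y \<in> topspace (nsphere 2) \<Longrightarrow> Sph_to_nsphere (nsphere_to_Sph y) = y"
  using homeomorphic_maps_nsphere_Sph by (auto simp: homeomorphic_maps_def)

definition sph_degree :: "(complex \<times> real \<Rightarrow> complex \<times> real) \<Rightarrow> int"
  where "sph_degree F = Brouwer_degree2 2 (Sph_to_nsphere \<circ> F \<circ> nsphere_to_Sph)"

abbreviation sph_map :: "(complex \<times> real \<Rightarrow> complex \<times> real) \<Rightarrow> bool"
  where "sph_map F \<equiv> continuous_map (top_of_set Sph) (top_of_set Sph) F"

lemma sph_map_conj:
  "sph_map F \<Longrightarrow> continuous_map (nsphere 2) (nsphere 2) (Sph_to_nsphere \<circ> F \<circ> nsphere_to_Sph)"
  using continuous_map_nsphere_Sph by (meson continuous_map_compose)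

text \<open>Conjugation with \<open>nsphere 2\<close> carries the action of
  \<open>Brouwer_degree2\<close> over to the second homology of \<open>Sph\<close>; in dimension 2
  reduced and unreduced homology agree.\<close>

lemma sph_degree_hom_induced:
  assumes F: "sph_map F" and x: "x \<in> carrier (homology_group 2 (top_of_set Sph))"
  shows "hom_induced 2 (top_of_set Sph) {} (top_of_set Sph) {} F x
       = x [^]\<^bsub>homology_group 2 (top_of_set Sph)\<^esub> (sph_degree F)"
proof -
  let ?X = "top_of_set Sph" and ?N = "nsphere 2"
  let ?J = "hom_induced 2 ?N {} ?X {} nsphere_to_Sph" and ?J' = "hom_induced 2 ?X {} ?N {} Sph_to_nsphere"
  let ?f = "Sph_to_nsphere \<circ> F \<circ> nsphere_to_Sph"
  have un: "reduced_homology_group 2 ?N = homology_group 2 ?N"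
    by (rule un_reduced_homology_group) simp
  have J'x: "?J' x \<in> carrier (homology_group 2 ?N)"
    by (rule hom_induced_carrier)
  have id: "?J (?J' y) = y" if "y \<in> carrier (homology_group 2 ?X)" for y
  proof -
    have "?J (?J' y) = hom_induced 2 ?X {} ?X {} (nsphere_to_Sph \<circ> Sph_to_nsphere) y"
      by (rule hom_induced_compose') (use continuous_map_nsphere_Sph in auto)
    also have "\<dots> = y"
      by (rule hom_induced_id_gen)
         (use that continuous_map_compose[OF continuous_map_nsphere_Sph(2) continuous_map_nsphere_Sph(1)]
            nsphere_to_Sph_inverse in auto)
    finally show ?thesis .
  qed
  have "hom_induced 2 ?X {} ?X {} F x = ?J (?J' (hom_induced 2 ?X {} ?X {} F x))"
    by (rule id[OF hom_induced_carrier, symmetric])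
  also have "\<dots> = ?J (hom_induced 2 ?X {} ?N {} (Sph_to_nsphere \<circ> F) (?J (?J' x)))"
    using hom_induced_compose'[OF F _ continuous_map_nsphere_Sph(2), of "{}" "{}" "{}" 2 x] id[OF x] by simp
  also have "\<dots> = ?J (hom_induced 2 ?N {} ?N {} ?f (?J' x))"
    by (subst hom_induced_compose'[OF continuous_map_nsphere_Sph(1) _ continuous_map_compose[OF F continuous_map_nsphere_Sph(2)]])
       (auto simp: o_assoc)
  also have "\<dots> = ?J ((?J' x) [^]\<^bsub>homology_group 2 ?N\<^esub> (sph_degree F))"
    using Brouwer_degree2[of "?J' x" 2 ?f] J'x by (simp add: un sph_degree_def)
  also have "\<dots> = (?J (?J' x)) [^]\<^bsub>homology_group 2 ?X\<^esub> (sph_degree F)"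
    by (rule group_hom.hom_int_pow) (use J'x hom_induced_hom in \<open>auto simp: group_hom_def group_hom_axioms_def\<close>)
  finally show ?thesis
    using id[OF x] by simp
qed

lemma sph_degree_homotopic:
  assumes "homotopic_with_canon (\<lambda>_. True) Sph Sph F G"
  shows "sph_degree F = sph_degree G"
  unfolding sph_degree_def
proof (rule Brouwer_degree2_homotopic)
  show "homotopic_with (\<lambda>x. True) (nsphere 2) (nsphere 2)
     (Sph_to_nsphere \<circ> F \<circ> nsphere_to_Sph) (Sph_to_nsphere \<circ> G \<circ> nsphere_to_Sph)"
    using assms
    by (auto intro: homotopic_with_compose_continuous_map_left homotopic_with_compose_continuous_map_right
        continuous_map_nsphere_Sph)
qed

lemma nsphere_to_Sph_in: "x \<in> topspace (nsphere 2) \<Longrightarrow> nsphere_to_Sph x \<in> Sph"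
  and Sph_to_nsphere_in: "y \<in> Sph \<Longrightarrow> Sph_to_nsphere y \<in> topspace (nsphere 2)"
  using continuous_map_nsphere_Sph by (auto simp: continuous_map_def)

lemma sph_degree_cong:
  assumes "\<And>x. x \<in> Sph \<Longrightarrow> F x = G x"
  shows "sph_degree F = sph_degree G"
  unfolding sph_degree_def
  by (rule Brouwer_degree2_eq) (use assms nsphere_to_Sph_in in auto)

lemma sph_degree_id: "sph_degree (\<lambda>x. x) = 1"
proof -
  have "sph_degree (\<lambda>x. x) = Brouwer_degree2 2 id"
    unfolding sph_degree_def by (rule Brouwer_degree2_eq) (simp add: Sph_to_nsphere_inverse)
  then show ?thesis by simp
qed

lemma sph_degree_compose:
  assumes "sph_map F" "sph_map G"
  shows "sph_degree (G \<circ> F) = sph_degree G * sph_degree F"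
proof -
  have "sph_degree (G \<circ> F) = Brouwer_degree2 2 ((Sph_to_nsphere \<circ> G \<circ> nsphere_to_Sph) \<circ> (Sph_to_nsphere \<circ> F \<circ> nsphere_to_Sph))"
    unfolding sph_degree_def
  proof (rule Brouwer_degree2_eq)
    fix x assume "x \<in> topspace (nsphere 2)"
    then have "F (nsphere_to_Sph x) \<in> Sph"
      using assms(1) nsphere_to_Sph_in by (auto simp: image_subset_iff)
    then show "(Sph_to_nsphere \<circ> (G \<circ> F) \<circ> nsphere_to_Sph) x =
       ((Sph_to_nsphere \<circ> G \<circ> nsphere_to_Sph) \<circ> (Sph_to_nsphere \<circ> F \<circ> nsphere_to_Sph)) x"
      by (simp add: nsphere_to_Sph_inverse)
  qed
  then show ?thesis
    unfolding sph_degree_def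
    using Brouwer_degree2_compose[OF sph_map_conj[OF assms(1)] sph_map_conj[OF assms(2)]] by simp
qed

lemma sph_degree_nonsurjective:
  assumes "sph_map F" "y \<in> Sph" "\<And>x. x \<in> Sph \<Longrightarrow> F x \<noteq> y"
  shows "sph_degree F = 0"
  unfolding sph_degree_def
proof (rule Brouwer_degree2_nonsurjective[OF sph_map_conj[OF assms(1)]])
  have "Sph_to_nsphere y \<notin> (Sph_to_nsphere \<circ> F \<circ> nsphere_to_Sph) ` topspace (nsphere 2)"
  proof
    assume "Sph_to_nsphere y \<in> (Sph_to_nsphere \<circ> F \<circ> nsphere_to_Sph) ` topspace (nsphere 2)"
    then obtain x where x: "x \<in> topspace (nsphere 2)" "Sph_to_nsphere y = Sph_to_nsphere (F (nsphere_to_Sph x))"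
      by auto
    have "F (nsphere_to_Sph x) \<in> Sph"
      using assms(1) nsphere_to_Sph_in[OF x(1)] by (auto simp: image_subset_iff)
    then have "F (nsphere_to_Sph x) = y"
      by (metis x(2) assms(2) nsphere_to_Sph_inverse)
    then show False
      using assms(3) nsphere_to_Sph_in[OF x(1)] by blast
  qed
  then show "(Sph_to_nsphere \<circ> F \<circ> nsphere_to_Sph) ` topspace (nsphere 2) \<noteq> topspace (nsphere 2)"
    using Sph_to_nsphere_in[OF assms(2)] by blast
qed

lemma contractible_punctured_Sph:
  assumes "p \<in> Sph"
  shows "contractible_space (top_of_set (Sph - {p}))"
proof -
  have "Sph - {p} homeomorphic (UNIV :: complex set)"
    using homeomorphic_punctured_sphere_affine_gen[of "cball (0::complex\<times>real) 1" p "UNIV::complex set"] assms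
    by (simp add: Sph_def aff_dim_cball rel_frontier_cball)
  then have "contractible (Sph - {p})"
    using homeomorphic_contractible contractible_UNIV homeomorphic_sym by metis
  then show ?thesis
    by (simp add: contractible_space_top_of_set)
qed

lemma chain_log_var_cmul: "chain_log_var u (frag_cmul n a) = of_int n * chain_log_var u a"
proof -
  have "chain_log_var u (frag_cmul n a)
    = (\<Sum>s\<in>Poly_Mapping.keys a. of_int (Poly_Mapping.lookup (frag_cmul n a) s) * log_var (u \<circ> s \<circ> simplex_edge))"
    by (rule chain_log_var_superset) (auto simp: keys_cmul)
  then show ?thesis
    by (simp add: chain_log_var_def sum_distrib_left mult.assoc)
qed

text \<open>The reference cycle is the equator, once around, along which a logarithm of
  \<open>fst\<close> gains 2 pi i; the image of \<open>c\<close> under \<open>k\<close> is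
  homologous to \<open>sph_degree k\<close> times it. The cycle \<open>c\<close> is chosen before
  \<open>k\<close>, which makes the degrees of different maps comparable.\<close>

lemma sph_degree_chain:
  assumes "closed P" "closed Q" "P \<inter> Q = {}" "P \<subseteq> Sph" "Q \<subseteq> Sph"
  obtains c where "singular_chain (Suc 0) (top_of_set (Sph - P - Q)) c"
    "\<And>k. \<lbrakk>sph_map k; \<And>x. x \<in> Sph - P \<Longrightarrow> k x \<noteq> (0,-1); \<And>x. x \<in> Sph - Q \<Longrightarrow> k x \<noteq> (0,1)\<rbrakk>
       \<Longrightarrow> chain_log_var (fst \<circ> k) c = 2 * pi * \<i> * of_int (sph_degree k)"
proof -
  let ?X = "top_of_set Sph"
  let ?A = "top_of_set (Sph - {(0,-1)} - {(0,1)})"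
  \<comment> \<open>The equator as a singular 1-simplex; singular simplices are
    \<open>undefined\<close> off the standard simplex, hence \<open>restrict\<close>.\<close>
  define s where "s = restrict (\<lambda>x::nat\<Rightarrow>real. (exp (2 * of_real pi * \<i> * of_real (x 1)), 0::real)) (standard_simplex 1)"
  have s: "singular_simplex 1 ?A s"
  proof -
    have "continuous_on (standard_simplex 1) (\<lambda>x::nat\<Rightarrow>real. (exp (2 * of_real pi * \<i> * of_real (x 1)) :: complex, 0::real))"
      by (intro continuous_intros continuous_on_product_then_coordinatewise[OF continuous_on_id])
    then have "continuous_on (standard_simplex 1) s"
      unfolding s_def by (rule continuous_on_eq) auto
    moreover have "s ` standard_simplex 1 \<subseteq> Sph - {(0,-1)} - {(0,1)}"
      by (auto simp: s_def Sph_iff)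
    ultimately show ?thesis
      unfolding singular_simplex_def euclidean_product_topology by (auto simp: s_def image_subset_iff)
  qed
  have faces: "singular_face 1 0 s = singular_face 1 1 s"
    unfolding singular_face_def
  proof (rule restrict_ext)
    fix x assume x: "x \<in> standard_simplex (1 - Suc 0)"
    then have "x = (\<lambda>j. if j = 0 then 1 else 0)" by (simp add: standard_simplex_0)
    moreover have "simplical_face 0 x \<in> standard_simplex 1" "simplical_face 1 x \<in> standard_simplex 1"
      using simplical_face_in_standard_simplex[of 1 _ x] x by auto
    ultimately show "(s \<circ> simplical_face 0) x = (s \<circ> simplical_face 1) x"
      by (auto simp: s_def simplical_face_def exp_eq_1)
  qed
  have c0: "singular_relcycle 1 ?A {} (frag_of s)"
    unfolding singular_cycle using s faces by (simp add: singular_chain_of chain_boundary_of)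
  have var0: "chain_log_var fst (frag_of s) = 2 * pi * \<i>"
  proof -
    have "chain_log_var fst (frag_of s) = 2 * of_real pi * \<i> * of_real 1 - 2 * of_real pi * \<i> * of_real 0"
      unfolding chain_log_var_of
    proof (rule log_var_eq)
      show "continuous_on {0..1::real} (\<lambda>t. 2 * of_real pi * \<i> * of_real t)" by (intro continuous_intros)
      show "(fst \<circ> s \<circ> simplex_edge) t = exp (2 * of_real pi * \<i> * of_real t)" if "t \<in> {0..1}" for t
        using simplex_edge_in[OF that] by (simp add: s_def) (simp add: simplex_edge_def)
    qed
    then show ?thesis by simp
  qed
  have A: "subtopology ?X (topspace ?X - {(0,-1)} - {(0,1)}) = ?A"
    by (simp add: subtopology_subtopology) (rule arg_cong[where f="top_of_set"], auto)
  have U: "subtopology ?X (topspace ?X - P - Q) = top_of_set (Sph - P - Q)"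
    by (simp add: subtopology_subtopology) (rule arg_cong[where f="top_of_set"], auto)
  have con: "contractible_space (subtopology ?X (topspace ?X - {p}))" if "p \<in> Sph" for p
  proof -
    have "subtopology ?X (topspace ?X - {p}) = top_of_set (Sph - {p})"
      by (simp add: subtopology_subtopology) (rule arg_cong[where f="top_of_set"], auto)
    then show ?thesis using contractible_punctured_Sph[OF that] by simp
  qed
  have clo: "closedin ?X C" if "closed C" "C \<subseteq> Sph" for C
    using that by (simp add: closed_subset)
  obtain c where c: "singular_relcycle 1 (subtopology ?X (topspace ?X - P - Q)) {} c"
    "\<And>k. \<lbrakk>continuous_map ?X ?X k; k \<in> topspace ?X - P \<rightarrow> topspace ?X - {(0,-1)}; k \<in> topspace ?X - Q \<rightarrow> topspace ?X - {(0,1)}\<rbrakk> \<Longrightarrow>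
       homologous_rel 1 (subtopology ?X (topspace ?X - {(0,-1)} - {(0,1)})) {} (chain_map 1 k c) (frag_cmul (sph_degree k) (frag_of s))"
    by (rule Mayer_Vietoris_cycle[of ?X P Q "{(0,-1)}" "{(0,1)}" "frag_of s" sph_degree])
       (use assms clo con c0 A sph_degree_hom_induced in auto)
  have cU: "singular_chain 1 (top_of_set (Sph - P - Q)) c"
    using c(1) unfolding U singular_cycle by simp
  show thesis
  proof
    show "singular_chain (Suc 0) (top_of_set (Sph - P - Q)) c" using cU by simp
    fix k
    assume k: "sph_map k" "\<And>x. x \<in> Sph - P \<Longrightarrow> k x \<noteq> (0,-1)" "\<And>x. x \<in> Sph - Q \<Longrightarrow> k x \<noteq> (0,1)"
    have kS: "k x \<in> Sph" if "x \<in> Sph" for x using k(1) that by (auto simp: image_subset_iff)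
    have "homologous_rel 1 ?A {} (chain_map 1 k c) (frag_cmul (sph_degree k) (frag_of s))"
      unfolding A[symmetric] by (rule c(2)) (use k kS in auto)
    then obtain d where d: "singular_chain (Suc 1) ?A d" "chain_boundary (Suc 1) d = chain_map 1 k c - frag_cmul (sph_degree k) (frag_of s)"
      unfolding homologous_rel_def singular_boundary by blast
    have "chain_log_var fst (chain_boundary 2 d) = 0"
      by (rule chain_log_var_boundary[of ?A])
         (use d in \<open>auto simp: numeral_2_eq_2 Sph_fst_eq_0 intro!: continuous_intros\<close>)
    then have "chain_log_var fst (chain_map 1 k c) = chain_log_var fst (frag_cmul (sph_degree k) (frag_of s))"
      using d(2) by (simp add: numeral_2_eq_2 chain_log_var_diff)
    then show "chain_log_var (fst \<circ> k) c = 2 * pi * \<i> * of_int (sph_degree k)"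
      using chain_log_var_chain_map[of "top_of_set (Sph - P - Q)" c fst k] cU var0
      by (simp add: chain_log_var_cmul mult.commute del: chain_log_var_of)
  qed
qed

section \<open>Additivity of the degree in the angular part\<close>

lemma square_eq_1_if_abs: "\<bar>t\<bar> \<le> 1 \<Longrightarrow> \<not> \<bar>t\<bar> < 1 \<Longrightarrow> t\<^sup>2 = (1::real)"
  by (auto simp: abs_if power2_eq_1_iff split: if_splits)

text \<open>The point at height \<open>\<tau> x\<close> in direction \<open>u x\<close>. Where the
  height is 1 or -1 the radius vanishes and the value of \<open>u\<close> has no influence.\<close>

definition susp :: "('a \<Rightarrow> real) \<Rightarrow> ('a \<Rightarrow> complex) \<Rightarrow> 'a \<Rightarrow> complex \<times> real"
  where "susp \<tau> u x = (of_real (sqrt (1 - (\<tau> x)\<^sup>2)) * u x, \<tau> x)"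

text \<open>At points of height 1 or -1 the direction may fail to converge, but it has norm 1 nearby
  wherever the radius is positive, and the radius tends to 0.\<close>

lemma continuous_on_susp:
  fixes \<tau> :: "'a::metric_space \<Rightarrow> real"
  assumes \<tau>: "continuous_on T \<tau>" "\<And>p. p \<in> T \<Longrightarrow> \<bar>\<tau> p\<bar> \<le> 1"
    and u: "continuous_on {p \<in> T. \<bar>\<tau> p\<bar> < 1} u" "\<And>p. p \<in> T \<Longrightarrow> \<bar>\<tau> p\<bar> < 1 \<Longrightarrow> norm (u p) = 1"
  shows "continuous_on T (susp \<tau> u)"
proof -
  let ?s = "\<lambda>p. of_real (sqrt (1 - (\<tau> p)\<^sup>2)) :: complex"
  have cs: "continuous_on T ?s"
    using \<tau>(1) by (intro continuous_intros)
  have "continuous_on T (\<lambda>p. ?s p * u p)"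
    unfolding continuous_on_eq_continuous_within
  proof
    fix p assume p: "p \<in> T"
    let ?U = "{p \<in> T. \<bar>\<tau> p\<bar> < 1}"
    show "continuous (at p within T) (\<lambda>p. ?s p * u p)"
    proof (cases "\<bar>\<tau> p\<bar> < 1")
      case True
      have "openin (top_of_set T) (T \<inter> \<tau> -` {-1<..<1})"
        using \<tau>(1) by (rule continuous_openin_preimage_gen) auto
      also have "T \<inter> \<tau> -` {-1<..<1} = ?U" by auto
      finally obtain O' where O': "open O'" "?U = T \<inter> O'"
        using openin_open by blast
      then have "at p within T = at p within ?U"
        by (intro at_within_nhd[of p O']) (use True p in auto)
      moreover have "continuous_on ?U (\<lambda>p. ?s p * u p)"
        by (intro continuous_on_mult u continuous_on_subset[OF cs]) auto
      ultimately show ?thesis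
        using True p by (simp add: continuous_on_eq_continuous_within)
    next
      case False
      then have 1: "(\<tau> p)\<^sup>2 = 1"
        using \<tau>(2)[OF p] square_eq_1_if_abs by blast
      have "((\<lambda>p. ?s p * u p) \<longlongrightarrow> 0) (at p within T)"
      proof (rule Lim_null_comparison)
        show "\<forall>\<^sub>F x in at p within T. norm (?s x * u x) \<le> sqrt (1 - (\<tau> x)\<^sup>2)"
          unfolding eventually_at_topological
        proof (intro exI[of _ UNIV] conjI ballI impI)
          fix x assume x: "x \<in> T"
          then have "(\<tau> x)\<^sup>2 \<le> 1" using \<tau>(2) by (simp add: abs_square_le_1)
          then have ab: "\<bar>sqrt (1 - (\<tau> x)\<^sup>2)\<bar> = sqrt (1 - (\<tau> x)\<^sup>2)" by simp
          show "norm (?s x * u x) \<le> sqrt (1 - (\<tau> x)\<^sup>2)"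
          proof (cases "\<bar>\<tau> x\<bar> < 1")
            case True
            then show ?thesis using u(2)[OF x] ab by (simp add: norm_mult)
          next
            case False
            then have "(\<tau> x)\<^sup>2 = 1"
              using \<tau>(2)[OF x] square_eq_1_if_abs by blast
            then show ?thesis by simp
          qed
        qed auto
        have "continuous_on T (\<lambda>x. sqrt (1 - (\<tau> x)\<^sup>2))"
          using \<tau>(1) by (intro continuous_intros)
        then have "((\<lambda>x. sqrt (1 - (\<tau> x)\<^sup>2)) \<longlongrightarrow> sqrt (1 - (\<tau> p)\<^sup>2)) (at p within T)"
          using p by (simp add: continuous_on_def)
        then show "((\<lambda>x. sqrt (1 - (\<tau> x)\<^sup>2)) \<longlongrightarrow> 0) (at p within T)"
          using 1 by simp
      qed
      then show ?thesis using 1 by (simp add: continuous_within)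
    qed
  qed
  then show ?thesis
    unfolding susp_def[abs_def] by (intro continuous_on_Pair \<tau>(1))
qed

lemma susp_in_Sph:
  assumes "\<bar>\<tau> x\<bar> \<le> 1" "\<bar>\<tau> x\<bar> < 1 \<Longrightarrow> norm (u x) = 1"
  shows "susp \<tau> u x \<in> Sph"
proof -
  have "(\<tau> x)\<^sup>2 \<le> 1" using assms(1) by (simp add: abs_square_le_1)
  show ?thesis
  proof (cases "\<bar>\<tau> x\<bar> < 1")
    case True
    then show ?thesis
      using \<open>(\<tau> x)\<^sup>2 \<le> 1\<close> assms(2) by (simp add: Sph_iff susp_def norm_mult)
  next
    case False
    then have "(\<tau> x)\<^sup>2 = 1"
      using assms(1) square_eq_1_if_abs by blast
    then show ?thesis by (simp add: Sph_iff susp_def)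
  qed
qed

locale susp_coord =
  fixes \<tau> :: "complex \<times> real \<Rightarrow> real"
  assumes cont_\<tau>: "continuous_on Sph \<tau>" and \<tau>_le: "x \<in> Sph \<Longrightarrow> \<bar>\<tau> x\<bar> \<le> 1"
begin

definition U where "U = {x \<in> Sph. \<bar>\<tau> x\<bar> < 1}"

definition circle_map :: "(complex \<times> real \<Rightarrow> complex) \<Rightarrow> bool"
  where "circle_map u \<longleftrightarrow> continuous_on U u \<and> (\<forall>x\<in>U. norm (u x) = 1)"

definition deg where "deg u = sph_degree (susp \<tau> u)"

lemma openin_U: "openin (top_of_set Sph) U"
proof -
  have "openin (top_of_set Sph) (Sph \<inter> \<tau> -` {-1<..<1})"
    using cont_\<tau> by (rule continuous_openin_preimage_gen) auto
  also have "Sph \<inter> \<tau> -` {-1<..<1} = U" by (auto simp: U_def)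
  finally show ?thesis .
qed

lemma sph_map_susp:
  assumes "circle_map u"
  shows "sph_map (susp \<tau> u)"
  using assms continuous_on_susp[of Sph \<tau> u] susp_in_Sph[of \<tau> _ u] cont_\<tau> \<tau>_le
  by (auto simp: circle_map_def U_def image_subset_iff)

lemma circle_map_const [simp]: "norm c = 1 \<Longrightarrow> circle_map (\<lambda>_. c)"
  by (simp add: circle_map_def)

lemma circle_map_mult: "circle_map u \<Longrightarrow> circle_map v \<Longrightarrow> circle_map (\<lambda>x. u x * v x)"
  by (auto simp: circle_map_def norm_mult intro!: continuous_intros)

lemma circle_map_inverse: "circle_map u \<Longrightarrow> circle_map (\<lambda>x. inverse (u x))"
  by (auto simp: circle_map_def norm_inverse intro!: continuous_intros)

lemma circle_map_exp: "continuous_on U \<theta> \<Longrightarrow> circle_map (\<lambda>x. exp (\<i> * of_real (\<theta> x)))"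
  by (auto simp: circle_map_def intro!: continuous_intros)

lemma deg_cong:
  assumes "\<And>x. x \<in> U \<Longrightarrow> u x = v x"
  shows "deg u = deg v"
  unfolding deg_def
proof (rule sph_degree_cong)
  fix x assume x: "x \<in> Sph"
  show "susp \<tau> u x = susp \<tau> v x"
  proof (cases "x \<in> U")
    case False
    then have "(\<tau> x)\<^sup>2 = 1"
      using \<tau>_le[OF x] x square_eq_1_if_abs unfolding U_def by blast
    then show ?thesis by (simp add: susp_def)
  qed (simp add: susp_def assms)
qed

text \<open>The map omits the equatorial point \<open>(-1, 0)\<close>, which could only be the image
  of a point with \<open>\<tau> x = 0\<close> and \<open>u x = -1\<close>.\<close>

lemma deg_eq_0:
  assumes "circle_map u" "\<And>x. x \<in> Sph \<Longrightarrow> \<tau> x = 0 \<Longrightarrow> u x \<noteq> -1"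
  shows "deg u = 0"
  unfolding deg_def
  by (rule sph_degree_nonsurjective[OF sph_map_susp[OF assms(1)], of "(-1,0)"])
     (use assms(2) in \<open>auto simp: susp_def Sph_iff\<close>)

text \<open>The sets \<open>P\<close> and \<open>Q\<close>, and with them the cycle of
  \<open>sph_degree_chain\<close>, depend on \<open>\<tau>\<close> alone; so one cycle computes the
  degrees for \<open>u\<close>, for \<open>v\<close> and for the product, and along it variations of
  logarithms add up.\<close>

lemma deg_mult:
  assumes u: "circle_map u" and v: "circle_map v"
  shows "deg (\<lambda>x. u x * v x) = deg u + deg v"
proof -
  define P where "P = {x \<in> Sph. \<tau> x = -1}"
  define Q where "Q = {x \<in> Sph. \<tau> x = 1}"
  have "closed Sph" by (simp add: Sph_def)
  then have PQ: "closed P" "closed Q" "P \<inter> Q = {}" "P \<subseteq> Sph" "Q \<subseteq> Sph"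
    using continuous_closed_preimage_constant[OF cont_\<tau>] by (auto simp: P_def Q_def)
  obtain c where c: "singular_chain (Suc 0) (top_of_set (Sph - P - Q)) c"
    "\<And>k. \<lbrakk>sph_map k; \<And>x. x \<in> Sph - P \<Longrightarrow> k x \<noteq> (0,-1); \<And>x. x \<in> Sph - Q \<Longrightarrow> k x \<noteq> (0,1)\<rbrakk>
       \<Longrightarrow> chain_log_var (fst \<circ> k) c = 2 * pi * \<i> * of_int (sph_degree k)"
    using sph_degree_chain[OF PQ] by metis
  have UPQ: "Sph - P - Q = U"
    using \<tau>_le by (force simp: U_def P_def Q_def)
  have L: "chain_log_var (fst \<circ> susp \<tau> w) c = 2 * pi * \<i> * of_int (deg w)" if "circle_map w" for w
    unfolding deg_def
    by (rule c(2)[OF sph_map_susp[OF that]]) (auto simp: P_def Q_def susp_def)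
  let ?f = "\<lambda>w. fst \<circ> susp \<tau> w"
  have cf: "continuous_on U (?f w)" if "circle_map w" for w
  proof -
    have "continuous_on Sph (susp \<tau> w)" using sph_map_susp[OF that] by simp
    then have "continuous_on U (susp \<tau> w)"
      by (rule continuous_on_subset) (auto simp: U_def)
    then show ?thesis
      unfolding o_def by (rule continuous_on_fst)
  qed
  have nz: "?f w x \<noteq> 0" if "circle_map w" "x \<in> U" for w x
  proof -
    have "(\<tau> x)\<^sup>2 < 1" using that by (auto simp: U_def abs_square_less_1)
    moreover have "w x \<noteq> 0" using that by (auto simp: circle_map_def)
    ultimately show ?thesis by (simp add: susp_def)
  qed
  have mult: "chain_log_var (\<lambda>x. ?f w x * ?f w' x) c = chain_log_var (?f w) c + chain_log_var (?f w') c"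
    if "circle_map w" "circle_map w'" for w w'
    by (rule chain_log_var_mult[OF c(1)]) (use that cf nz UPQ in auto)
  \<comment> \<open>The first coordinate carries a radius, which occurs twice in the product for
    \<open>u\<close> and \<open>v\<close>. The constant direction 1, of degree 0, supplies the
    second copy on the other side.\<close>
  have "chain_log_var (\<lambda>x. ?f (\<lambda>x. u x * v x) x * ?f (\<lambda>x. 1) x) c = chain_log_var (\<lambda>x. ?f u x * ?f v x) c"
    by (rule arg_cong[where f="\<lambda>g. chain_log_var g c"]) (auto simp: susp_def)
  then have "2 * pi * \<i> * of_int (deg (\<lambda>x. u x * v x)) + 2 * pi * \<i> * of_int (deg (\<lambda>x. 1))
     = 2 * pi * \<i> * of_int (deg u) + 2 * pi * \<i> * of_int (deg v)"
    using mult[OF circle_map_mult[OF u v] circle_map_const[of 1]] mult[OF u v] L u v circle_map_mult[OF u v] by simp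
  moreover have "deg (\<lambda>x. 1) = 0"
    by (rule deg_eq_0) auto
  ultimately have "2 * pi * \<i> * of_int (deg (\<lambda>x. u x * v x)) = 2 * pi * \<i> * of_int (deg u + deg v)"
    by (simp add: algebra_simps)
  then have "complex_of_int (deg (\<lambda>x. u x * v x)) = of_int (deg u + deg v)"
    by (simp del: of_int_add)
  then show ?thesis by (simp only: of_int_eq_iff)
qed

text \<open>Height and direction may both move. Continuity of the direction is asked only where the
  height is not 1 or -1, and this region may change with time.\<close>

lemma deg_homotopic:
  fixes T :: "real \<times> (complex \<times> real) \<Rightarrow> real"
  assumes "continuous_on ({0..1} \<times> Sph) T" "\<And>p. p \<in> {0..1} \<times> Sph \<Longrightarrow> \<bar>T p\<bar> \<le> 1"
    and "continuous_on {p \<in> {0..1} \<times> Sph. \<bar>T p\<bar> < 1} u"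
    and "\<And>p. p \<in> {0..1} \<times> Sph \<Longrightarrow> \<bar>T p\<bar> < 1 \<Longrightarrow> norm (u p) = 1"
  shows "sph_degree (susp (\<lambda>x. T (0,x)) (\<lambda>x. u (0,x))) = sph_degree (susp (\<lambda>x. T (1,x)) (\<lambda>x. u (1,x)))"
proof (rule sph_degree_homotopic)
  have "continuous_on ({0..1} \<times> Sph) (susp T u)"
    by (rule continuous_on_susp) (use assms in auto)
  moreover have "susp T u ` ({0..1} \<times> Sph) \<subseteq> Sph"
    using assms susp_in_Sph[of T _ u] by blast
  moreover have "{0..1::real} \<times> UNIV \<inter> {0..1} \<times> Sph = {0..1} \<times> Sph" by auto
  moreover have "susp T u (s, x) = susp (\<lambda>x. T (s,x)) (\<lambda>x. u (s,x)) x" for s x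
    by (simp add: susp_def)
  ultimately show "homotopic_with_canon (\<lambda>_. True) Sph Sph (susp (\<lambda>x. T (0,x)) (\<lambda>x. u (0,x))) (susp (\<lambda>x. T (1,x)) (\<lambda>x. u (1,x)))"
    unfolding homotopic_with_def
    by (intro exI[of _ "susp T u"]) (auto simp: prod_topology_subtopology subtopology_subtopology image_subset_iff simp flip: euclidean_product_topology)
qed

lemma deg_exp:
  assumes \<theta>: "continuous_on U \<theta>"
  shows "deg (\<lambda>x. exp (\<i> * of_real (\<theta> x))) = 0"
proof -
  let ?T = "\<lambda>p::real \<times> (complex\<times>real). \<tau> (snd p)" and ?u = "\<lambda>p::real \<times> (complex\<times>real). exp (\<i> * of_real ((1 - fst p) * \<theta> (snd p)))"
  have "sph_degree (susp (\<lambda>x. ?T (0,x)) (\<lambda>x. ?u (0,x))) = sph_degree (susp (\<lambda>x. ?T (1,x)) (\<lambda>x. ?u (1,x)))"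
  proof (rule deg_homotopic)
    show "continuous_on ({0..1} \<times> Sph) ?T"
      by (rule continuous_on_compose2[OF cont_\<tau>]) (auto intro!: continuous_intros)
    show "\<bar>?T p\<bar> \<le> 1" if "p \<in> {0..1} \<times> Sph" for p using \<tau>_le that by auto
    show "continuous_on {p \<in> {0..1} \<times> Sph. \<bar>?T p\<bar> < 1} ?u"
      by (intro continuous_intros continuous_on_compose2[OF \<theta>]) (auto simp: U_def)
    show "norm (?u p) = 1" for p by (rule norm_exp_i_times)
  qed
  then have "deg (\<lambda>x. exp (\<i> * of_real (\<theta> x))) = deg (\<lambda>x. 1)"
    by (simp add: deg_def)
  also have "\<dots> = 0"
    by (rule deg_eq_0) auto
  finally show ?thesis .
qed

lemma deg_mult_exp:
  assumes "circle_map u" "continuous_on U \<theta>" "\<And>x. x \<in> U \<Longrightarrow> v x = u x * exp (\<i> * of_real (\<theta> x))"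
  shows "deg v = deg u"
proof -
  have "deg v = deg (\<lambda>x. u x * exp (\<i> * of_real (\<theta> x)))"
    by (rule deg_cong) (rule assms(3))
  then show ?thesis
    using deg_mult[OF assms(1) circle_map_exp[OF assms(2)]] deg_exp[OF assms(2)] by simp
qed

lemma deg_1 [simp]: "deg (\<lambda>x. 1) = 0"
  by (rule deg_eq_0) auto

lemma deg_inverse:
  assumes "circle_map u"
  shows "deg (\<lambda>x. inverse (u x)) = - deg u"
proof -
  have "deg (\<lambda>x. u x * inverse (u x)) = deg (\<lambda>x. 1)"
    by (rule deg_cong) (use assms in \<open>auto simp: circle_map_def intro!: right_inverse\<close>)
  then show ?thesis
    using deg_mult[OF assms circle_map_inverse[OF assms]] by simp
qed

lemma circle_map_power: "circle_map u \<Longrightarrow> circle_map (\<lambda>x. u x ^ n)"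
  by (auto simp: circle_map_def norm_power intro!: continuous_intros)

lemma deg_power:
  assumes "circle_map u"
  shows "deg (\<lambda>x. u x ^ n) = int n * deg u"
proof (induction n)
  case (Suc n)
  have "deg (\<lambda>x. u x ^ Suc n) = deg (\<lambda>x. u x * u x ^ n)" by simp
  also have "\<dots> = deg u + int n * deg u"
    using deg_mult[OF assms circle_map_power[OF assms]] Suc by simp
  finally show ?case by (simp add: algebra_simps)
qed simp

lemma circle_map_power_int: "circle_map u \<Longrightarrow> circle_map (\<lambda>x. u x powi n)"
  by (cases "n \<ge> 0") (auto simp: power_int_def circle_map_power intro!: circle_map_inverse circle_map_power)

lemma deg_power_int:
  assumes "circle_map u"
  shows "deg (\<lambda>x. u x powi n) = n * deg u"
  using deg_power[OF assms] deg_inverse[OF circle_map_power[OF assms]]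
  by (cases "n \<ge> 0") (auto simp: power_int_def power_inverse)

lemma circle_map_prod:
  "(\<And>i. i \<in> I \<Longrightarrow> circle_map (u i)) \<Longrightarrow> circle_map (\<lambda>x. \<Prod>i\<in>I. u i x)"
  by (induction I rule: infinite_finite_induct) (auto intro: circle_map_mult)

lemma deg_prod:
  assumes "finite I" "\<And>i. i \<in> I \<Longrightarrow> circle_map (u i)"
  shows "deg (\<lambda>x. \<Prod>i\<in>I. u i x) = (\<Sum>i\<in>I. deg (u i))"
  using assms
proof (induction I rule: finite_induct)
  case (insert i I)
  have "deg (\<lambda>x. u i x * (\<Prod>i\<in>I. u i x)) = deg (u i) + deg (\<lambda>x. \<Prod>i\<in>I. u i x)"
    by (rule deg_mult) (use insert circle_map_prod[of I u] in auto)
  then show ?case using insert by simp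
qed simp

end

lemma susp_snd_sgn: "x \<in> Sph \<Longrightarrow> susp snd (\<lambda>x. sgn (fst x)) x = x"
  by (cases "fst x = 0") (auto simp: susp_def cmod_fst_Sph[symmetric] sgn_div_norm prod_eq_iff scaleR_conv_of_real)

text \<open>The affine homotopy of the height function keeps its values at the poles.\<close>

lemma sph_degree_susp_sgn_eq:
  assumes \<tau>: "continuous_on Sph \<tau>" "\<And>x. x \<in> Sph \<Longrightarrow> \<bar>\<tau> x\<bar> \<le> 1"
    and \<sigma>: "continuous_on Sph \<sigma>" "\<And>x. x \<in> Sph \<Longrightarrow> \<bar>\<sigma> x\<bar> \<le> 1"
    and eq: "\<tau> (0,-1) = \<sigma> (0,-1)" "\<tau> (0,1) = \<sigma> (0,1)"
    and pm: "\<bar>\<tau> (0,-1)\<bar> = 1" "\<bar>\<tau> (0,1)\<bar> = 1"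
  shows "sph_degree (susp \<tau> (\<lambda>x. sgn (fst x))) = sph_degree (susp \<sigma> (\<lambda>x. sgn (fst x)))"
proof -
  interpret susp_coord \<tau> by unfold_locales (use \<tau> in auto)
  define T where "T = (\<lambda>p::real \<times> (complex\<times>real). (1 - fst p) * \<tau> (snd p) + fst p * \<sigma> (snd p))"
  have "sph_degree (susp (\<lambda>x. T (0,x)) (\<lambda>x. sgn (fst (snd (0::real,x))))) = sph_degree (susp (\<lambda>x. T (1,x)) (\<lambda>x. sgn (fst (snd (1::real,x)))))"
  proof (rule deg_homotopic)
    show "continuous_on ({0..1} \<times> Sph) T"
      unfolding T_def
      by (intro continuous_intros continuous_on_compose2[OF \<tau>(1)] continuous_on_compose2[OF \<sigma>(1)]) auto
    show "\<bar>T p\<bar> \<le> 1" if p: "p \<in> {0..1} \<times> Sph" for p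
    proof -
      have s: "0 \<le> fst p" "fst p \<le> 1" and x: "snd p \<in> Sph" using p by auto
      have "\<bar>T p\<bar> \<le> (1 - fst p) * \<bar>\<tau> (snd p)\<bar> + fst p * \<bar>\<sigma> (snd p)\<bar>"
        unfolding T_def using s abs_triangle_ineq[of "(1 - fst p) * \<tau> (snd p)" "fst p * \<sigma> (snd p)"]
        by (simp add: abs_mult)
      also have "\<dots> \<le> (1 - fst p) * 1 + fst p * 1"
        by (intro add_mono mult_left_mono) (use s x \<tau> \<sigma> in auto)
      finally show ?thesis by simp
    qed
    have nz: "fst (snd p) \<noteq> 0" if "p \<in> {0..1} \<times> Sph" "\<bar>T p\<bar> < 1" for p
    proof
      assume 0: "fst (snd p) = 0"
      have "snd p \<in> Sph" using that(1) by (simp add: mem_Times_iff)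
      then have "snd p = (0,1) \<or> snd p = (0,-1)"
        using Sph_fst_eq_0 0 by simp
      moreover have "T p = \<tau> (snd p)" if "\<tau> (snd p) = \<sigma> (snd p)"
        using that by (simp add: T_def algebra_simps)
      ultimately have "\<bar>T p\<bar> = 1"
        using eq pm by (elim disjE) simp_all
      then show False using that by simp
    qed
    show "continuous_on {p \<in> {0..1} \<times> Sph. \<bar>T p\<bar> < 1} (\<lambda>p. sgn (fst (snd p)))"
      by (intro continuous_intros) (use nz in auto)
    show "norm (sgn (fst (snd p))) = 1" if "p \<in> {0..1} \<times> Sph" "\<bar>T p\<bar> < 1" for p
      using nz[OF that] by (simp add: norm_sgn)
  qed
  then show ?thesis by (simp add: T_def)
qed

lemma sph_degree_susp_sgn_pos:
  assumes \<tau>: "continuous_on Sph \<tau>" "\<And>x. x \<in> Sph \<Longrightarrow> \<bar>\<tau> x\<bar> \<le> 1" and "\<tau> (0,-1) = -1" "\<tau> (0,1) = 1"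
  shows "sph_degree (susp \<tau> (\<lambda>x. sgn (fst x))) = 1"
proof -
  have "sph_degree (susp \<tau> (\<lambda>x. sgn (fst x))) = sph_degree (susp snd (\<lambda>x. sgn (fst x)))"
    by (rule sph_degree_susp_sgn_eq) (use assms in \<open>auto intro!: continuous_intros Sph_snd_le\<close>)
  also have "\<dots> = sph_degree (\<lambda>x. x)"
    by (rule sph_degree_cong) (rule susp_snd_sgn)
  finally show ?thesis by (simp add: sph_degree_id)
qed

text \<open>The height can be deformed to \<open>- snd\<close>, which gives the reflection in the
  equatorial plane; its square is the identity, so its degree is 1 or -1.\<close>

lemma sph_degree_susp_sgn_neg:
  assumes \<tau>: "continuous_on Sph \<tau>" "\<And>x. x \<in> Sph \<Longrightarrow> \<bar>\<tau> x\<bar> \<le> 1" and "\<tau> (0,-1) = 1" "\<tau> (0,1) = -1"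
  shows "\<bar>sph_degree (susp \<tau> (\<lambda>x. sgn (fst x)))\<bar> = 1"
proof -
  let ?r = "\<lambda>x::complex\<times>real. (fst x, - snd x)"
  have "sph_degree (susp \<tau> (\<lambda>x. sgn (fst x))) = sph_degree (susp (\<lambda>x. - snd x) (\<lambda>x. sgn (fst x)))"
    by (rule sph_degree_susp_sgn_eq) (use assms in \<open>auto intro!: continuous_intros Sph_snd_le\<close>)
  also have "\<dots> = sph_degree ?r"
    by (rule sph_degree_cong) (use susp_snd_sgn in \<open>simp add: susp_def prod_eq_iff\<close>)
  finally have *: "sph_degree (susp \<tau> (\<lambda>x. sgn (fst x))) = sph_degree ?r" .
  have "sph_map ?r"
    by (auto simp: Sph_iff image_subset_iff intro!: continuous_intros)
  then have "sph_degree ?r * sph_degree ?r = sph_degree (?r \<circ> ?r)"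
    by (simp add: sph_degree_compose)
  also have "?r \<circ> ?r = (\<lambda>x. x)" by auto
  finally have "sph_degree ?r * sph_degree ?r = 1" by (simp add: sph_degree_id)
  then show ?thesis unfolding * by (auto simp: zmult_eq_1_iff)
qed

text \<open>The height can be deformed to the constant \<open>c\<close>, and then the map is
  constant at a pole.\<close>

lemma sph_degree_susp_sgn_0:
  assumes \<tau>: "continuous_on Sph \<tau>" "\<And>x. x \<in> Sph \<Longrightarrow> \<bar>\<tau> x\<bar> \<le> 1" and "\<tau> (0,-1) = c" "\<tau> (0,1) = c" "\<bar>c\<bar> = 1"
  shows "sph_degree (susp \<tau> (\<lambda>x. sgn (fst x))) = 0"
proof -
  have c: "c\<^sup>2 = 1" using assms(5) square_eq_1_if_abs[of c] by simp
  have "sph_degree (susp \<tau> (\<lambda>x. sgn (fst x))) = sph_degree (susp (\<lambda>_. c) (\<lambda>x. sgn (fst x)))"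
    by (rule sph_degree_susp_sgn_eq) (use assms in auto)
  also have "\<dots> = 0"
    by (rule sph_degree_nonsurjective[of _ "(1,0)"]) (use c assms(5) in \<open>auto simp: susp_def[abs_def] Sph_iff\<close>)
  finally show ?thesis .
qed

section \<open>Logarithms and common roots\<close>

lemma log_var_winding_number:
  assumes "path p" "0 \<notin> path_image p"
  shows "log_var p = 2 * of_real pi * \<i> * winding_number p 0"
proof -
  obtain q where q: "path q" "pathfinish q - pathstart q = 2 * of_real pi * \<i> * winding_number p 0"
    "\<And>t. t \<in> {0..1} \<Longrightarrow> p t = 0 + exp (q t)"
    using winding_number_as_continuous_log[OF assms] by metis
  have "log_var p = q 1 - q 0"
    by (rule log_var_eq) (use q in \<open>auto simp: path_def\<close>)
  then show ?thesis using q(2) by (simp add: pathfinish_def pathstart_def)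
qed

lemma log_var_loop:
  assumes "path p" "0 \<notin> path_image p" "pathfinish p = pathstart p"
  obtains n :: int where "log_var p = 2 * of_real pi * \<i> * of_int n"
proof -
  have "winding_number p 0 \<in> \<int>"
    using assms by (simp add: integer_winding_number)
  then show ?thesis
    using that log_var_winding_number[OF assms(1,2)] by (auto elim!: Ints_cases)
qed

lemma path_logarithm:
  assumes "path p" "0 \<notin> path_image p"
  obtains l where "path l" "\<And>t. t \<in> {0..1} \<Longrightarrow> p t = exp (l t)" "log_var p = l 1 - l 0"
proof -
  have "continuous_on {0..1} p" "\<And>t. t \<in> {0..1} \<Longrightarrow> p t \<noteq> 0"
    using assms by (force simp: path_def path_image_def)+
  then obtain l where l: "continuous_on {0..1} l" "\<And>t. t \<in> {0..1} \<Longrightarrow> p t = exp (l t)"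
    using continuous_log_on_interval by metis
  show ?thesis
    by (rule that[of l]) (use l log_var_eq[OF l] in \<open>auto simp: path_def\<close>)
qed

text \<open>This is the lifting criterion for the covering by \<open>exp\<close>: the lift of a loop
  closes up when its logarithm has no net change.\<close>

lemma continuous_log_of_loops:
  fixes W :: "'c::real_normed_vector set" and q :: "'c \<Rightarrow> complex"
  assumes W: "path_connected W" "locally path_connected W" "z \<in> W"
    and q: "continuous_on W q" "\<And>x. x \<in> W \<Longrightarrow> q x \<noteq> 0"
    and loops: "\<And>r. \<lbrakk>path r; path_image r \<subseteq> W; pathstart r = z; pathfinish r = z\<rbrakk> \<Longrightarrow> log_var (q \<circ> r) = 0"
  obtains g where "continuous_on W g" "\<And>x. x \<in> W \<Longrightarrow> q x = exp (g x)"
proof (rule covering_space_lift_general[OF covering_space_exp_punctured_plane, of "Ln (q z)" z W q])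
  show "\<exists>k. path k \<and> path_image k \<subseteq> UNIV \<and> pathstart k = Ln (q z) \<and> pathfinish k = Ln (q z) \<and>
      homotopic_paths (- {0}) (q \<circ> r) (exp \<circ> k)"
    if r: "path r" "path_image r \<subseteq> W" "pathstart r = z" "pathfinish r = z" for r
  proof -
    have qr: "path (q \<circ> r)" "0 \<notin> path_image (q \<circ> r)"
      using r q by (auto intro!: path_continuous_image continuous_on_subset[OF q(1)] simp: path_image_compose)
    obtain l where l: "path l" "\<And>t. t \<in> {0..1} \<Longrightarrow> (q \<circ> r) t = exp (l t)" "log_var (q \<circ> r) = l 1 - l 0"
      using path_logarithm[OF qr] by metis
    define k where "k = (\<lambda>t. l t + (Ln (q z) - l 0))"
    have "q z = exp (l 0)" using l(2)[of 0] r(3) by (simp add: pathstart_def)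
    moreover have "exp (Ln (q z)) = q z" using q(2) W(3) by simp
    ultimately have "(q \<circ> r) t = (exp \<circ> k) t" if "t \<in> {0..1}" for t
      using l(2)[OF that] by (simp add: k_def exp_add exp_diff)
    then have "homotopic_paths (- {0}) (q \<circ> r) (exp \<circ> k)"
      using qr by (intro homotopic_paths_eq) auto
    moreover have "path k" using l(1) by (auto simp: path_def k_def intro!: continuous_intros)
    moreover have "l 1 = l 0" using l(3) loops[OF r] by simp
    ultimately show ?thesis
      by (intro exI[of _ k]) (auto simp: k_def pathstart_def pathfinish_def)
  qed
  show "thesis" if "continuous_on W g" "\<And>y. y \<in> W \<Longrightarrow> exp (g y) = q y" for g
    using \<open>\<And>g. \<lbrakk>continuous_on W g; \<And>x. x \<in> W \<Longrightarrow> q x = exp (g x)\<rbrakk> \<Longrightarrow> thesis\<close> that by metis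
qed (use assms in auto)

text \<open>The lifting criterion for the k-th power covering of the punctured plane: a loop lifts
  to a loop when its winding number is divisible by \<open>k\<close>.\<close>

lemma continuous_root_of_loops:
  fixes W :: "'c::real_normed_vector set" and q :: "'c \<Rightarrow> complex"
  assumes W: "path_connected W" "locally path_connected W" "z \<in> W" and k: "k > 0"
    and q: "continuous_on W q" "\<And>x. x \<in> W \<Longrightarrow> q x \<noteq> 0"
    and loops: "\<And>r. \<lbrakk>path r; path_image r \<subseteq> W; pathstart r = z; pathfinish r = z\<rbrakk>
       \<Longrightarrow> \<exists>n::int. log_var (q \<circ> r) = 2 * of_real pi * \<i> * of_int (int k * n)"
  obtains g where "continuous_on W g" "\<And>x. x \<in> W \<Longrightarrow> q x = g x ^ k" "\<And>x. x \<in> W \<Longrightarrow> g x \<noteq> 0"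
proof (rule covering_space_lift_general[OF covering_space_power_punctured_plane[OF k], of "exp (Ln (q z) / of_nat k)" z W q])
  have expk: "exp (w / of_nat k) ^ k = exp w" for w :: complex
    using k exp_of_nat_mult[of k "w / of_nat k"] by simp
  show "q z = exp (Ln (q z) / of_nat k) ^ k"
    using q(2)[OF W(3)] by (simp add: expk)
  show "\<exists>h. path h \<and> path_image h \<subseteq> - {0} \<and> pathstart h = exp (Ln (q z) / of_nat k) \<and> pathfinish h = exp (Ln (q z) / of_nat k) \<and>
      homotopic_paths (- {0}) (q \<circ> r) ((\<lambda>z. z ^ k) \<circ> h)"
    if r: "path r" "path_image r \<subseteq> W" "pathstart r = z" "pathfinish r = z" for r
  proof -
    have qr: "path (q \<circ> r)" "0 \<notin> path_image (q \<circ> r)"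
      using r q by (auto intro!: path_continuous_image continuous_on_subset[OF q(1)] simp: path_image_compose)
    obtain l where l: "path l" "\<And>t. t \<in> {0..1} \<Longrightarrow> (q \<circ> r) t = exp (l t)" "log_var (q \<circ> r) = l 1 - l 0"
      using path_logarithm[OF qr] by metis
    define m where "m = (\<lambda>t. l t + (Ln (q z) - l 0))"
    define h where "h = (\<lambda>t. exp (m t / of_nat k))"
    have "q z = exp (l 0)" using l(2)[of 0] r(3) by (simp add: pathstart_def)
    moreover have "exp (Ln (q z)) = q z" using q(2) W(3) by simp
    ultimately have "(q \<circ> r) t = ((\<lambda>z. z ^ k) \<circ> h) t" if "t \<in> {0..1}" for t
      using l(2)[OF that] by (simp add: h_def m_def expk exp_add exp_diff)
    then have "homotopic_paths (- {0}) (q \<circ> r) ((\<lambda>z. z ^ k) \<circ> h)"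
      using qr by (intro homotopic_paths_eq) auto
    moreover have "path h" using l(1) k by (auto simp: path_def h_def m_def intro!: continuous_intros)
    moreover obtain n :: int where "log_var (q \<circ> r) = 2 * of_real pi * \<i> * of_int (int k * n)"
      using loops[OF r] by blast
    then have "m 1 = m 0 + 2 * of_real pi * \<i> * of_int (int k * n)" using l(3) by (simp add: m_def algebra_simps)
    \<comment> \<open>Division by \<open>k\<close> turns the increment 2 pi i k n into 2 pi i n,
      which \<open>exp\<close> does not see.\<close>
    then have "m 1 / of_nat k = m 0 / of_nat k + 2 * of_real pi * \<i> * of_int n"
      using k by (simp add: field_simps)
    then have "h 1 = h 0" by (simp add: h_def exp_add exp_integer_2pi mult.commute mult.left_commute)
    moreover have "path_image h \<subseteq> - {0}" by (auto simp: h_def path_image_def)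
    ultimately show ?thesis
      by (intro exI[of _ h]) (auto simp: h_def m_def pathstart_def pathfinish_def)
  qed
  show "thesis" if "continuous_on W g" "g \<in> W \<rightarrow> - {0}" "\<And>y. y \<in> W \<Longrightarrow> g y ^ k = q y" for g
    using \<open>\<And>g. \<lbrakk>continuous_on W g; \<And>x. x \<in> W \<Longrightarrow> q x = g x ^ k; \<And>x. x \<in> W \<Longrightarrow> g x \<noteq> 0\<rbrakk> \<Longrightarrow> thesis\<close>[of g] that by force
qed (use assms in auto)

text \<open>\<open>L\<close> is a subgroup of Z x Z on which the first projection is injective,
  hence cyclic; the element with least positive first coordinate generates it.\<close>

lemma int_subgroup_pair_generator:
  fixes L :: "(int \<times> int) set"
  assumes diff: "\<And>p p'. p \<in> L \<Longrightarrow> p' \<in> L \<Longrightarrow> (fst p - fst p', snd p - snd p') \<in> L"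
    and 0: "\<And>n. (0, n) \<in> L \<Longrightarrow> n = 0" and ne: "(m0, n0) \<in> L" "m0 \<noteq> 0"
  obtains k :: nat and a :: int where "k > 0" "(int k, a) \<in> L" "\<And>m n. (m, n) \<in> L \<Longrightarrow> \<exists>j. m = int k * j \<and> n = a * j"
proof -
  have zero: "(0, 0) \<in> L" using diff[OF ne(1) ne(1)] by simp
  have neg: "(- m, - n) \<in> L" if "(m, n) \<in> L" for m n using diff[OF zero that] by simp
  have add: "(m + m', n + n') \<in> L" if "(m, n) \<in> L" "(m', n') \<in> L" for m n m' n'
    using diff[OF that(1) neg[OF that(2)]] by simp
  have mulnat: "(int i * m, int i * n) \<in> L" if "(m, n) \<in> L" for i m n
  proof (induction i)
    case (Suc i)
    then show ?case using add[OF that Suc] by (simp add: algebra_simps)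
  qed (simp add: zero)
  have mul: "(i * m, i * n) \<in> L" if "(m, n) \<in> L" for i m n
  proof (cases "i \<ge> 0")
    case True
    then show ?thesis using mulnat[OF that, of "nat i"] by simp
  next
    case False
    then show ?thesis using neg[OF mulnat[OF that, of "nat (- i)"]] by simp
  qed
  define P where "P = (\<lambda>k. k > 0 \<and> (\<exists>a. (int k, a) \<in> L))"
  have "\<exists>k. P k"
  proof (cases "m0 > 0")
    case True
    then show ?thesis using ne by (intro exI[of _ "nat m0"]) (auto simp: P_def)
  next
    case False
    then show ?thesis using ne neg[OF ne(1)] by (intro exI[of _ "nat (- m0)"]) (auto simp: P_def)
  qed
  then have "P (LEAST k. P k)" by (rule LeastI_ex)
  then obtain a where k: "(LEAST k. P k) > 0" and a: "(int (LEAST k. P k), a) \<in> L" by (auto simp: P_def)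
  define k where "k = (LEAST k. P k)"
  show ?thesis
  proof (rule that[of k a])
    show "k > 0" "(int k, a) \<in> L" using k a by (auto simp: k_def)
    fix m n assume mn: "(m, n) \<in> L"
    define j where "j = m div int k"
    have r: "(m - j * int k, n - j * a) \<in> L"
      using diff[OF mn mul[OF a, of j]] by (simp add: k_def)
    have "m - j * int k = m mod int k" by (simp add: j_def minus_div_mult_eq_mod)
    moreover have "m mod int k = 0"
    proof (rule ccontr)
      assume "m mod int k \<noteq> 0"
      moreover have kpos: "int k > 0" using k by (simp only: k_def of_nat_0_less_iff)
      ultimately have pos: "m mod int k > 0"
        using pos_mod_sign[OF kpos, of m] by linarith
      then have "P (nat (m mod int k))"
        using r pos unfolding P_def \<open>m - j * int k = m mod int k\<close> by (intro conjI exI) auto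
      then have "k \<le> nat (m mod int k)" unfolding k_def by (rule Least_le)
      moreover have "m mod int k < int k" using kpos by (rule pos_mod_bound)
      ultimately show False using pos by linarith
    qed
    ultimately have "m - j * int k = 0" by simp
    moreover from this r have "n - j * a = 0" by (intro 0) simp
    ultimately show "\<exists>j. m = int k * j \<and> n = a * j"
      by (intro exI[of _ j]) (auto simp: mult.commute)
  qed
qed

lemma log_var_power:
  assumes "path p" "0 \<notin> path_image p"
  shows "log_var (\<lambda>t. p t ^ k) = of_nat k * log_var p"
proof -
  obtain l where l: "path l" "\<And>t. t \<in> {0..1} \<Longrightarrow> p t = exp (l t)" "log_var p = l 1 - l 0"
    using path_logarithm[OF assms] by metis
  have "log_var (\<lambda>t. p t ^ k) = of_nat k * l 1 - of_nat k * l 0"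
    by (rule log_var_eq) (use l in \<open>auto simp: path_def exp_of_nat_mult intro!: continuous_intros\<close>)
  then show ?thesis using l(3) by (simp add: right_diff_distrib)
qed

lemma log_var_inverse:
  assumes "path p" "0 \<notin> path_image p"
  shows "log_var (\<lambda>t. inverse (p t)) = - log_var p"
proof -
  obtain l where l: "path l" "\<And>t. t \<in> {0..1} \<Longrightarrow> p t = exp (l t)" "log_var p = l 1 - l 0"
    using path_logarithm[OF assms] by metis
  have "log_var (\<lambda>t. inverse (p t)) = - l 1 - (- l 0)"
    by (rule log_var_eq) (use l in \<open>auto simp: path_def exp_minus intro!: continuous_intros\<close>)
  then show ?thesis using l(3) by simp
qed

lemma log_var_power_int:
  assumes "path p" "0 \<notin> path_image p"
  shows "log_var (\<lambda>t. p t powi n) = of_int n * log_var p"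
proof (cases "n \<ge> 0")
  case True
  then show ?thesis using log_var_power[OF assms, of "nat n"] by (simp add: power_int_def)
next
  case False
  have pi: "path (\<lambda>t. inverse (p t))" "0 \<notin> path_image (\<lambda>t. inverse (p t))"
    using assms by (auto simp: path_def path_image_def intro!: continuous_intros)
  show ?thesis
    using False log_var_power[OF pi, of "nat (- n)"] log_var_inverse[OF assms] by (simp add: power_int_def)
qed

text \<open>Two nonvanishing functions for which winding number \<open>0\<close> of the first along a loop forces winding number \<open>0\<close> of the
  second are, up to factors with a logarithm, powers of a common function.\<close>

lemma common_root_of_loops:
  fixes W :: "'c::real_normed_vector set" and p q :: "'c \<Rightarrow> complex"
  assumes W: "path_connected W" "locally path_connected W" "W \<noteq> {}"
    and p: "continuous_on W p" "\<And>x. x \<in> W \<Longrightarrow> p x \<noteq> 0"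
    and q: "continuous_on W q" "\<And>x. x \<in> W \<Longrightarrow> q x \<noteq> 0"
    and loops: "\<And>\<gamma>. \<lbrakk>path \<gamma>; path_image \<gamma> \<subseteq> W; pathfinish \<gamma> = pathstart \<gamma>; log_var (p \<circ> \<gamma>) = 0\<rbrakk> \<Longrightarrow> log_var (q \<circ> \<gamma>) = 0"
  obtains k :: nat and a :: int and r g h where "k > 0" "continuous_on W r" "\<And>x. x \<in> W \<Longrightarrow> r x \<noteq> 0"
    "continuous_on W g" "continuous_on W h"
    "\<And>x. x \<in> W \<Longrightarrow> p x = r x ^ k * exp (g x)" "\<And>x. x \<in> W \<Longrightarrow> q x = r x powi a * exp (h x)"
proof -
  obtain z where z: "z \<in> W" using W by blast
  define lp where "lp = (\<lambda>\<gamma>. path \<gamma> \<and> path_image \<gamma> \<subseteq> W \<and> pathstart \<gamma> = z \<and> pathfinish \<gamma> = z)"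
  have img: "path (u \<circ> \<gamma>)" "0 \<notin> path_image (u \<circ> \<gamma>)" "pathfinish (u \<circ> \<gamma>) = pathstart (u \<circ> \<gamma>)"
    if "lp \<gamma>" "continuous_on W u" "\<And>x. x \<in> W \<Longrightarrow> u x \<noteq> 0" for \<gamma> u
    using that by (auto simp: lp_def path_image_compose pathstart_compose pathfinish_compose
        intro!: path_continuous_image continuous_on_subset[OF that(2)])
  \<comment> \<open>The pairs of winding numbers of \<open>p\<close> and \<open>q\<close> along
    loops based at \<open>z\<close>. They form a group, and the hypothesis on loops says that an
    element with first entry 0 is 0.\<close>
  define L where "L = {(m, n). \<exists>\<gamma>. lp \<gamma> \<and> log_var (p \<circ> \<gamma>) = 2 * of_real pi * \<i> * of_int m \<and> log_var (q \<circ> \<gamma>) = 2 * of_real pi * \<i> * of_int n}"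
  have joinv: "log_var (u \<circ> (\<gamma> +++ reversepath \<gamma>')) = log_var (u \<circ> \<gamma>) - log_var (u \<circ> \<gamma>')"
    if "lp \<gamma>" "lp \<gamma>'" and u: "continuous_on W u" "\<And>x. x \<in> W \<Longrightarrow> u x \<noteq> 0" for u \<gamma> \<gamma>'
  proof -
    note i = img[OF that(1) u] and i' = img[OF that(2) u]
    have st: "pathfinish (u \<circ> \<gamma>) = pathstart (reversepath (u \<circ> \<gamma>'))"
      using that by (simp add: lp_def pathstart_compose pathfinish_compose)
    have pa: "path ((u \<circ> \<gamma>) +++ reversepath (u \<circ> \<gamma>'))" "0 \<notin> path_image ((u \<circ> \<gamma>) +++ reversepath (u \<circ> \<gamma>'))"
      using i i' st by (auto simp: path_image_join)
    have "u \<circ> (\<gamma> +++ reversepath \<gamma>') = (u \<circ> \<gamma>) +++ reversepath (u \<circ> \<gamma>')"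
      by (simp add: path_compose_join path_compose_reversepath)
    then show ?thesis
      using log_var_winding_number[OF pa] log_var_winding_number[OF i(1,2)] log_var_winding_number[OF i'(1,2)]
        winding_number_join[of "u \<circ> \<gamma>" 0 "reversepath (u \<circ> \<gamma>')"] winding_number_reversepath[OF i'(1,2)] i i' st
      by (simp add: algebra_simps)
  qed
  have diff: "(fst P - fst P', snd P - snd P') \<in> L" if P: "P \<in> L" "P' \<in> L" for P P'
  proof -
    obtain \<gamma> \<gamma>' where g: "lp \<gamma>" "log_var (p \<circ> \<gamma>) = 2 * of_real pi * \<i> * of_int (fst P)" "log_var (q \<circ> \<gamma>) = 2 * of_real pi * \<i> * of_int (snd P)"
      and g': "lp \<gamma>'" "log_var (p \<circ> \<gamma>') = 2 * of_real pi * \<i> * of_int (fst P')" "log_var (q \<circ> \<gamma>') = 2 * of_real pi * \<i> * of_int (snd P')"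
      using P by (auto simp: L_def)
    have "lp (\<gamma> +++ reversepath \<gamma>')"
      using g(1) g'(1) by (auto simp: lp_def path_image_join)
    then show ?thesis
      unfolding L_def using joinv[OF g(1) g'(1) p] joinv[OF g(1) g'(1) q] g g'
      by (auto simp: algebra_simps intro!: exI[of _ "\<gamma> +++ reversepath \<gamma>'"])
  qed
  have inL: "\<exists>m n. (m, n) \<in> L \<and> log_var (p \<circ> \<gamma>) = 2 * of_real pi * \<i> * of_int m \<and> log_var (q \<circ> \<gamma>) = 2 * of_real pi * \<i> * of_int n" if lpg: "lp \<gamma>" for \<gamma>
  proof -
    obtain m n :: int where "log_var (p \<circ> \<gamma>) = 2 * of_real pi * \<i> * of_int m" "log_var (q \<circ> \<gamma>) = 2 * of_real pi * \<i> * of_int n"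
      using log_var_loop[OF img[OF lpg p]] log_var_loop[OF img[OF lpg q]] by metis
    then show ?thesis unfolding L_def using lpg by blast
  qed
  have zero: "n = 0" if nL: "(0, n) \<in> L" for n
  proof -
    obtain \<gamma> where "lp \<gamma>" "log_var (p \<circ> \<gamma>) = 0" "log_var (q \<circ> \<gamma>) = 2 * of_real pi * \<i> * of_int n"
      using nL by (auto simp: L_def)
    then show ?thesis using loops[of \<gamma>] by (auto simp: lp_def)
  qed
  show ?thesis
  proof (cases "\<exists>m0 n0. (m0, n0) \<in> L \<and> m0 \<noteq> 0")
    \<comment> \<open>No loop winds for \<open>p\<close>, hence none for \<open>q\<close>. Both have
      logarithms, and the common root is the constant 1 with k = 1 and a = 0.\<close>
    case False
    then have p0: "log_var (p \<circ> \<gamma>) = 0" if "lp \<gamma>" for \<gamma> using inL[OF that] by auto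
    then have q0: "log_var (q \<circ> \<gamma>) = 0" if "lp \<gamma>" for \<gamma> using loops[of \<gamma>] that by (auto simp: lp_def)
    obtain g where g: "continuous_on W g" "\<And>x. x \<in> W \<Longrightarrow> p x = exp (g x)"
      using continuous_log_of_loops[OF W(1,2) z p] p0 unfolding lp_def by metis
    obtain h where h: "continuous_on W h" "\<And>x. x \<in> W \<Longrightarrow> q x = exp (h x)"
      using continuous_log_of_loops[OF W(1,2) z q] q0 unfolding lp_def by metis
    show ?thesis
      by (rule that[of 1 "\<lambda>_. 1" g h 0]) (use g h in auto)
  next
    case True
    then obtain m0 n0 where "(m0, n0) \<in> L" "m0 \<noteq> 0" by blast
    then obtain k a where ka: "k > 0" "\<And>m n. (m, n) \<in> L \<Longrightarrow> \<exists>j. m = int k * j \<and> n = a * j"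
      using int_subgroup_pair_generator[of L, OF diff zero] by metis
    have "\<exists>n::int. log_var (p \<circ> \<gamma>) = 2 * of_real pi * \<i> * of_int (int k * n)" if "lp \<gamma>" for \<gamma>
      using inL[OF that] ka(2) by metis
    then obtain r where r: "continuous_on W r" "\<And>x. x \<in> W \<Longrightarrow> p x = r x ^ k" "\<And>x. x \<in> W \<Longrightarrow> r x \<noteq> 0"
      using continuous_root_of_loops[OF W(1,2) z ka(1) p] unfolding lp_def by metis
    \<comment> \<open>Along a loop with pair (k j, a j) the root \<open>r\<close> winds j times, so
      dividing \<open>q\<close> by \<open>r powi a\<close> removes its winding.\<close>
    define q' where "q' = (\<lambda>x. q x * r x powi (- a))"
    have q': "continuous_on W q'" "\<And>x. x \<in> W \<Longrightarrow> q' x \<noteq> 0"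
      unfolding q'_def using q r by (auto intro!: continuous_intros)
    have "log_var (q' \<circ> \<gamma>) = 0" if l: "lp \<gamma>" for \<gamma>
    proof -
      obtain j where j: "log_var (p \<circ> \<gamma>) = 2 * of_real pi * \<i> * of_int (int k * j)" "log_var (q \<circ> \<gamma>) = 2 * of_real pi * \<i> * of_int (a * j)"
        using inL[OF l] ka(2) by metis
      note ir = img[OF l r(1,3)] and iq = img[OF l q]
      have "log_var (p \<circ> \<gamma>) = log_var (\<lambda>t. (r \<circ> \<gamma>) t ^ k)"
        unfolding log_var_def using r(2) l by (auto simp: lp_def path_image_def image_subset_iff)
      also have "\<dots> = of_nat k * log_var (r \<circ> \<gamma>)" by (rule log_var_power[OF ir(1,2)])
      finally have lr: "log_var (r \<circ> \<gamma>) = 2 * of_real pi * \<i> * of_int j"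
        using j(1) ka(1) by (simp add: mult.assoc)
      have "log_var (q' \<circ> \<gamma>) = log_var (\<lambda>t. (q \<circ> \<gamma>) t * ((r \<circ> \<gamma>) t powi (- a)))"
        by (simp add: q'_def o_def)
      also have "\<dots> = log_var (q \<circ> \<gamma>) + log_var (\<lambda>t. (r \<circ> \<gamma>) t powi (- a))"
        by (rule log_var_mult) (use ir iq in \<open>auto simp: path_def path_image_def intro!: continuous_intros\<close>)
      also have "\<dots> = 0"
        by (simp only: log_var_power_int[OF ir(1,2)] j(2) lr) (simp add: algebra_simps)
      finally show ?thesis .
    qed
    then obtain h where h: "continuous_on W h" "\<And>x. x \<in> W \<Longrightarrow> q' x = exp (h x)"
      using continuous_log_of_loops[OF W(1,2) z q'] unfolding lp_def by metis
    show ?thesis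
    proof (rule that[of k r "\<lambda>_. 0" h a])
      fix x assume x: "x \<in> W"
      have "r x powi (- a) * r x powi a = 1"
        using r(3)[OF x] by (simp flip: power_int_add)
      then show "q x = r x powi a * exp (h x)"
        unfolding h(2)[OF x, symmetric] q'_def by (simp add: algebra_simps)
    qed (use ka r h in auto)
  qed
qed

section \<open>Logarithms on open subsets of the sphere\<close>

lemma locally_path_connected_Sph_open:
  "openin (top_of_set Sph) V \<Longrightarrow> locally path_connected V"
  unfolding Sph_def by (rule locally_open_subset[OF locally_path_connected_sphere])

lemma path_connected_if_connected:
  assumes "connected V" "locally path_connected V"
  shows "path_connected V"
  unfolding path_connected_component_set
  using assms path_component_eq_connected_component_set[OF assms(2)] connected_component_eq_self[OF assms(1)]
  by simp

text \<open>Components of an open subset of the sphere are open, so logarithms chosen independently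
  on them fit together continuously.\<close>

lemma continuous_log_of_loops_Sph:
  fixes q :: "complex \<times> real \<Rightarrow> complex"
  assumes V: "openin (top_of_set Sph) V"
    and q: "continuous_on V q" "\<And>x. x \<in> V \<Longrightarrow> q x \<noteq> 0"
    and loops: "\<And>r. \<lbrakk>path r; path_image r \<subseteq> V; pathfinish r = pathstart r\<rbrakk> \<Longrightarrow> log_var (q \<circ> r) = 0"
  obtains g where "continuous_on V g" "\<And>x. x \<in> V \<Longrightarrow> q x = exp (g x)"
proof -
  have lpc: "locally path_connected V" by (rule locally_path_connected_Sph_open[OF V])
  then have lc: "locally connected V" by (rule locally_path_connected_imp_locally_connected)
  have "\<exists>g. continuous_on C g \<and> (\<forall>x\<in>C. q x = exp (g x))" if C: "C \<in> components V" for C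
  proof -
    have "C \<subseteq> V" "connected C" "C \<noteq> {}" using C in_components_subset in_components_connected in_components_nonempty by blast+
    have lpC: "locally path_connected C" using locally_path_connected_components[OF lpc C] .
    obtain z where z: "z \<in> C" using \<open>C \<noteq> {}\<close> by blast
    show ?thesis
      using continuous_log_of_loops[OF path_connected_if_connected[OF \<open>connected C\<close> lpC] lpC z, of q]
        q loops \<open>C \<subseteq> V\<close> continuous_on_subset[of V q C] by (metis subset_trans subsetD)
  qed
  then obtain G where G: "\<And>C. C \<in> components V \<Longrightarrow> continuous_on C (G C)" "\<And>C x. C \<in> components V \<Longrightarrow> x \<in> C \<Longrightarrow> q x = exp (G C x)"
    by metis
  define g where "g = (\<lambda>x. G (connected_component_set V x) x)"
  have gC: "g x = G C x" if "C \<in> components V" "x \<in> C" for C x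
    using that unfolding g_def by (metis components_iff connected_component_eq)
  show ?thesis
  proof
    show "continuous_on V g"
      by (rule continuous_on_components[OF lc]) (use G(1) gC in \<open>metis continuous_on_eq\<close>)
    show "q x = exp (g x)" if "x \<in> V" for x
      using G(2)[of "connected_component_set V x" x] that gC by (metis componentsI connected_component_refl_eq mem_Collect_eq)
  qed
qed

section \<open>Stereographic projection\<close>

definition stereo :: "complex \<times> real \<Rightarrow> complex"
  where "stereo x = fst x / of_real (1 - snd x)"

lemma continuous_on_stereo: "continuous_on {x. snd x \<noteq> 1} stereo"
  unfolding stereo_def by (intro continuous_intros) auto

lemma Sph_snd_less_1: "x \<in> Sph \<Longrightarrow> x \<noteq> (0,1) \<Longrightarrow> snd x < 1"
  using Sph_snd_le[of x] Sph_snd_eq(1)[of x] by linarith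

lemma cmod_stereo:
  assumes "x \<in> Sph" "snd x < 1"
  shows "(cmod (stereo x))\<^sup>2 = (1 + snd x) / (1 - snd x)"
proof -
  have f: "(cmod (fst x))\<^sup>2 = (1 + snd x) * (1 - snd x)"
    using assms(1) by (simp add: Sph_iff power2_eq_square algebra_simps)
  have "norm (complex_of_real (1 - snd x)) = 1 - snd x"
    unfolding norm_of_real using assms(2) by simp
  then have "(cmod (stereo x))\<^sup>2 = ((1 + snd x) * (1 - snd x)) / (1 - snd x)\<^sup>2"
    unfolding stereo_def norm_divide power_divide f by (simp only:)
  then show ?thesis using assms(2) by (simp add: power2_eq_square)
qed

lemma stereo_inj:
  assumes "x \<in> Sph" "y \<in> Sph" "snd x < 1" "snd y < 1" "stereo x = stereo y"
  shows "x = y"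
proof -
  have "(1 + snd x) / (1 - snd x) = (1 + snd y) / (1 - snd y)"
    using cmod_stereo assms by metis
  then have "(1 + snd x) * (1 - snd y) = (1 + snd y) * (1 - snd x)"
    using assms(3,4) by (simp add: frac_eq_eq)
  then have s: "snd x = snd y" by (simp add: algebra_simps)
  then have "fst x = fst y" using assms(3,5) by (simp add: stereo_def of_real_eq_1_iff)
  with s show ?thesis by (simp add: prod_eq_iff)
qed

lemma stereo_eq_0: "snd x < 1 \<Longrightarrow> stereo x = 0 \<longleftrightarrow> fst x = 0"
  by (simp add: stereo_def of_real_eq_1_iff)

text \<open>The winding number of the projected loop about \<open>stereo x\<close> is integer-valued
  and continuous for \<open>x\<close> in \<open>K\<close>. It tends to 0 at \<open>(0, 1)\<close>,
  which projects to infinity, so it vanishes at \<open>(0, -1)\<close>, which projects to 0.\<close>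

lemma loop_winding_0_if_avoids_connected:
  assumes \<gamma>: "path \<gamma>" "pathfinish \<gamma> = pathstart \<gamma>" "path_image \<gamma> \<subseteq> Sph"
    and K: "connected K" "K \<subseteq> Sph" "(0,-1) \<in> K" "(0,1) \<in> K" "K \<inter> path_image \<gamma> = {}"
  shows "log_var (fst \<circ> \<gamma>) = 0"
proof -
  let ?S = "(0,1) :: complex \<times> real"
  have gim: "path_image \<gamma> \<subseteq> {x. snd x < 1}"
  proof
    fix x assume "x \<in> path_image \<gamma>"
    then have "x \<in> Sph" "x \<noteq> ?S" using \<gamma> K by auto
    then show "x \<in> {x. snd x < 1}" using Sph_snd_less_1 by simp
  qed
  define p where "p = stereo \<circ> \<gamma>"
  have p: "path p" "pathfinish p = pathstart p"
    unfolding p_def using \<gamma> by (auto intro!: path_continuous_image continuous_on_subset[OF continuous_on_stereo] dest: subsetD[OF gim] simp: pathstart_compose pathfinish_compose)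
  have nin: "stereo x \<notin> path_image p" if "x \<in> K" "x \<noteq> ?S" for x
  proof
    assume "stereo x \<in> path_image p"
    then obtain y where y: "y \<in> path_image \<gamma>" "stereo x = stereo y" by (auto simp: p_def path_image_compose)
    then have "x = y"
      using stereo_inj[of x y] Sph_snd_less_1[of x] that K(2) \<gamma>(3) gim by blast
    then show False using y that K(5) by blast
  qed
  \<comment> \<open>The value 0 at \<open>(0, 1)\<close> is the winding number about points near
    infinity, which makes \<open>w\<close> continuous on all of \<open>K\<close>.\<close>
  define w where "w = (\<lambda>x. if x = ?S then 0 else winding_number p (stereo x))"
  have int: "w x \<in> \<int>" if "x \<in> K" for x
  proof (cases "x = ?S")
    case False
    then have "stereo x \<notin> path_image p" by (rule nin[OF that])
    then show ?thesis using p False by (simp add: w_def integer_winding_number)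
  qed (simp add: w_def)
  obtain B where B: "\<And>z. B \<le> norm z \<Longrightarrow> winding_number p z = 0"
    using winding_number_zero_at_infinity[OF p] by blast
  have contw: "continuous_on K w"
    unfolding continuous_on_eq_continuous_within
  proof
    fix x assume x: "x \<in> K"
    show "continuous (at x within K) w"
    proof (cases "x = ?S")
      case False
      have op: "open (- path_image p)" using p by (simp add: closed_path_image open_Compl)
      have nx: "stereo x \<notin> path_image p" by (rule nin[OF x False])
      have "snd x \<noteq> 1" using Sph_snd_less_1[of x] x False K(2) by auto
      then have "continuous (at x within K) stereo"
        unfolding stereo_def by (intro continuous_intros) auto
      moreover have "isCont (winding_number p) (stereo x)"
        using continuous_on_winding_number[OF p(1)] op nx by (simp add: continuous_on_eq_continuous_at)
      ultimately have "continuous (at x within K) (\<lambda>x. winding_number p (stereo x))"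
        using continuous_within_compose3 by blast
      then show ?thesis
      proof (rule continuous_transform_within_openin[where S="K - {?S}"])
        show "openin (top_of_set K) (K - {?S})" by (simp add: openin_delete)
      qed (use x False in \<open>auto simp: w_def\<close>)
    next
      case True
      define B' where "B' = max B 1"
      \<comment> \<open>At height h the squared modulus of the projection is (1 + h) / (1 - h), so
        heights above 1 - 1/B'^2 project to points of modulus at least B'.\<close>
      have big: "B \<le> norm (stereo y)" if "y \<in> Sph" "y \<noteq> ?S" "1 - 1 / B'\<^sup>2 < snd y" for y
      proof -
        have B': "B' \<ge> 1" "B' \<ge> B" by (auto simp: B'_def)
        have t: "snd y < 1" by (rule Sph_snd_less_1[OF that(1,2)])
        have "1 / B'\<^sup>2 \<le> 1" using B'(1) by simp
        then have t0: "snd y > 0" using that(3) by linarith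
        have "1 - snd y < 1 / B'\<^sup>2" using that(3) by simp
        then have "B'\<^sup>2 * (1 - snd y) < 1" using B'(1) by (simp add: field_simps)
        then have "B'\<^sup>2 \<le> (1 + snd y) / (1 - snd y)" using t t0 by (simp add: field_simps)
        moreover have "(cmod (stereo y))\<^sup>2 = (1 + snd y) / (1 - snd y)"
          by (rule cmod_stereo[OF that(1) t])
        ultimately have "B' \<le> cmod (stereo y)" using B'(1) by (metis norm_ge_zero power2_le_imp_le)
        then show ?thesis using B'(2) by linarith
      qed
      have "eventually (\<lambda>y. 1 - 1 / B'\<^sup>2 < snd y) (at x within K)"
      proof (rule order_tendstoD(1))
        show "(snd \<longlongrightarrow> 1) (at x within K)"
          using tendsto_snd[OF tendsto_ident_at[of x K]] by (simp add: True)
        show "1 - 1 / B'\<^sup>2 < 1" by (simp add: B'_def zero_less_power max_def)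
      qed
      moreover have "eventually (\<lambda>y. y \<in> K \<and> y \<noteq> x) (at x within K)"
        by (auto simp: eventually_at_filter)
      ultimately have "eventually (\<lambda>y. w y = w x) (at x within K)"
      proof eventually_elim
        case (elim y)
        then show ?case using big[of y] B K(2) by (auto simp: w_def True)
      qed
      then show ?thesis
        unfolding continuous_within by (rule tendsto_eventually)
    qed
  qed
  have "w constant_on K"
  proof (rule continuous_discrete_range_constant[OF K(1) contw])
    fix x assume x: "x \<in> K"
    show "\<exists>e>0. \<forall>y. y \<in> K \<and> w y \<noteq> w x \<longrightarrow> e \<le> norm (w y - w x)"
    proof (intro exI[of _ 1] conjI allI impI)
      fix y assume y: "y \<in> K \<and> w y \<noteq> w x"
      then have "w y - w x \<in> \<int>" "w y - w x \<noteq> 0" using int x by auto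
      then obtain n :: int where n: "w y - w x = of_int n" "n \<noteq> 0"
        by (metis Ints_cases of_int_0)
      then have "1 \<le> \<bar>real_of_int n\<bar>" by linarith
      then show "1 \<le> norm (w y - w x)" unfolding n(1) norm_of_int .
    qed simp
  qed
  then have "w (0,-1) = w ?S" using K unfolding constant_on_def by metis
  then have "winding_number p 0 = 0" by (simp add: w_def stereo_def)
  moreover have nz: "0 \<notin> path_image p"
  proof
    assume "0 \<in> path_image p"
    then obtain x where x: "x \<in> path_image \<gamma>" "stereo x = 0" by (auto simp: p_def path_image_compose)
    then have "fst x = 0" using gim stereo_eq_0[of x] by auto
    then show False using Sph_fst_eq_0[of x] x K \<gamma> by auto
  qed
  ultimately have lp: "log_var p = 0" using log_var_winding_number[OF p(1)] by simp
  \<comment> \<open>The positive factor between \<open>fst\<close> and \<open>stereo\<close>; its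
    real logarithm returns to the initial value along the loop.\<close>
  define s where "s = (\<lambda>t. complex_of_real (1 - snd (\<gamma> t)))"
  have pos: "1 - snd (\<gamma> t) > 0" if "t \<in> {0..1}" for t
  proof -
    have "\<gamma> t \<in> path_image \<gamma>" using that by (auto simp: path_image_def)
    then have "snd (\<gamma> t) < 1" using gim by auto
    then show ?thesis by simp
  qed
  have cg: "continuous_on {0..1} \<gamma>" using \<gamma>(1) by (simp add: path_def)
  have "log_var s = of_real (ln (1 - snd (\<gamma> 1))) - of_real (ln (1 - snd (\<gamma> 0)))"
  proof (rule log_var_eq[of "\<lambda>t. of_real (ln (1 - snd (\<gamma> t)))"])
    show "continuous_on {0..1} (\<lambda>t. complex_of_real (ln (1 - snd (\<gamma> t))))"
      by (intro continuous_intros cg) (use pos in force)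
    show "s t = exp (complex_of_real (ln (1 - snd (\<gamma> t))))" if "t \<in> {0..1}" for t
      using pos[OF that] by (simp add: s_def exp_of_real)
  qed
  then have ls: "log_var s = 0" using \<gamma>(2) by (simp add: pathfinish_def pathstart_def)
  have "log_var (fst \<circ> \<gamma>) = log_var (\<lambda>t. p t * s t)"
  proof -
    have "(fst \<circ> \<gamma>) t = p t * s t" if "t \<in> {0..1}" for t
      using pos[OF that] by (simp add: p_def stereo_def s_def)
    then show ?thesis unfolding log_var_def by (metis (no_types, lifting))
  qed
  also have "\<dots> = log_var p + log_var s"
  proof (rule log_var_mult)
    show "continuous_on {0..1} s" unfolding s_def by (intro continuous_intros cg)
    show "s t \<noteq> 0" if "t \<in> {0..1}" for t using pos[OF that] by (simp add: s_def) 
  qed (use p nz in \<open>auto simp: path_def path_image_def\<close>)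
  finally show ?thesis using lp ls by simp
qed

section \<open>Points in a plane ring where a function takes the value 1\<close>

text \<open>The inverse Riemann map \<open>\<psi>\<close> with \<open>\<psi> 0 = 0\<close> has the
  form \<open>u * exp (\<kappa> u)\<close>: injectivity makes its derivative at 0 nonzero, so
  \<open>\<psi> u / u\<close> extends to a nonvanishing function on the disc and has a logarithm. In
  this form roots can be extracted along the radial contraction.\<close>

lemma Riemann_map_normalized:
  assumes D: "open D" "simply_connected D" "bounded D" "0 \<in> D"
  obtains \<phi> \<kappa> where "continuous_on D \<phi>" "\<And>z. z \<in> D \<Longrightarrow> \<phi> z \<in> ball 0 (1::real)"
    "continuous_on (ball 0 1) \<kappa>" "\<And>u. u \<in> ball 0 1 \<Longrightarrow> u * exp (\<kappa> u) \<in> D"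
    "\<And>z. z \<in> D \<Longrightarrow> \<phi> z * exp (\<kappa> (\<phi> z)) = (z::complex)"
proof -
  have "D \<noteq> UNIV" using D(3) not_bounded_UNIV by blast
  then obtain f0 g0 where fg: "f0 holomorphic_on D" "g0 holomorphic_on ball 0 1"
    "\<And>z. z \<in> D \<Longrightarrow> f0 z \<in> ball 0 1 \<and> g0 (f0 z) = z"
    "\<And>z. z \<in> ball 0 1 \<Longrightarrow> g0 z \<in> D \<and> f0 (g0 z) = z"
    using Riemann_mapping_theorem[of D] D by blast
  have "f0 0 \<in> ball 0 1" using fg(3) D(4) by blast
  then obtain m n where mn: "m (f0 0) = 0" "m holomorphic_on ball 0 1" "m ` ball 0 1 \<subseteq> ball 0 1"
    "n holomorphic_on ball 0 1" "n ` ball 0 1 \<subseteq> ball 0 1"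
    "\<And>z. z \<in> ball 0 1 \<Longrightarrow> m (n z) = z" "\<And>z. z \<in> ball 0 1 \<Longrightarrow> n (m z) = z"
    using ball_biholomorphism_exists by blast
  define \<phi> where "\<phi> = m \<circ> f0"
  define \<psi> where "\<psi> = g0 \<circ> n"
  have \<phi>: "\<phi> holomorphic_on D"
    unfolding \<phi>_def by (rule holomorphic_on_compose_gen[OF fg(1) mn(2)]) (use fg in auto)
  have \<psi>: "\<psi> holomorphic_on ball 0 1"
    unfolding \<psi>_def by (rule holomorphic_on_compose_gen[OF mn(4) fg(2)]) (use mn in auto)
  have \<phi>D: "\<phi> z \<in> ball 0 1" if "z \<in> D" for z using that fg mn unfolding \<phi>_def by fastforce
  have \<psi>D: "\<psi> u \<in> D" if "u \<in> ball 0 1" for u using that fg(4) mn(5) unfolding \<psi>_def o_def by blast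
  have \<psi>\<phi>: "\<psi> (\<phi> z) = z" if "z \<in> D" for z
    using fg(3)[OF that] mn(7) unfolding \<phi>_def \<psi>_def by simp
  have \<phi>\<psi>: "\<phi> (\<psi> u) = u" if u: "u \<in> ball 0 1" for u
  proof -
    have "n u \<in> ball 0 1" using mn(5) u by blast
    then show ?thesis using fg(4) mn(6)[OF u] unfolding \<phi>_def \<psi>_def by simp
  qed
  have \<psi>0: "\<psi> 0 = 0" using \<psi>\<phi>[OF D(4)] mn(1) by (simp add: \<phi>_def)
  have inj: "inj_on \<psi> (ball 0 1)" using \<phi>\<psi> by (rule inj_on_inverseI)
  define \<kappa>0 where "\<kappa>0 = (\<lambda>u. if u = 0 then deriv \<psi> 0 else \<psi> u / u)"
  have "continuous_on (ball 0 1) \<kappa>0"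
    unfolding continuous_on_eq_continuous_at[OF open_ball]
  proof
    fix u :: complex assume u: "u \<in> ball 0 1"
    show "isCont \<kappa>0 u"
    proof (cases "u = 0")
      case True
      have "(\<psi> has_field_derivative deriv \<psi> 0) (at 0)"
        by (rule holomorphic_derivI[OF \<psi> open_ball]) auto
      then have "((\<lambda>h. (\<psi> (0 + h) - \<psi> 0) / h) \<longlongrightarrow> deriv \<psi> 0) (at 0)"
        unfolding DERIV_def .
      then have "((\<lambda>h. \<psi> h / h) \<longlongrightarrow> deriv \<psi> 0) (at 0)" by (simp add: \<psi>0)
      then have "(\<kappa>0 \<longlongrightarrow> deriv \<psi> 0) (at 0)"
        by (rule Lim_transform_eventually) (auto simp: \<kappa>0_def eventually_at_filter)
      then show ?thesis unfolding True isCont_def by (simp add: \<kappa>0_def)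
    next
      case False
      have "isCont \<psi> u"
        using holomorphic_on_imp_continuous_on[OF \<psi>] u by (simp add: continuous_on_eq_continuous_at)
      then have "isCont (\<lambda>u. \<psi> u / u) u"
        using False by (intro continuous_intros) auto
      moreover have "eventually (\<lambda>y. \<kappa>0 y = \<psi> y / y) (nhds u)"
        using t1_space_nhds[OF False] by eventually_elim (simp add: \<kappa>0_def)
      ultimately show ?thesis using isCont_cong by fastforce
    qed
  qed
  moreover have "\<kappa>0 u \<noteq> 0" if u: "u \<in> ball 0 1" for u
  proof (cases "u = 0")
    case True
    then show ?thesis
      using holomorphic_injective_imp_regular[OF \<psi> open_ball inj, of 0] by (simp add: \<kappa>0_def)
  next
    case False
    then have "\<psi> u \<noteq> \<psi> 0" using inj u by (auto dest: inj_onD)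
    then show ?thesis using False by (simp add: \<kappa>0_def \<psi>0)
  qed
  ultimately obtain \<kappa> where \<kappa>: "continuous_on (ball 0 1) \<kappa>" "\<And>u. u \<in> ball 0 1 \<Longrightarrow> \<kappa>0 u = exp (\<kappa> u)"
    using continuous_logarithm_on_ball by metis
  have eq: "u * exp (\<kappa> u) = \<psi> u" if "u \<in> ball 0 1" for u
    using \<kappa>(2)[OF that, symmetric] by (auto simp: \<kappa>0_def \<psi>0)
  show ?thesis
  proof (rule that[of \<phi> \<kappa>])
    show "continuous_on D \<phi>" using \<phi> by (rule holomorphic_on_imp_continuous_on)
  qed (use \<phi>D \<kappa> eq \<psi>D \<psi>\<phi> in auto)
qed

text \<open>The Riemann map contracts \<open>z (c z)\<^sup>q\<close> inside \<open>D\<close> to \<open>0\<close>; since \<open>z\<close> stays outside \<open>D\<close>, the corresponding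
  deformation of \<open>c\<close> to \<open>0\<close> avoids \<open>1\<close>.\<close>

lemma continuous_log_one_minus:
  fixes c :: "complex \<Rightarrow> complex"
  assumes D: "open D" "simply_connected D" "bounded D" "0 \<in> D"
    and K: "K \<inter> D = {}" and c: "continuous_on K c" "\<And>z. z \<in> K \<Longrightarrow> c z \<noteq> 0" and q: "q > 0"
    and inD: "\<And>z. z \<in> K \<Longrightarrow> z * c z ^ q \<in> D"
  obtains l where "continuous_on K l" "\<And>z. z \<in> K \<Longrightarrow> 1 - c z = exp (l z)"
proof -
  obtain \<phi> \<kappa> where \<phi>: "continuous_on D \<phi>" "\<And>z. z \<in> D \<Longrightarrow> \<phi> z \<in> ball 0 (1::real)"
    and \<kappa>: "continuous_on (ball 0 1) \<kappa>" "\<And>u. u \<in> ball 0 1 \<Longrightarrow> u * exp (\<kappa> u) \<in> D"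
    and id: "\<And>z. z \<in> D \<Longrightarrow> \<phi> z * exp (\<kappa> (\<phi> z)) = z"
    using Riemann_map_normalized[OF D] by metis
  define u where "u = (\<lambda>z. \<phi> (z * c z ^ q))"
  have u: "u z \<in> ball 0 1" if "z \<in> K" for z using \<phi>(2) inD[OF that] by (simp add: u_def)
  have contu: "continuous_on K u"
    unfolding u_def by (rule continuous_on_compose2[OF \<phi>(1)]) (use inD in \<open>auto intro!: continuous_intros c\<close>)
  \<comment> \<open>Replacing u by s^q u moves the point u exp(\<kappa>(u)) = z c^q to z c_s^q with
    c_s = c s exp((\<kappa>(s^q u) - \<kappa>(u)) / q), and \<open>H\<close> is 1 - c_s. The
    parameter s^q is chosen because its q-th root s is continuous.\<close>
  define H where "H = (\<lambda>(s::real, z). 1 - c z * of_real s * exp ((\<kappa> (of_real (s ^ q) * u z) - \<kappa> (u z)) / of_nat q))"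
  have ball: "of_real (s ^ q) * u z \<in> ball 0 1" if "s \<in> {0..1}" "z \<in> K" for s :: real and z
  proof -
    have "s ^ q * cmod (u z) \<le> 1 * cmod (u z)"
      using that by (intro mult_right_mono) (simp_all add: power_le_one)
    moreover have "cmod (of_real (s ^ q) * u z) = s ^ q * cmod (u z)"
      using that by (simp add: norm_mult norm_power)
    ultimately have "cmod (of_real (s ^ q) * u z) \<le> cmod (u z)" by simp
    then show ?thesis using u[OF that(2)] by auto
  qed
  have "continuous_on ({0..1} \<times> K) H"
    unfolding H_def case_prod_unfold
    by (intro continuous_intros continuous_on_compose2[OF c(1)] continuous_on_compose2[OF \<kappa>(1)] continuous_on_compose2[OF contu])
       (use ball u q in auto)
  moreover have "H p \<noteq> 0" if p: "p \<in> {0..1} \<times> K" for p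
  proof
    obtain s z where sz: "p = (s, z)" "s \<in> {0..1}" "z \<in> K" using p by auto
    assume "H p = 0"
    then have one: "c z * of_real s * exp ((\<kappa> (of_real (s ^ q) * u z) - \<kappa> (u z)) / of_nat q) = 1"
      by (simp add: H_def sz)
    have expq: "exp (w / of_nat q) ^ q = exp w" for w :: complex
      using q exp_of_nat_mult[of q "w / of_nat q"] by simp
    \<comment> \<open>If c_s = 1, then z coincides with the contracted point and so lies in
      \<open>D\<close>, although it belongs to \<open>K\<close>.\<close>
    have "1 = (c z * of_real s * exp ((\<kappa> (of_real (s ^ q) * u z) - \<kappa> (u z)) / of_nat q)) ^ q"
      unfolding one by simp
    also have "\<dots> = c z ^ q * of_real (s ^ q) * exp (\<kappa> (of_real (s ^ q) * u z) - \<kappa> (u z))"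
      by (simp add: power_mult_distrib expq)
    finally have "z = (z * c z ^ q) * of_real (s ^ q) * exp (\<kappa> (of_real (s ^ q) * u z) - \<kappa> (u z))"
      by (metis mult.assoc mult.right_neutral)
    also have "z * c z ^ q = u z * exp (\<kappa> (u z))"
      using id[OF inD[OF sz(3)]] by (simp add: u_def)
    finally have "z = (of_real (s ^ q) * u z) * exp (\<kappa> (of_real (s ^ q) * u z))"
      by (simp add: exp_diff mult_ac)
    then have "z \<in> D" using \<kappa>(2)[OF ball[OF sz(2,3)]] by metis
    then show False using K sz(3) by blast
  qed
  moreover have H01: "H (0, z) = 1" "H (1, z) = 1 - c z" for z
    by (simp_all add: H_def)
  ultimately have "homotopic_with_canon (\<lambda>h. True) K (- {0}) (\<lambda>z. 1) (\<lambda>z. 1 - c z)"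
    unfolding homotopic_with_def
    by (intro exI[of _ H]) (auto simp: prod_topology_subtopology subtopology_subtopology image_subset_iff Times_Int_Times
        H01 simp flip: euclidean_product_topology)
  then have "homotopic_with_canon (\<lambda>h. True) K (- {0}) (\<lambda>z. 1 - c z) (\<lambda>z. 1)"
    by (rule homotopic_with_symD)
  then have "\<exists>a. homotopic_with_canon (\<lambda>h. True) K (- {0}) (\<lambda>z. 1 - c z) (\<lambda>z. a)"
    by (rule exI)
  then have "\<exists>l. continuous_on K l \<and> (\<forall>z\<in>K. 1 - c z = exp (l z))"
    by (simp only: inessential_eq_continuous_logarithm)
  then show ?thesis using that by blast
qed

section \<open>Plane sets that separate 0 from infinity\<close>

lemma no_log_on_separating_frontier:
  assumes "compact F" "(0::complex) \<notin> F" "bounded (connected_component_set (- F) 0)" "continuous_on F g"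
  shows "\<exists>z\<in>F. z \<noteq> exp (g z)"
proof (rule ccontr)
  assume "\<not> ?thesis"
  then have g: "z = exp (g z)" if "z \<in> F" for z using that by blast
  \<comment> \<open>A logarithm of z on \<open>F\<close> gives a continuous argument of z/|z|, which
    is then homotopic to a constant; the Borsuk map of a bounded complementary component is
    essential.\<close>
  have "\<exists>c. homotopic_with_canon (\<lambda>x. True) F (sphere 0 1) (\<lambda>x. inverse (norm (x - 0)) *\<^sub>R (x - 0)) (\<lambda>x. c)"
    unfolding inessential_eq_continuous_logarithm_circle
  proof (intro exI conjI ballI)
    show "continuous_on F (\<lambda>z. Im (g z))" using assms(4) by (intro continuous_intros)
    fix z assume z: "z \<in> F"
    have "z = of_real (norm z) * exp (\<i> * of_real (Im (g z)))"
      using g[OF z] exp_eq_polar[of "g z"] by (metis cis_conv_exp norm_exp_eq_Re)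
    moreover have "norm z \<noteq> 0" using z assms(2) by auto
    ultimately show "inverse (norm (z - 0)) *\<^sub>R (z - 0) = exp (\<i> * of_real (Im (g z)))"
      by (metis diff_zero left_inverse mult.assoc mult_1 of_real_1 of_real_mult scaleR_conv_of_real)
  qed
  then show False
    using Borsuk_map_essential_bounded_component[OF assms(1,2)] assms(3) by blast
qed

text \<open>The reason is the identity c = - (1 - c) / (1 - 1/c). The numerator, continued over
  \<open>D\<close>, has a logarithm because the compact set \<open>- D'\<close> has a connected
  complement.\<close>

lemma continuous_log_transfer:
  fixes c :: "complex \<Rightarrow> complex"
  assumes D: "open D" "open D'" "D \<inter> D' = {}" "connected D'" "bounded (- D')"
    and B: "B = - (D \<union> D')" and c: "continuous_on B c" "\<And>z. z \<in> B \<Longrightarrow> c z \<noteq> 0" "\<And>z. z \<in> B \<Longrightarrow> c z \<noteq> 1"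
    and l: "continuous_on (frontier D) l" "\<And>z. z \<in> frontier D \<Longrightarrow> 1 - c z = exp (l z)"
    and l': "continuous_on (frontier D') l'" "\<And>z. z \<in> frontier D' \<Longrightarrow> 1 - inverse (c z) = exp (l' z)"
  obtains g where "continuous_on (frontier D') g" "\<And>z. z \<in> frontier D' \<Longrightarrow> c z = exp (g z)"
proof -
  \<comment> \<open>Extending the logarithm of 1 - c from the frontier, rather than 1 - c itself,
    keeps the continuation over \<open>D\<close> nonvanishing.\<close>
  obtain L where L: "continuous_on UNIV L" "\<And>z. z \<in> frontier D \<Longrightarrow> L z = l z"
    using Tietze_unbounded[OF l(1), of UNIV] by auto
  have closB: "closed B" unfolding B using D(1,2) by (intro closed_Compl open_Un)
  have disj: "closure D \<inter> D' = {}" using D by (metis Int_commute open_Int_closure_eq_empty)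
  have un: "- D' = closure D \<union> B"
    using disj closure_subset[of D] D(3) by (auto simp: B)
  have fr: "closure D \<inter> B = frontier D"
    using D(1) disj by (auto simp: B frontier_def interior_open)
  define Q where "Q = (\<lambda>z. if z \<in> closure D then exp (L z) else 1 - c z)"
  have "continuous_on (closure D \<union> B) Q"
    unfolding Q_def
  proof (rule continuous_on_cases)
    show "continuous_on (closure D) (\<lambda>z. exp (L z))"
      by (intro continuous_intros continuous_on_subset[OF L(1)]) auto
    show "continuous_on B (\<lambda>z. 1 - c z)" by (intro continuous_intros c)
    show "\<forall>x. x \<in> closure D \<and> x \<notin> closure D \<or> x \<in> B \<and> x \<in> closure D \<longrightarrow> exp (L x) = 1 - c x"
    proof (intro allI impI)
      fix x assume "x \<in> closure D \<and> x \<notin> closure D \<or> x \<in> B \<and> x \<in> closure D"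
      then have "x \<in> frontier D" using fr by blast
      then show "exp (L x) = 1 - c x" using L(2) l(2) by simp
    qed
  qed (use closB in auto)
  moreover have "Q z \<noteq> 0" if "z \<in> - D'" for z
  proof (cases "z \<in> closure D")
    case False
    then have "z \<in> B" using that un by blast
    then show ?thesis using False c(3) by (simp add: Q_def)
  qed (simp add: Q_def)
  moreover have "Borsukian (- D')"
  proof -
    have "compact (- D')" using D by (simp add: compact_eq_bounded_closed closed_Compl)
    then show ?thesis using Borsukian_separation_compact D(4) by (metis double_complement)
  qed
  ultimately obtain \<Lambda> where \<Lambda>: "continuous_on (- D') \<Lambda>" "\<And>z. z \<in> - D' \<Longrightarrow> Q z = exp (\<Lambda> z)"
    unfolding Borsukian_continuous_logarithm un[symmetric] by (metis (no_types, lifting) ComplI Pi_I singletonD)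
  have frD': "frontier D' \<subseteq> B" "frontier D' \<subseteq> - D'"
  proof -
    have "D \<inter> closure D' = {}" using D by (metis open_Int_closure_eq_empty)
    then show "frontier D' \<subseteq> B" "frontier D' \<subseteq> - D'" using D(2) by (auto simp: B frontier_def interior_open)
  qed
  show ?thesis
  proof
    \<comment> \<open>The summand pi i accounts for the minus sign in c = - (1 - c) / (1 -
      1/c).\<close>
    show "continuous_on (frontier D') (\<lambda>z. \<Lambda> z - l' z + \<i> * of_real pi)"
      by (intro continuous_intros l' continuous_on_subset[OF \<Lambda>(1)] frD')
    fix z assume z: "z \<in> frontier D'"
    then have zB: "z \<in> B" using frD' by blast
    have "Q z = 1 - c z"
    proof (cases "z \<in> closure D")
      case True
      then have "z \<in> frontier D" using fr zB by blast
      then show ?thesis using True L(2) l(2) by (simp add: Q_def)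
    qed (simp add: Q_def)
    then have "exp (\<Lambda> z) = 1 - c z" using \<Lambda>(2) z frD'(2) by (metis subsetD)
    have "exp (l' z) = 1 - inverse (c z)" using l'(2)[OF z] by simp
    have "exp (\<Lambda> z - l' z + \<i> * of_real pi) = - (exp (\<Lambda> z) / exp (l' z))"
      by (simp add: exp_add exp_diff)
    also have "\<dots> = - ((1 - c z) / (1 - inverse (c z)))"
      by (simp only: \<open>exp (\<Lambda> z) = _\<close> \<open>exp (l' z) = _\<close>)
    also have "1 - inverse (c z) = (c z - 1) / c z"
      using c(2)[OF zB] by (simp add: field_simps)
    also have "- ((1 - c z) / ((c z - 1) / c z)) = c z"
      using c(2,3)[OF zB] by (simp add: divide_simps) (simp add: algebra_simps)
    finally show "c z = exp (\<Lambda> z - l' z + \<i> * of_real pi)" by simp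
  qed
qed

text \<open>If \<open>c\<close> omits \<open>1\<close>, then extending \<open>1 - c\<close> over \<open>D\<close> gives it a logarithm on \<open>- D'\<close>, so \<open>c\<close>, and with it \<open>z\<close>,
  has a logarithm on the frontier of \<open>D'\<close>, which separates \<open>0\<close> from infinity.\<close>

lemma value_one_between_aux:
  fixes c :: "complex \<Rightarrow> complex"
  assumes D: "open D" "open D'" "D \<inter> D' = {}" "connected D'" "bounded (- D')" "0 \<in> D"
    and B: "B = - (D \<union> D')" and e: "e = 1 \<or> e = -1"
    and \<gamma>: "continuous_on B \<gamma>" "\<And>z. z \<in> B \<Longrightarrow> c z = z powi e * exp (\<gamma> z)"
    and l: "continuous_on (frontier D) l" "\<And>z. z \<in> frontier D \<Longrightarrow> 1 - c z = exp (l z)"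
    and l': "continuous_on (frontier D') l'" "\<And>z. z \<in> frontier D' \<Longrightarrow> 1 - inverse (c z) = exp (l' z)"
  shows "\<exists>z\<in>B. c z = 1"
proof (rule ccontr)
  assume ne: "\<not> ?thesis"
  have B0: "0 \<notin> B" using D by (simp add: B)
  have frD': "frontier D' \<subseteq> B"
  proof -
    have "D \<inter> closure D' = {}" using D by (metis open_Int_closure_eq_empty)
    then show "frontier D' \<subseteq> B" using D(2) by (auto simp: B frontier_def interior_open)
  qed
  have "continuous_on B (\<lambda>z. z powi e * exp (\<gamma> z))"
    using B0 by (intro continuous_intros \<gamma>) auto
  then have cc: "continuous_on B c" by (rule continuous_on_eq) (use \<gamma> in auto)
  have c0: "c z \<noteq> 0" if "z \<in> B" for z using \<gamma>(2)[OF that] that B0 by auto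
  obtain g where g: "continuous_on (frontier D') g" "\<And>z. z \<in> frontier D' \<Longrightarrow> c z = exp (g z)"
    by (rule continuous_log_transfer[OF D(1-5) B cc c0 _ l l']) (use ne in auto)
  have comp: "compact (frontier D')"
    using D(5) by (metis frontier_complement compact_eq_bounded_closed bounded_closure bounded_subset frontier_closed frontier_def Diff_subset)
  have "0 \<notin> frontier D'" using frD' B0 by blast
  \<comment> \<open>0 lies outside \<open>D'\<close>, and a connected set that avoids the frontier
    of \<open>D'\<close> cannot enter \<open>D'\<close>; so the component of 0 stays in the bounded
    set \<open>- D'\<close>.\<close>
  moreover have "bounded (connected_component_set (- frontier D') 0)"
  proof (rule bounded_subset[OF D(5)])
    have "0 \<notin> D'" "0 \<notin> frontier D'" using D frD' B0 by blast+
    let ?C = "connected_component_set (- frontier D') 0"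
    have "0 \<in> ?C - D'"
      using \<open>0 \<notin> frontier D'\<close> \<open>0 \<notin> D'\<close> by simp
    show "?C \<subseteq> - D'"
    proof (rule ccontr)
      assume "\<not> ?C \<subseteq> - D'"
      then have "?C \<inter> D' \<noteq> {}" by blast
      moreover have "?C - D' \<noteq> {}" using \<open>0 \<in> ?C - D'\<close> by blast
      ultimately have "?C \<inter> frontier D' \<noteq> {}"
        by (rule connected_Int_frontier[OF connected_connected_component])
      then show False using connected_component_subset[of "- frontier D'" 0] by blast
    qed
  qed
  moreover have "continuous_on (frontier D') (\<lambda>z. of_int e * (g z - \<gamma> z))"
    by (intro continuous_intros g continuous_on_subset[OF \<gamma>(1) frD'])
  ultimately obtain z where z: "z \<in> frontier D'" "z \<noteq> exp (of_int e * (g z - \<gamma> z))"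
    using no_log_on_separating_frontier[OF comp] by blast
  have "z powi e = exp (g z - \<gamma> z)"
    using g(2)[OF z(1)] \<gamma>(2)[of z] frD' z(1) by (auto simp: exp_diff field_simps)
  then have "z = exp (of_int e * (g z - \<gamma> z))"
    using e by (auto simp: power_int_minus exp_minus inverse_eq_iff_eq) (metis exp_minus inverse_inverse_eq minus_diff_eq)
  then show False using z(2) by simp
qed

text \<open>The second alternative is the first one for 1/c and -e.\<close>

lemma value_one_between:
  fixes c :: "complex \<Rightarrow> complex"
  assumes D: "open D" "open D'" "D \<inter> D' = {}" "connected D'" "bounded (- D')" "0 \<in> D"
    and B: "B = - (D \<union> D')" and e: "e = 1 \<or> e = -1"
    and \<gamma>: "continuous_on B \<gamma>" "\<And>z. z \<in> B \<Longrightarrow> c z = z powi e * exp (\<gamma> z)"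
    and l: "continuous_on (frontier D) l" "continuous_on (frontier D') l'"
    and log: "((\<forall>z \<in> frontier D. 1 - c z = exp (l z)) \<and> (\<forall>z \<in> frontier D'. 1 - inverse (c z) = exp (l' z)))
       \<or> ((\<forall>z \<in> frontier D. 1 - inverse (c z) = exp (l z)) \<and> (\<forall>z \<in> frontier D'. 1 - c z = exp (l' z)))"
  shows "\<exists>z\<in>B. c z = 1"
  using log
proof
  assume "(\<forall>z \<in> frontier D. 1 - c z = exp (l z)) \<and> (\<forall>z \<in> frontier D'. 1 - inverse (c z) = exp (l' z))"
  then show ?thesis
    by (intro value_one_between_aux[OF D B e \<gamma> l(1) _ l(2)]) auto
next
  assume a: "(\<forall>z \<in> frontier D. 1 - inverse (c z) = exp (l z)) \<and> (\<forall>z \<in> frontier D'. 1 - c z = exp (l' z))"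
  have "\<exists>z\<in>B. inverse (c z) = 1"
  proof (rule value_one_between_aux[OF D B _ _ _ l(1) _ l(2)])
    show "- e = 1 \<or> - e = -1" using e by auto
    show "continuous_on B (\<lambda>z. - \<gamma> z)" using \<gamma> by (intro continuous_intros)
    show "inverse (c z) = z powi (- e) * exp (- \<gamma> z)" if "z \<in> B" for z
      using \<gamma>(2)[OF that] by (simp add: power_int_minus exp_minus)
  qed (use a in auto)
  then show ?thesis by (metis inverse_1 inverse_inverse_eq)
qed

text \<open>\<open>D\<close> is the complement of the unbounded component of the complement of
  \<open>V\<close>, hence simply connected, as the Riemann map demands. An unbounded connected set
  that avoids \<open>V\<close> lies in that component and so avoids the filled holes too.\<close>

lemma fill_holes:
  fixes V :: "complex set"
  assumes V: "open V" "connected V" "bounded V" "V \<noteq> {}"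
  obtains D where "open D" "simply_connected D" "bounded D" "V \<subseteq> D" "frontier D \<subseteq> frontier V"
    "\<And>T. connected T \<Longrightarrow> \<not> bounded T \<Longrightarrow> T \<inter> V = {} \<Longrightarrow> T \<inter> D = {}"
proof
  let ?D = "- outside V"
  have con: "connected (outside V)" by (rule connected_outside[OF V(3)]) simp
  have ub: "\<not> bounded (outside V)" by (rule unbounded_outside[OF V(3)])
  then have "outside V \<noteq> {}" by auto
  then have comp: "outside V \<in> components (- V)" using con outside_in_components by blast
  have "closed (outside V)" by (rule closed_components[OF _ comp]) (use V in auto)
  then show o: "open ?D" by (rule open_Compl)
  show b: "bounded ?D" by (rule cobounded_outside[OF V(3)])
  have "connected ?D" by (rule component_complement_connected[OF V(2) comp])
  then show "simply_connected ?D" using simply_connected_iff_simple[OF o b] con by simp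
  show "V \<subseteq> ?D" using outside_no_overlap by blast
  show "frontier ?D \<subseteq> frontier V"
    using frontier_of_components_subset[OF comp] by (simp add: frontier_complement)
  fix T assume T: "connected T" "\<not> bounded T" "T \<inter> V = {}"
  have "T \<subseteq> outside V"
  proof
    fix x assume x: "x \<in> T"
    have "T \<subseteq> connected_component_set (- V) x"
      by (rule connected_component_maximal[OF x T(1)]) (use T in auto)
    then have "\<not> bounded (connected_component_set (- V) x)" using T(2) bounded_subset by blast
    then show "x \<in> outside V" using x T by (auto simp: outside)
  qed
  then show "T \<inter> ?D = {}" by blast
qed

lemma unbounded_inverse_image:
  fixes D :: "complex set"
  assumes "open D" "0 \<in> D"
  shows "\<not> bounded (inverse ` (D - {0}))"
proof
  assume "bounded (inverse ` (D - {0}))"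
  then obtain M where M: "M > 0" "\<And>z. z \<in> D - {0} \<Longrightarrow> cmod (inverse z) \<le> M"
    by (auto simp: bounded_pos)
  obtain e where e: "e > 0" "ball 0 e \<subseteq> D" using assms openE by blast
  define r where "r = min (e / 2) (1 / (2 * M))"
  have r: "r > 0" "r < e" "r \<le> 1 / (2 * M)" using e M by (auto simp: r_def min_def)
  then have "complex_of_real r \<in> D - {0}" using e by auto
  then have "inverse r \<le> M" using M(2) r(1) by (fastforce simp: norm_inverse)
  moreover have "inverse r \<ge> 2 * M" using r M by (simp add: field_simps)
  ultimately show False using M(1) by linarith
qed

text \<open>The ring lies between a neighbourhood \<open>V\<close> of 0 and a neighbourhood of
  infinity, the latter given by \<open>V'\<close> in the coordinate 1/z. In the first alternative of
  \<open>bd\<close> the map z c^q sends each frontier into the neighbourhood that it bounds; in the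
  second it increases the modulus on the inner frontier and decreases it on the outer one.\<close>

lemma planar_value_one:
  fixes V V' :: "complex set" and c :: "complex \<Rightarrow> complex"
  assumes V: "open V" "connected V" "bounded V" "0 \<in> V"
    and V': "open V'" "connected V'" "bounded V'" "0 \<in> V'"
    and disj: "\<And>z. z \<noteq> 0 \<Longrightarrow> z \<in> V \<Longrightarrow> inverse z \<notin> V'"
    and e: "e = 1 \<or> e = -1" and q: "q > 0"
    and \<gamma>: "continuous_on (- {0}) \<gamma>" "\<And>z. c z = z powi e * exp (\<gamma> z)"
    and bd: "((\<forall>z. z \<in> frontier V \<longrightarrow> z * c z ^ q \<in> V) \<and> (\<forall>z. z \<noteq> 0 \<longrightarrow> inverse z \<in> frontier V' \<longrightarrow> inverse (z * c z ^ q) \<in> V'))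
      \<or> ((\<forall>z. z \<in> frontier V \<longrightarrow> cmod (c z) > 1) \<and> (\<forall>z. z \<noteq> 0 \<longrightarrow> inverse z \<in> frontier V' \<longrightarrow> cmod (c z) < 1))"
  obtains z where "z \<noteq> 0" "z \<notin> V" "inverse z \<notin> V'" "c z = 1"
proof -
  obtain D where D: "open D" "simply_connected D" "bounded D" "V \<subseteq> D" "frontier D \<subseteq> frontier V"
    and D_disj: "\<And>T. connected T \<Longrightarrow> \<not> bounded T \<Longrightarrow> T \<inter> V = {} \<Longrightarrow> T \<inter> D = {}"
    using fill_holes[OF V(1-3)] V(4) by (metis empty_iff)
  obtain D1 where D1: "open D1" "simply_connected D1" "bounded D1" "V' \<subseteq> D1" "frontier D1 \<subseteq> frontier V'"
    and D1_disj: "\<And>T. connected T \<Longrightarrow> \<not> bounded T \<Longrightarrow> T \<inter> V' = {} \<Longrightarrow> T \<inter> D1 = {}"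
    using fill_holes[OF V'(1-3)] V'(4) by (metis empty_iff)
  have coninv: "connected (inverse ` (A - {0}))" if "open A" "connected A" for A :: "complex set"
    by (intro connected_continuous_image connected_open_delete that continuous_intros) auto
  have conD: "connected D" "connected D1" using D(2) D1(2) simply_connected_imp_connected by auto
  have "inverse ` (V' - {0}) \<inter> V = {}"
  proof -
    have False if "w \<in> V'" "w \<noteq> 0" "inverse w \<in> V" for w
      using disj[of "inverse w"] that by simp
    then show ?thesis by blast
  qed
  \<comment> \<open>The inverse image of a connected open neighbourhood of 0, punctured, is
    connected and unbounded; so disjointness survives filling first \<open>V\<close> and then
    \<open>V'\<close>.\<close>
  then have "inverse ` (V' - {0}) \<inter> D = {}"
    by (intro D_disj coninv V' unbounded_inverse_image)
  then have "inverse ` (D - {0}) \<inter> V' = {}"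
  proof -
    have False if "z \<in> D" "z \<noteq> 0" "inverse z \<in> V'" for z
    proof -
      have "z = inverse (inverse z)" "inverse z \<noteq> 0" using that by auto
      then have "z \<in> inverse ` (V' - {0})" using that by blast
      then show False using that \<open>inverse ` (V' - {0}) \<inter> D = {}\<close> by blast
    qed
    then show ?thesis by blast
  qed
  then have DD1: "inverse ` (D - {0}) \<inter> D1 = {}"
    using D V by (intro D1_disj coninv conD unbounded_inverse_image) auto
  define D' where "D' = inverse ` (D1 - {0})"
  have D'iff: "z \<in> D' \<longleftrightarrow> z \<noteq> 0 \<and> inverse z \<in> D1" for z
  proof
    assume "z \<noteq> 0 \<and> inverse z \<in> D1"
    then have "z = inverse (inverse z)" "inverse z \<in> D1 - {0}" by auto
    then show "z \<in> D'" unfolding D'_def by blast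
  qed (auto simp: D'_def)
  have opD': "open D'"
  proof -
    have "open ((- {0}) \<inter> inverse -` D1)"
      by (rule continuous_open_preimage) (use D1 in \<open>auto intro!: continuous_intros\<close>)
    moreover have "(- {0}) \<inter> inverse -` D1 = D'" using D'iff by auto
    ultimately show ?thesis by simp
  qed
  have conD': "connected D'" unfolding D'_def by (rule coninv[OF D1(1) conD(2)])
  have DD': "D \<inter> D' = {}"
  proof -
    have False if "z \<in> D" "z \<in> D'" for z
    proof -
      have "z \<noteq> 0" "inverse z \<in> D1" using that D'iff by auto
      then show False using DD1 that by blast
    qed
    then show ?thesis by blast
  qed
  have 0: "0 \<in> D" using V D by blast
  have bD': "bounded (- D')"
  proof -
    have "0 \<in> D1" using V' D1 by blast
    then obtain r where r: "r > 0" "ball 0 r \<subseteq> D1" using D1(1) openE by blast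
    have "- D' \<subseteq> cball 0 (1 / r)"
    proof
      fix z assume z: "z \<in> - D'"
      show "z \<in> cball 0 (1 / r)"
      proof (cases "z = 0")
        case False
        then have "inverse z \<notin> ball 0 r" using z r D'iff by blast
        then have "r \<le> inverse (cmod z)" by (simp add: norm_inverse)
        then show ?thesis using False r(1) by (simp add: field_simps)
      qed (use r in auto)
    qed
    then show ?thesis using bounded_cball bounded_subset by blast
  qed
  have frD': "z \<noteq> 0" "inverse z \<in> frontier D1" "z \<notin> D'" if z: "z \<in> frontier D'" for z
  proof -
    have zc: "z \<in> closure D'" and zn: "z \<notin> D'" using z opD' by (auto simp: frontier_def interior_open)
    have "D \<inter> closure D' = {}" using D DD' by (metis open_Int_closure_eq_empty)
    then show nz: "z \<noteq> 0" using zc 0 by blast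
    show "z \<notin> D'" by (rule zn)
    obtain s where s: "\<And>n. s n \<in> D'" "s \<longlonglongrightarrow> z" using zc unfolding closure_sequential by blast
    have "(\<lambda>n. inverse (s n)) \<longlonglongrightarrow> inverse z" using s(2) nz by (rule tendsto_inverse)
    moreover have "inverse (s n) \<in> D1" for n using s(1) D'iff by blast
    ultimately have "inverse z \<in> closure D1"
      unfolding closure_sequential by (intro exI[of _ "\<lambda>n. inverse (s n)"]) simp
    moreover have "inverse z \<notin> D1" using zn nz D'iff by blast
    ultimately show "inverse z \<in> frontier D1" using D1(1) by (simp add: frontier_def interior_open)
  qed
  define B where "B = - (D \<union> D')"
  have frD: "frontier D \<subseteq> - D" using D(1) by (auto simp: frontier_def interior_open)
  have nz: "z \<noteq> 0" if "z \<in> frontier D" for z using that frD 0 by blast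
  have cc: "continuous_on (- {0}) c"
  proof -
    have "continuous_on (- {0}) (\<lambda>z. z powi e * exp (\<gamma> z))" by (intro continuous_intros \<gamma>(1)) auto
    then show ?thesis by (rule continuous_on_eq) (use \<gamma>(2) in auto)
  qed
  have c0: "c z \<noteq> 0" if "z \<noteq> 0" for z using that \<gamma>(2) by simp
  have ccD: "continuous_on (frontier D) c" "continuous_on (frontier D') c"
    using nz frD' by (auto intro!: continuous_on_subset[OF cc])
  have "\<exists>l l'. continuous_on (frontier D) l \<and> continuous_on (frontier D') l' \<and>
    (((\<forall>z \<in> frontier D. 1 - c z = exp (l z)) \<and> (\<forall>z \<in> frontier D'. 1 - inverse (c z) = exp (l' z)))
       \<or> ((\<forall>z \<in> frontier D. 1 - inverse (c z) = exp (l z)) \<and> (\<forall>z \<in> frontier D'. 1 - c z = exp (l' z))))"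
    using bd
  proof
    assume A: "(\<forall>z. z \<in> frontier V \<longrightarrow> z * c z ^ q \<in> V) \<and> (\<forall>z. z \<noteq> 0 \<longrightarrow> inverse z \<in> frontier V' \<longrightarrow> inverse (z * c z ^ q) \<in> V')"
    obtain l where l: "continuous_on (frontier D) l" "\<And>z. z \<in> frontier D \<Longrightarrow> 1 - c z = exp (l z)"
    proof (rule continuous_log_one_minus[OF D(1-3) 0, of "frontier D" c q])
      show "z * c z ^ q \<in> D" if "z \<in> frontier D" for z using A D that by blast
    qed (use frD ccD nz c0 q in auto)
    let ?K = "inverse ` frontier D'"
    have Kiff: "w \<noteq> 0" "inverse w \<in> frontier D'" "w \<in> frontier D1" if w: "w \<in> ?K" for w
      using w frD' by auto
    \<comment> \<open>The outer frontier is treated in the coordinate w = 1/z, where infinity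
      becomes 0 and \<open>c\<close> is replaced by its reciprocal.\<close>
    obtain l' where l': "continuous_on ?K l'" "\<And>w. w \<in> ?K \<Longrightarrow> 1 - inverse (c (inverse w)) = exp (l' w)"
    proof (rule continuous_log_one_minus[OF D1(1-3), of ?K "\<lambda>w. inverse (c (inverse w))" q])
      show "0 \<in> D1" using V' D1 by blast
      have "frontier D1 \<inter> D1 = {}" using D1(1) by (auto simp: frontier_def interior_open)
      then show "?K \<inter> D1 = {}" using Kiff by blast
      show "continuous_on ?K (\<lambda>w. inverse (c (inverse w)))"
      proof (rule continuous_on_inverse)
        have "continuous_on ?K (\<lambda>w. inverse w)"
          by (rule continuous_on_inverse[OF continuous_on_id]) (use Kiff(1) in blast)
        moreover have "inverse ` ?K \<subseteq> frontier D'" using Kiff(2) by blast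
        ultimately show "continuous_on ?K (\<lambda>w. c (inverse w))"
          by (rule continuous_on_compose2[OF ccD(2)])
        show "\<forall>w\<in>?K. c (inverse w) \<noteq> 0" using Kiff(1) c0 by (metis inverse_nonzero_iff_nonzero)
      qed
      show "inverse (c (inverse w)) \<noteq> 0" if "w \<in> ?K" for w using Kiff[OF that] c0 by auto
      show "w * inverse (c (inverse w)) ^ q \<in> D1" if "w \<in> ?K" for w
      proof -
        have k: "inverse w \<noteq> 0" using Kiff(1)[OF that] by simp
        have "inverse (inverse w) \<in> frontier V'" using Kiff[OF that] D1 by auto
        then have "inverse (inverse w * c (inverse w) ^ q) \<in> V'"
          using A[THEN conjunct2, rule_format, OF k] by blast
        moreover have "inverse (inverse w * c (inverse w) ^ q) = w * inverse (c (inverse w)) ^ q"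
          by (simp add: power_inverse)
        ultimately show ?thesis using D1 by auto
      qed
    qed (use q in auto)
    have "continuous_on (frontier D') (\<lambda>z. l' (inverse z))"
      by (rule continuous_on_compose2[OF l'(1)]) (use frD' in \<open>auto intro!: continuous_intros\<close>)
    moreover have "1 - inverse (c z) = exp (l' (inverse z))" if "z \<in> frontier D'" for z
      using l'(2)[of "inverse z"] that by simp
    ultimately show ?thesis using l by (intro exI[of _ l] exI[of _ "\<lambda>z. l' (inverse z)"]) auto
  next
    assume A: "(\<forall>z. z \<in> frontier V \<longrightarrow> cmod (c z) > 1) \<and> (\<forall>z. z \<noteq> 0 \<longrightarrow> inverse z \<in> frontier V' \<longrightarrow> cmod (c z) < 1)"
    \<comment> \<open>Here 1 - w lies in the open right half-plane, where the principal logarithm is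
      continuous.\<close>
    have pos: "1 - w \<notin> \<real>\<^sub>\<le>\<^sub>0" if "cmod w < 1" for w
    proof -
      have "Re w < 1" using that complex_Re_le_cmod[of w] by linarith
      then show ?thesis by (auto simp: complex_nonpos_Reals_iff)
    qed
    have 1: "cmod (inverse (c z)) < 1" if "z \<in> frontier D" for z
    proof -
      have "cmod (c z) > 1" using A D that by blast
      then show ?thesis by (simp add: norm_inverse inverse_less_1_iff)
    qed
    have 2: "cmod (c z) < 1" if "z \<in> frontier D'" for z using A D1 frD'[OF that] by blast
    have l: "continuous_on (frontier D) (\<lambda>z. Ln (1 - inverse (c z)))"
      using 1 pos nz c0 by (intro continuous_intros ccD) auto
    have l': "continuous_on (frontier D') (\<lambda>z. Ln (1 - c z))"
      using 2 pos by (intro continuous_intros ccD) auto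
    have "1 - w = exp (Ln (1 - w))" if "cmod w < 1" for w
      using pos[OF that] by (subst exp_Ln) auto
    then show ?thesis using l l' 1 2
      by (intro exI[of _ "\<lambda>z. Ln (1 - inverse (c z))"] exI[of _ "\<lambda>z. Ln (1 - c z)"]) auto
  qed
  then obtain l l' where "continuous_on (frontier D) l" "continuous_on (frontier D') l'"
    "((\<forall>z \<in> frontier D. 1 - c z = exp (l z)) \<and> (\<forall>z \<in> frontier D'. 1 - inverse (c z) = exp (l' z)))
       \<or> ((\<forall>z \<in> frontier D. 1 - inverse (c z) = exp (l z)) \<and> (\<forall>z \<in> frontier D'. 1 - c z = exp (l' z)))" by blast
  then have "\<exists>z\<in>B. c z = 1"
    by (intro value_one_between[OF D(1) opD' DD' conD' bD' 0 B_def e, of \<gamma> c l l'])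
       (use \<gamma> 0 in \<open>auto simp: B_def intro: continuous_on_subset\<close>)
  then obtain z where z: "z \<in> B" "c z = 1" by blast
  have "z \<noteq> 0" using z 0 by (auto simp: B_def)
  moreover have "inverse z \<notin> V'" using z D1 D'iff \<open>z \<noteq> 0\<close> by (auto simp: B_def)
  ultimately show ?thesis using that[of z] z D by (auto simp: B_def)
qed

section \<open>Fixed points in a ring\<close>

definition istereo :: "complex \<Rightarrow> complex \<times> real"
  where "istereo w = (of_real (2 / ((cmod w)\<^sup>2 + 1)) * w, ((cmod w)\<^sup>2 - 1) / ((cmod w)\<^sup>2 + 1))"

lemma cmod_sq_plus_1_pos: "(cmod w)\<^sup>2 + 1 > 0"
  by (simp add: add_nonneg_pos)

lemma continuous_on_istereo: "continuous_on A istereo"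
  unfolding istereo_def using cmod_sq_plus_1_pos
  by (intro continuous_intros) (metis less_irrefl)+

lemma snd_istereo_less: "snd (istereo w) < 1"
  using cmod_sq_plus_1_pos[of w] by (simp add: istereo_def)

lemma istereo_in_Sph: "istereo w \<in> Sph"
proof -
  define r where "r = (cmod w)\<^sup>2"
  define a where "a = r + 1"
  have a: "a > 0" using cmod_sq_plus_1_pos[of w] by (simp add: a_def r_def)
  have "cmod (fst (istereo w)) = 2 / a * cmod w"
    unfolding istereo_def fst_conv norm_mult norm_of_real r_def[symmetric] a_def[symmetric] using a by simp
  then have "(cmod (fst (istereo w)))\<^sup>2 = (2 / a)\<^sup>2 * r"
    by (simp only: power_mult_distrib r_def)
  moreover have "snd (istereo w) = (r - 1) / a"
    by (simp add: istereo_def r_def a_def)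
  ultimately have "(cmod (fst (istereo w)))\<^sup>2 + (snd (istereo w))\<^sup>2 = (4 * r + (r - 1)\<^sup>2) / a\<^sup>2"
    by (simp add: power_divide add_divide_distrib)
  also have "4 * r + (r - 1)\<^sup>2 = a\<^sup>2" unfolding a_def by (simp add: power2_eq_square algebra_simps)
  finally show ?thesis using a by (simp add: Sph_iff)
qed

lemma stereo_istereo [simp]: "stereo (istereo w) = w"
proof -
  let ?r = "(cmod w)\<^sup>2"
  have p: "?r + 1 > 0" by (rule cmod_sq_plus_1_pos)
  have "1 - (?r - 1) / (?r + 1) = 2 / (?r + 1)" using p by (simp add: field_simps)
  then have "stereo (istereo w) = of_real (2 / (?r + 1)) * w / of_real (2 / (?r + 1))"
    by (simp only: stereo_def istereo_def fst_conv snd_conv)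
  also have "of_real (2 / (?r + 1)) \<noteq> (0::complex)" using p by (simp only: of_real_eq_0_iff) simp
  then have "of_real (2 / (?r + 1)) * w / of_real (2 / (?r + 1)) = w" by simp
  finally show ?thesis .
qed

lemma istereo_stereo: "x \<in> Sph \<Longrightarrow> snd x < 1 \<Longrightarrow> istereo (stereo x) = x"
  by (rule stereo_inj) (auto simp: istereo_in_Sph snd_istereo_less)

text \<open>The inversion z -> 1/z of the stereographic chart, seen on the sphere: a half-turn that
  exchanges the poles. It reduces statements about \<open>(0, 1)\<close> to statements about
  \<open>(0, -1)\<close>.\<close>

definition flip :: "complex \<times> real \<Rightarrow> complex \<times> real"
  where "flip x = (cnj (fst x), - snd x)"

lemma flip_flip [simp]: "flip (flip x) = x"
  by (simp add: flip_def)

lemma continuous_on_flip: "continuous_on A flip"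
  unfolding flip_def by (intro continuous_intros)

lemma flip_in_Sph [simp]: "flip x \<in> Sph \<longleftrightarrow> x \<in> Sph"
  by (simp add: flip_def Sph_iff)

lemma istereo_inverse:
  assumes "z \<noteq> 0"
  shows "istereo (inverse z) = flip (istereo z)"
proof -
  define r where "r = (cmod z)\<^sup>2"
  have r: "r > 0" using assms by (simp add: r_def)
  have n: "(cmod (inverse z))\<^sup>2 = inverse r" by (simp only: r_def norm_inverse power_inverse)
  have ir: "inverse r + 1 = (r + 1) * inverse r" "inverse r - 1 = - ((r - 1) * inverse r)"
    using r by (simp_all add: distrib_right left_diff_distrib)
  have s: "(inverse r - 1) / (inverse r + 1) = - ((r - 1) / (r + 1))"
    unfolding ir using r by simp
  have two: "2 / (inverse r + 1) = 2 / (r + 1) * r"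
    unfolding ir using r by (simp add: divide_inverse)
  have "z * cnj z = of_real r" unfolding r_def by (rule complex_norm_square[symmetric])
  then have "of_real r * inverse z = cnj z" using assms by (simp add: field_simps)
  then have "of_real (2 / (inverse r + 1)) * inverse z = of_real (2 / (r + 1)) * cnj z"
    unfolding two of_real_mult mult.assoc by simp
  then show ?thesis unfolding istereo_def flip_def n fst_conv snd_conv s r_def[symmetric] by simp
qed

text \<open>The logarithm of the modulus of \<open>stereo x\<close> for a point \<open>x\<close> at
  height \<open>t\<close>.\<close>

definition log_height :: "real \<Rightarrow> real"
  where "log_height t = ln ((1 + t) / (1 - t)) / 2"

lemma log_height_less_iff:
  assumes "\<bar>s\<bar> < 1" "\<bar>t\<bar> < 1"
  shows "log_height s < log_height t \<longleftrightarrow> s < t"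
proof -
  have p: "1 - s > 0" "1 - t > 0" "1 + s > 0" "1 + t > 0" using assms by linarith+
  have "log_height s < log_height t \<longleftrightarrow> (1 + s) / (1 - s) < (1 + t) / (1 - t)"
    unfolding log_height_def using p by simp
  also have "\<dots> \<longleftrightarrow> (1 + s) * (1 - t) < (1 + t) * (1 - s)"
    by (simp only: pos_divide_less_eq[OF p(1)] times_divide_eq_left pos_less_divide_eq[OF p(2)])
  also have "\<dots> \<longleftrightarrow> s < t" by (simp add: algebra_simps)
  finally show ?thesis .
qed

lemma log_height_eq_iff:
  assumes "\<bar>s\<bar> < 1" "\<bar>t\<bar> < 1"
  shows "log_height s = log_height t \<longleftrightarrow> s = t"
  using log_height_less_iff[OF assms] log_height_less_iff[OF assms(2,1)] by (metis less_irrefl linorder_neqE_linordered_idom)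

lemma continuous_on_log_height:
  assumes "t < 1"
  shows "continuous_on {-t..t} log_height"
  unfolding log_height_def using assms by (intro continuous_intros) auto

lemma cmod_stereo_exp:
  assumes "x \<in> Sph" "\<bar>snd x\<bar> < 1"
  shows "cmod (stereo x) = exp (log_height (snd x))"
proof (rule power2_eq_imp_eq)
  have "(exp (log_height (snd x)))\<^sup>2 = exp (2 * log_height (snd x))"
    by (simp add: power2_eq_square flip: exp_add)
  also have "\<dots> = (1 + snd x) / (1 - snd x)"
  proof -
    have "(1 + snd x) / (1 - snd x) > 0" using assms(2) by (intro divide_pos_pos) linarith+
    then show ?thesis unfolding log_height_def by simp
  qed
  also have "\<dots> = (cmod (stereo x))\<^sup>2" using cmod_stereo[of x] assms by (simp add: abs_less_iff)
  finally show "(cmod (stereo x))\<^sup>2 = (exp (log_height (snd x)))\<^sup>2" by simp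
qed auto

lemma abs_snd_istereo:
  assumes "w \<noteq> 0"
  shows "\<bar>snd (istereo w)\<bar> < 1"
proof -
  have "istereo w \<noteq> (0, -1)"
  proof
    assume "istereo w = (0, -1)"
    then have "stereo (istereo w) = stereo (0, -1)" by simp
    then show False using assms by (simp add: stereo_def[of "(0, -1)"])
  qed
  moreover have "istereo w \<noteq> (0, 1)" using snd_istereo_less[of w] by auto
  ultimately show ?thesis using Sph_snd_less[OF istereo_in_Sph] by blast
qed

lemma cmod_eq_exp_log_height: "w \<noteq> 0 \<Longrightarrow> cmod w = exp (log_height (snd (istereo w)))"
  using cmod_stereo_exp[OF istereo_in_Sph abs_snd_istereo] by simp

lemma snd_istereo_eq:
  assumes "cmod w = exp (log_height t)" "\<bar>t\<bar> < 1"
  shows "snd (istereo w) = t"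
proof -
  have w: "w \<noteq> 0" using assms(1) by auto
  then have "log_height (snd (istereo w)) = log_height t"
    using cmod_eq_exp_log_height[OF w] assms(1) by simp
  then show ?thesis using log_height_eq_iff[OF abs_snd_istereo[OF w] assms(2)] by simp
qed

lemma sgn_stereo: "snd x < 1 \<Longrightarrow> sgn (stereo x) = sgn (fst x)"
proof -
  assume "snd x < 1"
  then have "sgn (complex_of_real (1 - snd x)) = 1" unfolding sgn_of_real by simp
  then show ?thesis unfolding stereo_def by (simp add: sgn_divide)
qed

lemma closure_subset_Sph: "A \<subseteq> Sph \<Longrightarrow> closure A \<subseteq> Sph"
  by (simp add: Sph_def closure_minimal)

lemma cap_in_neighbourhood:
  assumes V: "openin (top_of_set Sph) V" "(0, -1) \<in> V"
  obtains t where "0 < t" "t < 1" "\<And>x. x \<in> Sph \<Longrightarrow> snd x \<le> -t \<Longrightarrow> x \<in> V"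
proof -
  obtain O' where O': "open O'" "V = Sph \<inter> O'" using V(1) openin_open by blast
  have comp: "compact (Sph - O')" unfolding Sph_def using O'(1) by (intro compact_diff) auto
  show ?thesis
  proof (cases "Sph - O' = {}")
    case True
    then show ?thesis using that[of "1/2"] O' by auto
  next
    case False
    obtain y where y: "y \<in> Sph - O'" "\<And>x. x \<in> Sph - O' \<Longrightarrow> snd y \<le> snd x"
      using continuous_attains_inf[OF comp False continuous_on_snd[OF continuous_on_id]] by blast
    have "y \<noteq> (0, -1)" using y V O' by auto
    then have "snd y > -1" using Sph_snd_eq(2)[of y] Sph_snd_le[of y] y by auto
    \<comment> \<open>-(1 - snd y) / 2 is the midpoint of -1 and \<open>snd y\<close>; the maximum
      with 1/2 keeps \<open>t\<close> positive.\<close>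
    define t where "t = max (1/2) ((1 - snd y) / 2)"
    have t: "0 < t" "t < 1" using \<open>snd y > -1\<close> by (auto simp: t_def)
    have "(1 - snd y) / 2 \<le> t" by (simp add: t_def)
    then have "- t < snd y" using \<open>snd y > -1\<close> by (simp add: field_simps)
    show ?thesis
    proof (rule that[OF t])
      fix x assume x: "x \<in> Sph" "snd x \<le> -t"
      then have "snd x < snd y" using \<open>- t < snd y\<close> by linarith
      then show "x \<in> V" using y(2)[of x] x O' by (cases "x \<in> O'") auto
    qed
  qed
qed

text \<open>The bound on the height keeps \<open>V\<close> away from the point that projects to
  infinity, so its image in the plane is bounded.\<close>

lemma chart_of_neighbourhood:
  assumes V: "openin (top_of_set Sph) V" "connected V" "(0, -1) \<in> V" and t: "t < 1" "\<And>x. x \<in> V \<Longrightarrow> snd x < t"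
  shows "open {w. istereo w \<in> V}" "connected {w. istereo w \<in> V}" "bounded {w. istereo w \<in> V}" "0 \<in> {w. istereo w \<in> V}"
    "z \<in> frontier {w. istereo w \<in> V} \<Longrightarrow> istereo z \<in> closure V \<and> z \<noteq> 0"
proof -
  obtain O' where O': "open O'" "V = Sph \<inter> O'" using V(1) openin_open by blast
  have eq: "{w. istereo w \<in> V} = istereo -` O'" using O' istereo_in_Sph by auto
  show o: "open {w. istereo w \<in> V}"
    unfolding eq by (rule open_vimage[OF O'(1)]) (rule continuous_on_istereo)
  have VS: "V \<subseteq> Sph" using O' by blast
  have im: "{w. istereo w \<in> V} = stereo ` V"
  proof (rule Set.set_eqI, rule iffI)
    fix w assume "w \<in> {w. istereo w \<in> V}"
    then show "w \<in> stereo ` V" by (metis image_eqI mem_Collect_eq stereo_istereo)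
  next
    fix w assume "w \<in> stereo ` V"
    then obtain x where x: "x \<in> V" "w = stereo x" by blast
    have "snd x < 1" using t(2)[OF x(1)] t(1) by linarith
    then have "istereo w = x" using istereo_stereo[of x] VS x by blast
    then show "w \<in> {w. istereo w \<in> V}" using x by simp
  qed
  show "connected {w. istereo w \<in> V}"
    unfolding im using t by (intro connected_continuous_image V(2) continuous_on_subset[OF continuous_on_stereo]) fastforce
  have n: "cmod w \<le> exp (log_height \<bar>t\<bar>)" if w: "istereo w \<in> V" for w
  proof (cases "w = 0")
    case False
    have s: "\<bar>snd (istereo w)\<bar> < 1" by (rule abs_snd_istereo[OF False])
    have "snd (istereo w) < t" using t w by blast
    then have t1: "\<bar>t\<bar> < 1" using s t by linarith
    have "log_height (snd (istereo w)) < log_height t"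
      using log_height_less_iff[OF s t1] \<open>snd (istereo w) < t\<close> by blast
    moreover have "log_height t \<le> log_height \<bar>t\<bar>"
      using log_height_less_iff[of "\<bar>t\<bar>" t] t1 by linarith
    ultimately show ?thesis using cmod_eq_exp_log_height[OF False] by simp
  qed simp
  show "bounded {w. istereo w \<in> V}"
    by (rule boundedI[of _ "exp (log_height \<bar>t\<bar>)"]) (use n in auto)
  show 0: "0 \<in> {w. istereo w \<in> V}" using V(3) by (simp add: istereo_def)
  assume z: "z \<in> frontier {w. istereo w \<in> V}"
  have "closed {w. istereo w \<in> closure V}"
    using closed_vimage[OF closed_closure continuous_on_istereo, of V] by (simp add: vimage_def)
  then have "closure {w. istereo w \<in> V} \<subseteq> {w. istereo w \<in> closure V}"
    by (intro closure_minimal) (use closure_subset in auto)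
  then show "istereo z \<in> closure V \<and> z \<noteq> 0"
    using z o 0 by (auto simp: frontier_def interior_open)
qed

lemma connected_meets_boundary:
  assumes A: "connected A" "A \<subseteq> S" and K: "closed K" "A \<inter> K \<noteq> {}" "\<not> A \<subseteq> K"
  shows "\<exists>y. y \<in> A \<and> y \<in> K \<and> y \<in> closure (S - K)"
proof (rule ccontr)
  assume no: "\<not> ?thesis"
  have "A \<subseteq> K \<union> closure (S - K)" using A closure_subset[of "S - K"] by blast
  moreover have "K \<inter> closure (S - K) \<inter> A = {}" using no by blast
  moreover have "closure (S - K) \<inter> A \<noteq> {}" using K A closure_subset[of "S - K"] by blast
  ultimately show False
    using A(1) K(1,2) closed_closure[of "S - K"] unfolding connected_closed by blast
qed

lemma exp_root_of_unity_inj: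
  assumes "j < q" "j' < q" "exp (2 * of_real pi * \<i> * of_nat j / of_nat q) = exp (2 * of_real pi * \<i> * of_nat j' / of_nat q)"
  shows "j = j'"
proof -
  obtain n :: int where n: "2 * of_real pi * \<i> * of_nat j / of_nat q = 2 * of_real pi * \<i> * of_nat j' / of_nat q + (of_int (2 * n) * of_real pi) * \<i>"
    using assms(3) unfolding exp_eq by auto
  have q: "q \<noteq> 0" using assms by auto
  have "(2 * of_real pi * \<i>) * of_nat j = (2 * of_real pi * \<i>) * (of_nat j' + of_int n * of_nat q :: complex)"
    using n q by (simp add: field_simps)
  then have "(of_nat j :: complex) = of_nat j' + of_int n * of_nat q" by simp
  then have "(of_int (int j) :: complex) = of_int (int j' + n * int q)" by simp
  then have "int j = int j' + n * int q" by (simp only: of_int_eq_iff)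
  then have "int j mod int q = int j' mod int q" by simp
  then show ?thesis using assms by simp
qed

section \<open>Attracting neighbourhoods of the poles\<close>

lemma in_flip_image: "x \<in> flip ` V \<longleftrightarrow> flip x \<in> V"
proof
  assume "flip x \<in> V"
  then have "flip (flip x) \<in> flip ` V" by (rule imageI)
  then show "x \<in> flip ` V" by simp
qed auto

lemma openin_flip_image:
  assumes "openin (top_of_set Sph) V"
  shows "openin (top_of_set Sph) (flip ` V)"
proof -
  have "openin (top_of_set Sph) (Sph \<inter> flip -` V)"
    by (rule continuous_openin_preimage[OF continuous_on_flip _ assms]) auto
  moreover have "V \<subseteq> Sph" using assms openin_imp_subset by blast
  then have "Sph \<inter> flip -` V = flip ` V" by (auto simp: in_flip_image)
  ultimately show ?thesis by simp
qed

locale attracting_poles =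
  fixes F :: "complex \<times> real \<Rightarrow> complex \<times> real" and VN VS :: "(complex \<times> real) set"
  assumes F: "continuous_on Sph F" "x \<in> Sph \<Longrightarrow> F x \<in> Sph"
    and VN: "openin (top_of_set Sph) VN" "connected VN" "(0, -1) \<in> VN"
    and VS: "openin (top_of_set Sph) VS" "connected VS" "(0, 1) \<in> VS"
    and disj: "VN \<inter> VS = {}"
    and attr: "x \<in> closure VN \<Longrightarrow> F x \<in> VN" "x \<in> closure VS \<Longrightarrow> F x \<in> VS"
begin

lemma closure_disj: "closure VN \<inter> VS = {}" "VN \<inter> closure VS = {}"
proof -
  obtain O' where O': "open O'" "VS = Sph \<inter> O'" using VS(1) openin_open by blast
  have "VN \<subseteq> Sph" "VS \<subseteq> Sph" using VN(1) VS(1) openin_imp_subset by auto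
  then have s: "closure VN \<subseteq> Sph" "closure VS \<subseteq> Sph" by (simp_all add: closure_subset_Sph)
  have "VN \<inter> O' = {}" using disj O' \<open>VN \<subseteq> Sph\<close> by blast
  then have "closure VN \<inter> O' = {}" using O'(1) by (metis inf_commute open_Int_closure_eq_empty)
  then show "closure VN \<inter> VS = {}" using O' by blast
  obtain O'' where O'': "open O''" "VN = Sph \<inter> O''" using VN(1) openin_open by blast
  have "VS \<inter> O'' = {}" using disj O'' \<open>VS \<subseteq> Sph\<close> by blast
  then have "closure VS \<inter> O'' = {}" using O''(1) by (metis inf_commute open_Int_closure_eq_empty)
  then show "VN \<inter> closure VS = {}" using O'' by blast
qed

lemma closure_N_S_subset: "closure VN \<subseteq> Sph" "closure VS \<subseteq> Sph"
  by (rule closure_subset_Sph[OF openin_imp_subset[OF VN(1)]], rule closure_subset_Sph[OF openin_imp_subset[OF VS(1)]])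

lemma caps:
  obtains t where "0 < t" "t < 1" "\<And>x. x \<in> Sph \<Longrightarrow> snd x \<le> -t \<Longrightarrow> x \<in> VN" "\<And>x. x \<in> Sph \<Longrightarrow> t \<le> snd x \<Longrightarrow> x \<in> VS"
proof -
  obtain t1 where t1: "0 < t1" "t1 < 1" "\<And>x. x \<in> Sph \<Longrightarrow> snd x \<le> -t1 \<Longrightarrow> x \<in> VN"
    using cap_in_neighbourhood[OF VN(1,3)] by blast
  have "openin (top_of_set Sph) (flip ` VS)" by (rule openin_flip_image[OF VS(1)])
  moreover have "(0, -1) \<in> flip ` VS"
    using VS(3) unfolding in_flip_image by (simp add: flip_def)
  ultimately obtain t2 where t2: "0 < t2" "t2 < 1" "\<And>x. x \<in> Sph \<Longrightarrow> snd x \<le> -t2 \<Longrightarrow> x \<in> flip ` VS"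
    using cap_in_neighbourhood[of "flip ` VS"] by blast
  show ?thesis
  proof (rule that[of "max t1 t2"])
    fix x assume x: "x \<in> Sph" "max t1 t2 \<le> snd x"
    then have "flip x \<in> flip ` VS" by (intro t2(3)) (simp, simp add: flip_def)
    then show "x \<in> VS" by (simp add: in_flip_image)
  next
    fix x assume "x \<in> Sph" "snd x \<le> - max t1 t2"
    then show "x \<in> VN" by (intro t1(3)) linarith+
  qed (use t1(1,2) t2(1,2) in linarith)+
qed

text \<open>The fixed points correspond to the solutions of \<open>c j z = 1\<close>, where \<open>c j\<close> for \<open>j < q = |m - 1|\<close> are the branches of a
  \<open>q\<close>-th root of the quotient of the map by the identity in the stereographic chart; different branches
  have different solutions.\<close>

lemma ring_fixed_points:
  assumes K: "closed K0" "closed K1" "K0 \<inter> K1 = {}" "K0 \<subseteq> Sph" "K1 \<subseteq> Sph" "(0, -1) \<in> K0" "(0, 1) \<in> K1"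
    and v: "\<And>x. x \<in> K0 \<Longrightarrow> x \<in> closure (Sph - K0) \<Longrightarrow> snd (F x) = v0"
           "\<And>x. x \<in> K1 \<Longrightarrow> x \<in> closure (Sph - K1) \<Longrightarrow> snd (F x) = v1"
    and v01: "v0 = -1 \<and> v1 = 1 \<or> v0 = 1 \<and> v1 = -1"
    and \<theta>: "continuous_on {x \<in> Sph - K0 - K1. \<bar>snd (F x)\<bar> < 1} \<theta>"
      "\<And>x. \<lbrakk>x \<in> Sph - K0 - K1; \<bar>snd (F x)\<bar> < 1\<rbrakk> \<Longrightarrow> sgn (fst (F x)) = sgn (fst x) powi m * exp (\<i> * of_real (\<theta> x))"
    and m: "m \<noteq> 1"
  obtains Z where "Z \<subseteq> {x \<in> Sph - K0 - K1. F x = x}" "finite Z" "card Z = nat \<bar>m - 1\<bar>"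
proof -
  obtain t where t: "0 < t" "t < 1" and capN: "\<And>x. x \<in> Sph \<Longrightarrow> snd x \<le> -t \<Longrightarrow> x \<in> VN"
    and capS: "\<And>x. x \<in> Sph \<Longrightarrow> t \<le> snd x \<Longrightarrow> x \<in> VS"
    using caps by blast
  define R where "R = Sph - K0 - K1"
  \<comment> \<open>Heights of images are cut off at -t and t so that \<open>log_height\<close>
    stays finite. This alters only images in the caps beyond these heights, which lie in
    \<open>VN\<close> and \<open>VS\<close>.\<close>
  define \<tau>c where "\<tau>c = (\<lambda>x. max (-t) (min t (snd (F x))))"
  \<comment> \<open>The pieces fit because F has height \<open>v0\<close> or \<open>v1\<close> on
    the boundaries of \<open>K0\<close> and \<open>K1\<close>, and the cut-off turns 1 and -1 into t
    and -t.\<close>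
  define \<tau> where "\<tau> = (\<lambda>x. if x \<in> K0 then v0 * t else if x \<in> K1 then v1 * t else \<tau>c x)"
  have RS: "closure R \<subseteq> Sph" by (rule closure_subset_Sph) (auto simp: R_def)
  have cF: "continuous_on A (\<lambda>x. snd (F x))" if "A \<subseteq> Sph" for A
    by (intro continuous_intros continuous_on_subset[OF F(1)] that)
  have clR: "snd (F x) = v0" if "x \<in> K0" "x \<in> closure R" for x
    by (rule v(1)[OF that(1)]) (use that(2) closure_mono[of R "Sph - K0"] in \<open>auto simp: R_def\<close>)
  have clR1: "snd (F x) = v1" if "x \<in> K1" "x \<in> closure R" for x
    by (rule v(2)[OF that(1)]) (use that(2) closure_mono[of R "Sph - K1"] in \<open>auto simp: R_def\<close>)
  have cover: "Sph = K0 \<union> (K1 \<union> closure R)"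
    using K(4,5) RS closure_subset[of R] by (auto simp: R_def)
  have c\<tau>c: "continuous_on (closure R) \<tau>c"
    unfolding \<tau>c_def by (intro continuous_intros cF RS)
  have vt: "\<tau>c x = v0 * t" if "snd (F x) = v0" for x using that v01 t by (auto simp: \<tau>c_def)
  have vt1: "\<tau>c x = v1 * t" if "snd (F x) = v1" for x using that v01 t by (auto simp: \<tau>c_def)
  have c1: "continuous_on (K1 \<union> closure R) (\<lambda>x. if x \<in> K1 then v1 * t else \<tau>c x)"
    by (rule continuous_on_cases) (use K c\<tau>c clR1 vt1 in auto)
  have c\<tau>: "continuous_on Sph \<tau>"
    unfolding cover \<tau>_def
    by (rule continuous_on_cases) (use K c1 clR vt in auto)
  have \<tau>_le: "\<bar>\<tau> x\<bar> \<le> t" for x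
    using v01 t by (auto simp: \<tau>_def \<tau>c_def)
  \<comment> \<open>On this closed set the cut-off changes nothing and the image heights stay away
    from 1 and -1; hence \<open>\<theta>\<close> is continuous on it and extends by Tietze.\<close>
  define C0 where "C0 = {x \<in> closure R. \<bar>snd (F x)\<bar> \<le> t}"
  have "closed C0"
  proof -
    have "closed (closure R \<inter> (\<lambda>x. snd (F x)) -` {-t..t})"
      by (rule continuous_closed_preimage[OF cF[OF RS]]) auto
    moreover have "closure R \<inter> (\<lambda>x. snd (F x)) -` {-t..t} = C0" by (auto simp: C0_def)
    ultimately show ?thesis by simp
  qed
  have C0: "x \<in> R" "\<bar>snd (F x)\<bar> < 1" "\<tau> x = snd (F x)" if "x \<in> C0" for x
  proof -
    show 1: "\<bar>snd (F x)\<bar> < 1" using that t by (auto simp: C0_def)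
    have "x \<notin> K0" "x \<notin> K1"
      using clR[of x] clR1[of x] that 1 v01 by (auto simp: C0_def)
    moreover have "x \<in> Sph" using that RS by (auto simp: C0_def)
    ultimately show "x \<in> R" by (simp add: R_def)
    show "\<tau> x = snd (F x)" using \<open>x \<notin> K0\<close> \<open>x \<notin> K1\<close> that by (auto simp: \<tau>_def \<tau>c_def C0_def)
  qed
  have "continuous_on C0 \<theta>"
    by (rule continuous_on_subset[OF \<theta>(1)]) (use C0 in \<open>auto simp: R_def\<close>)
  then obtain \<theta>' where \<theta>': "continuous_on UNIV \<theta>'" "\<And>x. x \<in> C0 \<Longrightarrow> \<theta>' x = \<theta> x"
    using Tietze_unbounded[of C0 \<theta> UNIV] \<open>closed C0\<close> by auto
  define q where "q = nat \<bar>m - 1\<bar>"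
  define e :: int where "e = sgn (m - 1)"
  have q: "q > 0" and e: "e = 1 \<or> e = -1" and eq: "e * int q = m - 1"
    using m by (auto simp: q_def e_def sgn_if)
  \<comment> \<open>Chosen so that z^m exp(g) is the model map \<open>h\<close> below, with modulus
    exp(log_height \<tau>) and direction (sgn z)^m exp(i \<theta>'). Since m - 1 = e q, the
    functions \<open>c j\<close> are then the q-th roots of h(z)/z.\<close>
  define g where "g = (\<lambda>z. of_real (log_height (\<tau> (istereo z)) - of_int m * ln (cmod z)) + \<i> * of_real (\<theta>' (istereo z)) :: complex)"
  define \<gamma> where "\<gamma> = (\<lambda>j::nat. \<lambda>z. g z / of_nat q + 2 * of_real pi * \<i> * of_nat j / of_nat q)"
  define c where "c = (\<lambda>j z. z powi e * exp (\<gamma> j z))"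
  define h where "h = (\<lambda>z. sgn z powi m * exp (of_real (log_height (\<tau> (istereo z))) + \<i> * of_real (\<theta>' (istereo z))))"
  have "continuous_on (- {0}) (\<lambda>z. \<tau> (istereo z))"
    by (rule continuous_on_compose2[OF c\<tau> continuous_on_istereo]) (use istereo_in_Sph in blast)
  moreover have "(\<lambda>z. \<tau> (istereo z)) ` (- {0}) \<subseteq> {-t..t}"
  proof
    fix y assume "y \<in> (\<lambda>z. \<tau> (istereo z)) ` (- {0})"
    then obtain z where "y = \<tau> (istereo z)" by blast
    then show "y \<in> {-t..t}" using abs_le_D1[OF \<tau>_le] abs_le_D2[OF \<tau>_le] by (simp add: minus_le_iff)
  qed
  ultimately have ch: "continuous_on (- {0}) (\<lambda>z. log_height (\<tau> (istereo z)))"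
    by (rule continuous_on_compose2[OF continuous_on_log_height[OF t(2)]])
  have ct: "continuous_on (- {0}) (\<lambda>z. \<theta>' (istereo z))"
    by (rule continuous_on_compose2[OF \<theta>'(1) continuous_on_istereo]) auto
  have cln: "continuous_on (- {0::complex}) (\<lambda>z. ln (cmod z))"
    by (intro continuous_intros) auto
  have cg: "continuous_on (- {0}) g"
    unfolding g_def by (intro continuous_intros ch ct cln)
  have c\<gamma>: "continuous_on (- {0}) (\<gamma> j)" for j
    unfolding \<gamma>_def by (intro continuous_on_add continuous_on_divide cg continuous_on_const) (use q in auto)
  have expq: "exp (w / of_nat q) ^ q = exp w" for w :: complex
    using q exp_of_nat_mult[of q "w / of_nat q"] by simp
  have h: "z * c j z ^ q = h z" if z: "z \<noteq> 0" for j z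
  proof -
    define A where "A = of_real (log_height (\<tau> (istereo z))) + \<i> * of_real (\<theta>' (istereo z))"
    define r where "r = complex_of_real (cmod z)"
    have r: "r \<noteq> 0" "sgn z = z / r" using z by (simp_all add: r_def sgn_eq)
    have "exp (- (of_int m * of_real (ln (cmod z))) :: complex) = r powi (- m)"
    proof -
      have "exp (of_real (ln (cmod z)) :: complex) = r"
        using z by (simp add: exp_of_real r_def)
      then show ?thesis
        using exp_power_int[of "of_real (ln (cmod z)) :: complex" "- m"] by simp
    qed
    moreover have "g z = A + - (of_int m * of_real (ln (cmod z)))" by (simp add: g_def A_def)
    ultimately have eg: "exp (g z) = exp A * r powi (- m)" by (simp only: exp_add)
    have root: "exp (2 * of_real pi * \<i> * of_nat j :: complex) = 1"
      using exp_integer_2pi[of "of_nat j"] by (simp add: mult_ac)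
    have "c j z = z powi e * (exp (g z / of_nat q) * exp (2 * of_real pi * \<i> * of_nat j / of_nat q))"
      unfolding c_def \<gamma>_def exp_add by (rule refl)
    then have "c j z ^ q = (z powi e) ^ q * exp (g z)"
      by (simp only: power_mult_distrib expq root mult_1_right)
    also have "(z powi e) ^ q = z powi (m - 1)"
      unfolding eq[symmetric] by (simp add: power_int_mult)
    finally have "z * c j z ^ q = (z * z powi (m - 1)) * exp (g z)" by (simp only: mult.assoc)
    also have "z * z powi (m - 1) = z powi m"
      using z power_int_add[of z 1 "m - 1"] by simp
    also have "z powi m * exp (g z) = (z powi m / r powi m) * exp A"
      unfolding eg power_int_minus divide_inverse by (simp only: mult_ac)
    also have "z powi m / r powi m = sgn z powi m"
      unfolding r(2) by (simp only: power_int_divide_distrib)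
    finally show ?thesis by (simp only: h_def A_def)
  qed
  have \<tau>1: "\<bar>\<tau> x\<bar> < 1" for x using \<tau>_le[of x] t by linarith
  have hn: "cmod (h z) = exp (log_height (\<tau> (istereo z)))" if "z \<noteq> 0" for z
    using that by (simp add: h_def norm_mult norm_power_int norm_sgn exp_add)
  have hnz: "h z \<noteq> 0" if "z \<noteq> 0" for z using hn[OF that] by (metis exp_not_eq_zero norm_eq_zero)
  have shz: "snd (istereo (h z)) = \<tau> (istereo z)" if "z \<noteq> 0" for z
    by (rule snd_istereo_eq[OF hn[OF that] \<tau>1])
  have hC0: "h z = stereo (F (istereo z))" if z: "z \<noteq> 0" "istereo z \<in> C0" for z
  proof -
    let ?x = "istereo z"
    have x: "?x \<in> Sph - K0 - K1" "\<bar>snd (F ?x)\<bar> < 1" using C0[OF z(2)] by (auto simp: R_def)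
    have s1: "snd ?x < 1" "snd (F ?x) < 1" using snd_istereo_less x by auto
    have "stereo (F ?x) = sgn (stereo (F ?x)) * of_real (cmod (stereo (F ?x)))"
      by (cases "stereo (F ?x) = 0") (simp_all add: sgn_eq)
    also have "sgn (stereo (F ?x)) = sgn z powi m * exp (\<i> * of_real (\<theta> ?x))"
      using \<theta>(2)[OF x] sgn_stereo[OF s1(1)] sgn_stereo[OF s1(2)] by simp
    also have "cmod (stereo (F ?x)) = exp (log_height (\<tau> ?x))"
      using cmod_stereo_exp[OF F(2) x(2)] C0(3)[OF z(2)] istereo_in_Sph by simp
    also have "\<theta> ?x = \<theta>' ?x" using \<theta>'(2)[OF z(2)] by simp
    finally show ?thesis by (simp add: h_def exp_add exp_of_real mult_ac)
  qed
  define V where "V = {w. istereo w \<in> VN}"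
  define V' where "V' = {w. istereo w \<in> flip ` VS}"
  have VSsub: "VN \<subseteq> Sph" "VS \<subseteq> Sph" using VN(1) VS(1) openin_imp_subset by auto
  have V'iff: "w \<in> V' \<longleftrightarrow> flip (istereo w) \<in> VS" for w
    by (simp add: V'_def in_flip_image)
  have flipVS: "openin (top_of_set Sph) (flip ` VS)" "connected (flip ` VS)" "(0, -1) \<in> flip ` VS"
  proof -
    show "openin (top_of_set Sph) (flip ` VS)" by (rule openin_flip_image[OF VS(1)])
    show "connected (flip ` VS)" by (rule connected_continuous_image[OF continuous_on_flip VS(2)])
    show "(0, -1) \<in> flip ` VS" using VS(3) unfolding in_flip_image by (simp add: flip_def)
  qed
  have lt: "snd x < t" if "x \<in> closure VN" for x
  proof -
    have "x \<in> Sph" "x \<notin> VS" using that closure_disj closure_N_S_subset by auto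
    then show ?thesis using capS[of x] by linarith
  qed
  have gt: "- t < snd x" if "x \<in> closure VS" for x
  proof -
    have "x \<in> Sph" "x \<notin> VN" using that closure_disj closure_N_S_subset by auto
    then show ?thesis using capN[of x] by linarith
  qed
  have lt1: "snd x < t" if "x \<in> VN" for x using that lt closure_subset by blast
  have gt1: "snd x < t" if "x \<in> flip ` VS" for x
  proof -
    have "flip x \<in> closure VS" using that closure_subset[of VS] by (auto simp: in_flip_image)
    from gt[OF this] show ?thesis by (simp add: flip_def)
  qed
  have chV: "open V" "connected V" "bounded V" "0 \<in> V"
    and chVf: "\<And>z. z \<in> frontier V \<Longrightarrow> istereo z \<in> closure VN \<and> z \<noteq> 0"
    using chart_of_neighbourhood[OF VN t(2)] lt1 unfolding V_def by blast+
  have chV': "open V'" "connected V'" "bounded V'" "0 \<in> V'"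
    and chVf': "\<And>z. z \<in> frontier V' \<Longrightarrow> istereo z \<in> closure (flip ` VS) \<and> z \<noteq> 0"
    using chart_of_neighbourhood[OF flipVS t(2)] gt1 unfolding V'_def by blast+
  have VV': "inverse z \<notin> V'" if "z \<noteq> 0" "z \<in> V" for z
    using that disj by (auto simp: V'iff istereo_inverse V_def)
  have frV: "istereo z \<in> closure VN" "z \<noteq> 0" if "z \<in> frontier V" for z
    using chVf[OF that] by auto
  have frV': "istereo z \<in> closure VS" if "z \<noteq> 0" "inverse z \<in> frontier V'" for z
  proof -
    have "flip (istereo z) \<in> closure (flip ` VS)"
      using chVf'[OF that(2)] istereo_inverse[OF that(1)] by simp
    moreover have "flip ` closure (flip ` VS) \<subseteq> closure VS"
      by (rule image_closure_subset[OF continuous_on_flip]) (use closure_subset[of VS] in \<open>auto simp: in_flip_image\<close>)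
    ultimately have "flip (flip (istereo z)) \<in> closure VS" by blast
    then show ?thesis by simp
  qed
  have conN: "connected (closure VN)" "connected (closure VS)"
    using VN(2) VS(2) by (auto intro: connected_imp_connected_closure)
  have poles: "(0, -1) \<in> closure VN" "(0, 1) \<in> closure VS"
    using VN(3) VS(3) closure_subset by auto
  have F1: "snd (F x) < t" if "x \<in> closure VN" for x using attr(1)[OF that] lt1 by blast
  have F2: "- t < snd (F x)" if "x \<in> closure VS" for x
    using attr(2)[OF that] gt closure_subset[of VS] by blast
  have bd: "((\<forall>z. z \<in> frontier V \<longrightarrow> z * c j z ^ q \<in> V) \<and> (\<forall>z. z \<noteq> 0 \<longrightarrow> inverse z \<in> frontier V' \<longrightarrow> inverse (z * c j z ^ q) \<in> V'))
      \<or> ((\<forall>z. z \<in> frontier V \<longrightarrow> cmod (c j z) > 1) \<and> (\<forall>z. z \<noteq> 0 \<longrightarrow> inverse z \<in> frontier V' \<longrightarrow> cmod (c j z) < 1))" for j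
  proof (cases "v0 = -1")
    case True
    then have v1: "v1 = 1" using v01 by auto
    \<comment> \<open>\<open>closure VN\<close> contains a point outside \<open>K1\<close>. If it
      met \<open>K1\<close>, it would meet the boundary of \<open>K1\<close>, where F has height 1,
      whereas F sends \<open>closure VN\<close> to heights below t.\<close>
    have no1: "closure VN \<inter> K1 = {}"
    proof (rule ccontr)
      assume "closure VN \<inter> K1 \<noteq> {}"
      moreover have "\<not> closure VN \<subseteq> K1" using poles K by blast
      ultimately obtain y where "y \<in> closure VN" "y \<in> K1" "y \<in> closure (Sph - K1)"
        using connected_meets_boundary[OF conN(1) closure_N_S_subset(1) K(2)] by blast
      then show False using v(2)[of y] F1[of y] v1 t by simp
    qed
    have no0: "closure VS \<inter> K0 = {}"
    proof (rule ccontr)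
      assume "closure VS \<inter> K0 \<noteq> {}"
      moreover have "\<not> closure VS \<subseteq> K0" using poles K by blast
      ultimately obtain y where "y \<in> closure VS" "y \<in> K0" "y \<in> closure (Sph - K0)"
        using connected_meets_boundary[OF conN(2) closure_N_S_subset(2) K(1)] by blast
      then show False using v(1)[of y] F2[of y] True t by simp
    qed
    have "z * c j z ^ q \<in> V" if zf: "z \<in> frontier V" for z
    proof -
      note z = frV[OF zf]
      let ?x = "istereo z"
      have xS: "?x \<in> Sph" by (rule istereo_in_Sph)
      have "istereo (h z) \<in> VN"
      proof (cases "?x \<in> C0")
        case True
        have "snd (F ?x) < 1" using F1[OF z(1)] t by linarith
        then have "istereo (h z) = F ?x" using hC0[OF z(2) True] istereo_stereo[OF F(2)[OF xS]] by simp
        then show ?thesis using attr(1)[OF z(1)] by simp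
      next
        case False
        \<comment> \<open>Off \<open>C0\<close> the model has height -t, either because the point is
          in \<open>K0\<close> or because its image was cut off at the lower end; and height -t
          belongs to \<open>VN\<close>.\<close>
        have "\<tau> ?x = - t"
        proof (cases "?x \<in> K0")
          case False
          then have "?x \<in> R" using no1 z xS by (auto simp: R_def)
          then have "\<bar>snd (F ?x)\<bar> > t" using \<open>?x \<notin> C0\<close> closure_subset[of R] by (auto simp: C0_def)
          then have "snd (F ?x) < - t" using F1[OF z(1)] by linarith
          then show ?thesis using \<open>?x \<in> R\<close> t by (auto simp: \<tau>_def \<tau>c_def R_def)
        qed (simp add: \<tau>_def \<open>v0 = -1\<close>)
        then show ?thesis by (intro capN istereo_in_Sph) (simp add: shz[OF z(2)])
      qed
      then show ?thesis by (simp add: h[OF z(2)] V_def)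
    qed
    moreover have "inverse (z * c j z ^ q) \<in> V'" if z0: "z \<noteq> 0" and zf: "inverse z \<in> frontier V'" for z
    proof -
      note z = frV'[OF z0 zf]
      let ?x = "istereo z"
      have xS: "?x \<in> Sph" by (rule istereo_in_Sph)
      have "istereo (h z) \<in> VS"
      proof (cases "?x \<in> C0")
        case True
        have "snd (F ?x) < 1" using C0(2)[OF True] by linarith
        then have "istereo (h z) = F ?x" using hC0[OF z0 True] istereo_stereo[OF F(2)[OF xS]] by simp
        then show ?thesis using attr(2)[OF z] by simp
      next
        case False
        have "\<tau> ?x = t"
        proof (cases "?x \<in> K1")
          case True
          then show ?thesis using K(3) by (auto simp: \<tau>_def v1)
        next
          case False
          then have "?x \<in> R" using no0 z xS by (auto simp: R_def)
          then have "\<bar>snd (F ?x)\<bar> > t" using \<open>?x \<notin> C0\<close> closure_subset[of R] by (auto simp: C0_def)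
          then have "snd (F ?x) > t" using F2[OF z] by linarith
          then show ?thesis using \<open>?x \<in> R\<close> t by (auto simp: \<tau>_def \<tau>c_def R_def)
        qed
        then show ?thesis by (intro capS istereo_in_Sph) (simp add: shz[OF z0])
      qed
      then show ?thesis by (simp add: h[OF z0] V'iff istereo_inverse[OF hnz[OF z0]])
    qed
    ultimately show ?thesis by blast
  next
    case False
    then have v0: "v0 = 1" and v1: "v1 = -1" using v01 by auto
    \<comment> \<open>With the ends exchanged, the boundary argument forces
      \<open>closure VN\<close> into \<open>K0\<close>. There the model has height t, above every
      height in \<open>closure VN\<close>, so it increases |z|; on the other side it decreases
      |z|.\<close>
    have in0: "closure VN \<subseteq> K0"
    proof (rule ccontr)
      assume "\<not> closure VN \<subseteq> K0"
      moreover have "closure VN \<inter> K0 \<noteq> {}" using poles K by blast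
      ultimately obtain y where "y \<in> closure VN" "y \<in> K0" "y \<in> closure (Sph - K0)"
        using connected_meets_boundary[OF conN(1) closure_N_S_subset(1) K(1)] by blast
      then show False using v(1)[of y] F1[of y] v0 t by simp
    qed
    have in1: "closure VS \<subseteq> K1"
    proof (rule ccontr)
      assume "\<not> closure VS \<subseteq> K1"
      moreover have "closure VS \<inter> K1 \<noteq> {}" using poles K by blast
      ultimately obtain y where "y \<in> closure VS" "y \<in> K1" "y \<in> closure (Sph - K1)"
        using connected_meets_boundary[OF conN(2) closure_N_S_subset(2) K(2)] by blast
      then show False using v(2)[of y] F2[of y] v1 t by simp
    qed
    have cmh: "cmod z * cmod (c j z) ^ q = exp (log_height (\<tau> (istereo z)))" if "z \<noteq> 0" for z
      using arg_cong[OF h[OF that, of j], of cmod] hn[OF that] by (simp add: norm_mult norm_power)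
    have "cmod (c j z) > 1" if zf: "z \<in> frontier V" for z
    proof (rule ccontr)
      note z = frV[OF zf]
      assume "\<not> cmod (c j z) > 1"
      then have "cmod (c j z) ^ q \<le> 1" by (intro power_le_one) auto
      then have "cmod z * cmod (c j z) ^ q \<le> cmod z * 1" by (intro mult_left_mono) auto
      moreover have "\<tau> (istereo z) = t" using in0 z by (auto simp: \<tau>_def v0)
      moreover have "log_height (snd (istereo z)) < log_height t"
        using lt[OF z(1)] log_height_less_iff[OF abs_snd_istereo[OF z(2)], of t] t by simp
      ultimately have "exp (log_height t) \<le> cmod z" "exp (log_height (snd (istereo z))) < exp (log_height t)"
        using cmh[OF z(2)] by auto
      then show False using cmod_eq_exp_log_height[OF z(2)] by linarith
    qed
    moreover have "cmod (c j z) < 1" if z0: "z \<noteq> 0" and zf: "inverse z \<in> frontier V'" for z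
    proof (rule ccontr)
      note z = frV'[OF z0 zf]
      assume "\<not> cmod (c j z) < 1"
      then have "1 \<le> cmod (c j z) ^ q" by (intro one_le_power) auto
      then have "cmod z * 1 \<le> cmod z * cmod (c j z) ^ q" by (intro mult_left_mono) auto
      moreover have "istereo z \<in> K1" using in1 z by blast
      then have "\<tau> (istereo z) = - t" using K(3) by (auto simp: \<tau>_def v1)
      moreover have "log_height (- t) < log_height (snd (istereo z))"
        using gt[OF z] log_height_less_iff[OF _ abs_snd_istereo[OF z0], of "- t"] t by simp
      ultimately have "cmod z \<le> exp (log_height (- t))" "exp (log_height (- t)) < exp (log_height (snd (istereo z)))"
        using cmh[OF z0] by auto
      then show False using cmod_eq_exp_log_height[OF z0] by linarith
    qed
    ultimately show ?thesis by blast
  qed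
  have "\<exists>z. z \<noteq> 0 \<and> istereo z \<in> R \<and> F (istereo z) = istereo z \<and> c j z = 1" for j
  proof -
    obtain z where z: "z \<noteq> 0" "z \<notin> V" "inverse z \<notin> V'" "c j z = 1"
      using planar_value_one[OF chV chV' VV' e q c\<gamma>[of j] _ bd[of j]] by (auto simp: c_def)
    let ?x = "istereo z"
    have xS: "?x \<in> Sph" by (rule istereo_in_Sph)
    have "?x \<notin> VN" "?x \<notin> VS" using z by (auto simp: V_def V'iff istereo_inverse)
    \<comment> \<open>Outside \<open>VN\<close> and \<open>VS\<close> heights lie strictly between
      -t and t. Where the model fixes a point, the image height was therefore not cut off, and the
      point is a true fixed point of F.\<close>
    then have sx: "\<bar>snd ?x\<bar> < t" using capN[OF xS] capS[OF xS] by linarith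
    have hz: "h z = z" using h[OF z(1), of j] z(4) by simp
    then have "exp (log_height (\<tau> ?x)) = exp (log_height (snd ?x))"
      using hn[OF z(1)] cmod_eq_exp_log_height[OF z(1)] by simp
    then have \<tau>x: "\<tau> ?x = snd ?x"
      using log_height_eq_iff[OF \<tau>1 abs_snd_istereo[OF z(1)]] by simp
    have "?x \<notin> K0" using \<tau>x sx t v01 by (auto simp: \<tau>_def)
    moreover have "?x \<notin> K1" using \<tau>x sx t v01 calculation by (auto simp: \<tau>_def)
    ultimately have xR: "?x \<in> R" and "\<tau>c ?x = snd ?x" using xS \<tau>x by (auto simp: R_def \<tau>_def)
    then have "\<bar>snd (F ?x)\<bar> \<le> t" using sx by (auto simp: \<tau>c_def max_def min_def split: if_splits)
    then have xC: "?x \<in> C0" using xR closure_subset[of R] by (auto simp: C0_def)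
    have "stereo (F ?x) = stereo ?x" using hC0[OF z(1) xC] hz by simp
    then have "F ?x = ?x"
      by (intro stereo_inj F(2) xS snd_istereo_less) (use C0(2)[OF xC] in auto)
    then show ?thesis using z xR by blast
  qed
  then obtain zz where zz: "\<And>j. zz j \<noteq> 0 \<and> istereo (zz j) \<in> R \<and> F (istereo (zz j)) = istereo (zz j) \<and> c j (zz j) = 1"
    by metis
  \<comment> \<open>At a common solution two of the roots would agree, although they differ by the
    factor of two distinct q-th roots of unity.\<close>
  have inj: "inj_on (\<lambda>j. istereo (zz j)) {..<q}"
  proof (rule inj_onI)
    fix j j' assume j: "j \<in> {..<q}" "j' \<in> {..<q}" "istereo (zz j) = istereo (zz j')"
    then have zeq: "zz j = zz j'" by (metis stereo_istereo)
    define w where "w = zz j powi e * exp (g (zz j) / of_nat q)"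
    have "w \<noteq> 0" using zz[of j] by (simp add: w_def)
    moreover have "w * exp (2 * of_real pi * \<i> * of_nat j / of_nat q) = 1"
      using zz[of j] by (simp add: c_def \<gamma>_def w_def exp_add mult.assoc)
    moreover have "w * exp (2 * of_real pi * \<i> * of_nat j' / of_nat q) = 1"
      using zz[of j'] unfolding zeq[symmetric] by (simp add: c_def \<gamma>_def w_def exp_add mult.assoc)
    ultimately have "exp (2 * of_real pi * \<i> * of_nat j / of_nat q) = exp (2 * of_real pi * \<i> * of_nat j' / of_nat q)"
      by (metis mult_left_cancel)
    then show "j = j'" using exp_root_of_unity_inj j by blast
  qed
  show ?thesis
  proof (rule that[of "(\<lambda>j. istereo (zz j)) ` {..<q}"])
    show "(\<lambda>j. istereo (zz j)) ` {..<q} \<subseteq> {x \<in> Sph - K0 - K1. F x = x}"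
      using zz by (auto simp: R_def)
    show "card ((\<lambda>j. istereo (zz j)) ` {..<q}) = nat \<bar>m - 1\<bar>"
      using card_image[OF inj] by (simp add: q_def)
  qed auto
qed

end

section \<open>Components of the preimage of the punctured sphere\<close>

lemma sgn_exp: "sgn (exp z) = exp (\<i> * of_real (Im z))" for z :: complex
  by (simp add: exp_eq_polar[of z] sgn_mult flip: cis_conv_exp) (simp add: sgn_eq cis_conv_exp)

lemma unicoherent_Sph: "unicoherent Sph"
  unfolding Sph_def by (intro Borsukian_imp_unicoherent Borsukian_sphere) simp

lemma connected_Sph: "connected Sph"
  unfolding Sph_def by (rule connected_sphere) simp

lemma compact_Sph: "compact Sph"
  unfolding Sph_def by (rule compact_sphere)

lemma openin_Sph_component:
  assumes "openin (top_of_set Sph) U" "W \<in> components U"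
  shows "openin (top_of_set Sph) W"
proof -
  have "locally connected Sph" unfolding Sph_def by (rule locally_connected_sphere)
  then show ?thesis using assms locally_connected_open_component by blast
qed

lemma connected_complement_of_component:
  assumes "connected W" "W \<subseteq> Sph" "K \<in> components (Sph - W)"
  shows "connected (Sph - K)"
  by (rule component_diff_connected[OF assms(1) connected_Sph assms(2,3)])

lemma closed_Sph_component:
  assumes "openin (top_of_set Sph) W" "K \<in> components (Sph - W)"
  shows "closed K"
proof -
  have "closed (Sph - W)"
  proof -
    obtain O' where "open O'" "W = Sph \<inter> O'" using assms(1) openin_open by blast
    moreover have "Sph - Sph \<inter> O' = Sph - O'" by blast
    ultimately show ?thesis using compact_imp_closed[OF compact_Sph] by auto
  qed
  then show ?thesis using closed_components assms(2) by blast
qed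

text \<open>The sphere is unicoherent, and it is the union of the closed connected sets
  \<open>K\<close> and \<open>closure (Sph - K)\<close>. The second one is connected because
  \<open>K\<close> is a component of the complement of a connected set.\<close>

lemma connected_component_boundary:
  assumes W: "openin (top_of_set Sph) W" "connected W" and K: "K \<in> components (Sph - W)"
  shows "connected (K \<inter> closure (Sph - K))"
proof (rule unicoherentD[OF unicoherent_Sph])
  have sub: "K \<subseteq> Sph" using in_components_subset[OF K] by blast
  have cs: "closure (Sph - K) \<subseteq> Sph" by (rule closure_subset_Sph) auto
  show "connected K" by (rule in_components_connected[OF K])
  show "connected (closure (Sph - K))"
    by (rule connected_imp_connected_closure[OF connected_complement_of_component[OF W(2) openin_imp_subset[OF W(1)] K]])
  show "Sph = K \<union> closure (Sph - K)" using sub cs closure_subset[of "Sph - K"] by blast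
  show "closedin (top_of_set Sph) K"
    using closed_Sph_component[OF W(1) K] sub by (simp add: closed_subset)
  show "closedin (top_of_set Sph) (closure (Sph - K))"
    using cs by (simp add: closed_subset)
qed

lemma continuous_on_if_clopen:
  assumes "openin (top_of_set T) A" "openin (top_of_set T) (T - A)"
    and "continuous_on A f" "continuous_on (T - A) g"
  shows "continuous_on T (\<lambda>x. if x \<in> A then f x else g x)"
proof -
  have "A \<subseteq> T" by (rule openin_imp_subset[OF assms(1)])
  then have T: "A \<union> (T - A) = T" by blast
  have "continuous_on (A \<union> (T - A)) (\<lambda>x. if x \<in> A then f x else g x)"
    by (rule continuous_on_cases_local_open) (use assms T in auto)
  then show ?thesis by (simp only: T)
qed

lemma openin_Diff_component:
  assumes U: "openin (top_of_set Sph) U" and W: "W \<in> components U"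
  shows "openin (top_of_set Sph) (U - W)"
proof -
  have "U - W = \<Union> (components U - {W})"
  proof (rule Set.set_eqI, rule iffI)
    fix x assume x: "x \<in> U - W"
    then obtain W' where "W' \<in> components U" "x \<in> W'" using Union_components[of U] by blast
    then show "x \<in> \<Union> (components U - {W})" using x by auto
  next
    fix x assume "x \<in> \<Union> (components U - {W})"
    then obtain W' where W': "W' \<in> components U" "W' \<noteq> W" "x \<in> W'" by blast
    then have "W' \<inter> W = {}" using components_nonoverlap[OF W'(1) W] by blast
    then show "x \<in> U - W" using W' in_components_subset[OF W'(1)] by blast
  qed
  then show ?thesis using openin_Sph_component[OF U] by auto
qed

context susp_coord
begin

text \<open>The filler 1 is compatible with products and powers, and for \<open>W\<close> open and
  closed in \<open>U\<close> it creates no discontinuity.\<close>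

definition restr :: "(complex \<times> real) set \<Rightarrow> (complex \<times> real \<Rightarrow> complex) \<Rightarrow> complex \<times> real \<Rightarrow> complex"
  where "restr W u x = (if x \<in> W then u x else 1)"

lemma component_props:
  assumes "W \<in> components U"
  shows "openin (top_of_set Sph) W" "openin (top_of_set U) W" "openin (top_of_set U) (U - W)"
    "W \<subseteq> U" "W \<subseteq> Sph" "connected W" "W \<noteq> {}"
proof -
  show 1: "openin (top_of_set Sph) W" by (rule openin_Sph_component[OF openin_U assms])
  show sub: "W \<subseteq> U" by (rule in_components_subset[OF assms])
  have US: "U \<subseteq> Sph" by (auto simp: U_def)
  show "W \<subseteq> Sph" using sub US by blast
  show "openin (top_of_set U) W" by (rule openin_subset_trans[OF 1 sub US])
  show "openin (top_of_set U) (U - W)"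
    by (rule openin_subset_trans[OF openin_Diff_component[OF openin_U assms] _ US]) auto
  show "connected W" by (rule in_components_connected[OF assms])
  show "W \<noteq> {}" by (rule in_components_nonempty[OF assms])
qed

lemma circle_map_restr:
  assumes "openin (top_of_set U) W" "openin (top_of_set U) (U - W)"
    and "continuous_on W u" "\<And>x. x \<in> W \<Longrightarrow> norm (u x) = 1"
  shows "circle_map (restr W u)"
proof -
  have "continuous_on U (restr W u)"
    unfolding restr_def[abs_def] by (intro continuous_on_if_clopen assms continuous_intros)
  then show ?thesis using assms(4) by (auto simp: circle_map_def restr_def)
qed

text \<open>\<open>U\<close> may have infinitely many components. Only these contribute to degrees,
  and they are finite in number, since disjoint open components cover the compact set of height
  0.\<close>

definition zero_components where "zero_components = {W \<in> components U. \<exists>x\<in>W. \<tau> x = 0}"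

lemma finite_zero_components: "finite zero_components"
proof -
  let ?T = "{x \<in> Sph. \<tau> x = 0}"
  have "closed ?T" by (intro continuous_closed_preimage_constant cont_\<tau> compact_imp_closed[OF compact_Sph])
  then have cT: "compact ?T"
    using compact_Int_closed[OF compact_Sph, of ?T] by (simp add: Int_absorb1 subset_iff)
  have "\<forall>W\<in>components U. \<exists>O'. open O' \<and> W = Sph \<inter> O'"
    using component_props(1) openin_open by blast
  then obtain O' where O': "\<And>W. W \<in> components U \<Longrightarrow> open (O' W) \<and> W = Sph \<inter> O' W" by metis
  have cov: "?T \<subseteq> (\<Union>W\<in>components U. O' W)"
  proof
    fix x assume "x \<in> ?T"
    then have "x \<in> U" by (auto simp: U_def)
    then obtain W where "W \<in> components U" "x \<in> W" using Union_components[of U] by blast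
    then show "x \<in> (\<Union>W\<in>components U. O' W)" using O' by blast
  qed
  have "\<exists>C \<subseteq> components U. finite C \<and> ?T \<subseteq> (\<Union>W\<in>C. O' W)"
  proof (rule compactE_image[OF cT _ cov])
    show "open (O' W)" if "W \<in> components U" for W using O' that by blast
    fix C assume "C \<subseteq> components U" "finite C" "?T \<subseteq> (\<Union>W\<in>C. O' W)"
    then show "\<exists>C \<subseteq> components U. finite C \<and> ?T \<subseteq> (\<Union>W\<in>C. O' W)" by blast
  qed
  then obtain C where C: "C \<subseteq> components U" "finite C" "?T \<subseteq> (\<Union>W\<in>C. O' W)"
    by blast
  have "zero_components \<subseteq> C"
  proof
    fix W assume "W \<in> zero_components"
    then obtain x where W: "W \<in> components U" "x \<in> W" "\<tau> x = 0" by (auto simp: zero_components_def)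
    then have "x \<in> ?T" using component_props(5) by blast
    then obtain W' where W': "W' \<in> C" "x \<in> O' W'" using C(3) by blast
    have "W' \<in> components U" using W' C by blast
    then have "x \<in> W'" using O' W' \<open>x \<in> ?T\<close> by blast
    then have "W = W'" using components_nonoverlap[OF W(1) \<open>W' \<in> components U\<close>] W(2) by blast
    then show "W \<in> C" using W' by simp
  qed
  then show ?thesis using C(2) finite_subset by blast
qed

text \<open>At height 0 the function \<open>u\<close> agrees with the product of its restrictions,
  so the quotient is 1 there and has degree 0 by \<open>deg_eq_0\<close>.\<close>

lemma deg_sum_components:
  assumes u: "circle_map u"
  shows "deg u = (\<Sum>W\<in>zero_components. deg (restr W u))"
proof -
  have r: "circle_map (restr W u)" if "W \<in> zero_components" for W
  proof -
    have W: "W \<in> components U" using that by (simp add: zero_components_def)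
    show ?thesis
      by (rule circle_map_restr) (use component_props[OF W] u in \<open>auto simp: circle_map_def intro: continuous_on_subset\<close>)
  qed
  let ?P = "\<lambda>x. \<Prod>W\<in>zero_components. restr W u x"
  have P: "circle_map ?P" by (intro circle_map_prod r finite_zero_components)
  have "deg (\<lambda>x. u x * inverse (?P x)) = 0"
  proof (rule deg_eq_0)
    show "circle_map (\<lambda>x. u x * inverse (?P x))" by (intro circle_map_mult u circle_map_inverse P)
    fix x assume x: "x \<in> Sph" "\<tau> x = 0"
    then have xU: "x \<in> U" by (simp add: U_def)
    then obtain W where W: "W \<in> components U" "x \<in> W" using Union_components[of U] by blast
    then have WZ: "W \<in> zero_components" using x by (auto simp: zero_components_def)
    have "?P x = restr W u x * (\<Prod>W'\<in>zero_components - {W}. restr W' u x)"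
      by (rule prod.remove[OF finite_zero_components WZ])
    also have "(\<Prod>W'\<in>zero_components - {W}. restr W' u x) = 1"
    proof (rule prod.neutral, rule ballI)
      fix W' assume W': "W' \<in> zero_components - {W}"
      then have "W' \<in> components U" by (simp add: zero_components_def)
      then have "x \<notin> W'" using components_nonoverlap[OF \<open>W' \<in> components U\<close> W(1)] W' W(2) by blast
      then show "restr W' u x = 1" by (simp add: restr_def)
    qed
    finally have "?P x = u x" using W(2) by (simp add: restr_def)
    moreover have "u x \<noteq> 0" using u xU by (auto simp: circle_map_def)
    ultimately show "u x * inverse (?P x) \<noteq> -1" by simp
  qed
  then have "deg u - deg ?P = 0"
    using deg_mult[OF u circle_map_inverse[OF P]] deg_inverse[OF P] by simp
  then show ?thesis using deg_prod[OF finite_zero_components r] by simp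
qed

end

section \<open>Complementary components and rings\<close>

lemma continuous_angle_of_loops:
  fixes q :: "complex \<times> real \<Rightarrow> complex"
  assumes "openin (top_of_set Sph) V" "continuous_on V q" "\<And>x. x \<in> V \<Longrightarrow> q x \<noteq> 0"
    and "\<And>r. \<lbrakk>path r; path_image r \<subseteq> V; pathfinish r = pathstart r\<rbrakk> \<Longrightarrow> log_var (q \<circ> r) = 0"
  obtains \<theta> where "continuous_on V \<theta>" "\<And>x. x \<in> V \<Longrightarrow> sgn (q x) = exp (\<i> * of_real (\<theta> x))"
proof -
  obtain g where g: "continuous_on V g" "\<And>x. x \<in> V \<Longrightarrow> q x = exp (g x)"
    using continuous_log_of_loops_Sph[OF assms] by blast
  have "continuous_on V (\<lambda>x. Im (g x))" by (intro continuous_intros g)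
  moreover have "sgn (q x) = exp (\<i> * of_real (Im (g x)))" if "x \<in> V" for x
    by (simp add: g(2)[OF that] sgn_exp)
  ultimately show thesis by (rule that)
qed

lemma continuous_on_if_boundary:
  fixes g :: "complex \<times> real \<Rightarrow> real"
  assumes "closed K" "K \<subseteq> Sph" "continuous_on K g" "\<And>x. x \<in> K \<Longrightarrow> x \<in> closure (Sph - K) \<Longrightarrow> g x = 0"
  shows "continuous_on Sph (\<lambda>x. if x \<in> K then g x else 0)"
proof -
  have "closure (Sph - K) \<subseteq> Sph" by (rule closure_subset_Sph) auto
  then have eq: "K \<union> closure (Sph - K) = Sph" using assms(2) closure_subset[of "Sph - K"] by blast
  have "continuous_on (K \<union> closure (Sph - K)) (\<lambda>x. if x \<in> K then g x else 0)"
    by (rule continuous_on_cases) (use assms in auto)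
  then show ?thesis by (simp only: eq)
qed

lemma abs_convex_le_1:
  fixes a g s :: real
  assumes "\<bar>a\<bar> \<le> 1" "\<bar>a + g\<bar> \<le> 1" "0 \<le> s" "s \<le> 1"
  shows "\<bar>a + s * g\<bar> \<le> 1"
proof -
  have "a + s * g = (1 - s) * a + s * (a + g)" by (simp add: algebra_simps)
  also have "\<bar>\<dots>\<bar> \<le> \<bar>(1 - s) * a\<bar> + \<bar>s * (a + g)\<bar>" by (rule abs_triangle_ineq)
  also have "\<dots> = (1 - s) * \<bar>a\<bar> + s * \<bar>a + g\<bar>" using assms by (simp add: abs_mult)
  also have "\<dots> \<le> (1 - s) * 1 + s * 1"
    by (intro add_mono mult_left_mono) (use assms in auto)
  finally show ?thesis by simp
qed

text \<open>The hypothesis on loops is expressed by winding numbers: a loop in the sphere without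
  its poles is contractible there exactly when \<open>fst\<close> does not wind along it.\<close>

locale loop_attracting = attracting_poles +
  assumes fixed: "F (0, -1) = (0, -1)" "F (0, 1) = (0, 1)"
    and loops: "\<lbrakk>path \<gamma>; path_image \<gamma> \<subseteq> {x \<in> Sph. \<bar>snd (F x)\<bar> < 1}; pathfinish \<gamma> = pathstart \<gamma>; log_var (fst \<circ> \<gamma>) = 0\<rbrakk>
      \<Longrightarrow> log_var ((\<lambda>x. fst (F x)) \<circ> \<gamma>) = 0"
begin

sublocale susp_coord "\<lambda>x. snd (F x)"
proof
  show "continuous_on Sph (\<lambda>x. snd (F x))" by (intro continuous_intros F)
  show "\<bar>snd (F x)\<bar> \<le> 1" if "x \<in> Sph" for x by (rule Sph_snd_le[OF F(2)[OF that]])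
qed

abbreviation "\<zeta> \<equiv> \<lambda>x::complex \<times> real. sgn (fst x)"
abbreviation "\<eta> \<equiv> \<lambda>x. sgn (fst (F x))"

lemma poles_notin_U: "(0, -1) \<notin> U" "(0, 1) \<notin> U"
  using fixed by (auto simp: U_def)

lemma fst_nonzero:
  assumes "x \<in> U"
  shows "fst x \<noteq> 0" "fst (F x) \<noteq> 0"
proof -
  have x: "x \<in> Sph" "\<bar>snd (F x)\<bar> < 1" using assms by (auto simp: U_def)
  show "fst x \<noteq> 0" using Sph_fst_eq_0[OF x(1)] poles_notin_U assms by blast
  have Fx: "F x \<in> Sph" using F(2) x by blast
  show "fst (F x) \<noteq> 0" using Sph_fst_eq_0[OF Fx] Sph_snd_less[OF Fx] x by blast
qed

lemma continuous_on_fst_U: "continuous_on U fst" "continuous_on U (\<lambda>x. fst (F x))"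
proof -
  have "U \<subseteq> Sph" by (auto simp: U_def)
  then show "continuous_on U (\<lambda>x. fst (F x))" by (intro continuous_intros continuous_on_subset[OF F(1)])
  show "continuous_on U fst" by (intro continuous_intros)
qed

lemma circle_map_\<zeta>_\<eta>: "circle_map \<zeta>" "circle_map \<eta>"
  using fst_nonzero continuous_on_fst_U unfolding circle_map_def
  by (auto intro!: continuous_on_sgn simp: norm_sgn)

lemma deg_\<zeta>: "deg \<zeta> = 1"
  unfolding deg_def by (rule sph_degree_susp_sgn_pos) (use cont_\<tau> \<tau>_le fixed in auto)

lemma deg_\<eta>: "deg \<eta> = sph_degree F"
  unfolding deg_def
proof (rule sph_degree_cong)
  fix x assume "x \<in> Sph"
  then have "susp snd (\<lambda>x. sgn (fst x)) (F x) = F x" by (intro susp_snd_sgn F)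
  then show "susp (\<lambda>x. snd (F x)) \<eta> x = F x" by (simp add: susp_def)
qed

abbreviation south :: "(complex \<times> real) set \<Rightarrow> (complex \<times> real) set"
  where "south W \<equiv> connected_component_set (Sph - W) (0, -1)"
abbreviation north :: "(complex \<times> real) set \<Rightarrow> (complex \<times> real) set"
  where "north W \<equiv> connected_component_set (Sph - W) (0, 1)"

lemma south_north:
  assumes "W \<in> components U"
  shows "south W \<in> components (Sph - W)" "north W \<in> components (Sph - W)"
    "(0, -1) \<in> south W" "(0, 1) \<in> north W"
proof -
  have "(0, -1) \<notin> W" "(0, 1) \<notin> W" using poles_notin_U component_props(4)[OF assms] by auto
  then have "(0, -1) \<in> Sph - W" "(0, 1) \<in> Sph - W" by auto
  then show "south W \<in> components (Sph - W)" "north W \<in> components (Sph - W)"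
    "(0, -1) \<in> south W" "(0, 1) \<in> north W" by (auto intro: componentsI)
qed

text \<open>A point of \<open>U\<close> in \<open>K\<close> lies in a component of \<open>U\<close>
  other than \<open>W\<close>; being connected and disjoint from \<open>W\<close>, that component is
  contained in \<open>K\<close>, and it is a neighbourhood of the point in the sphere.\<close>

lemma component_boundary_notin_U:
  assumes W: "W \<in> components U" and K: "K \<in> components (Sph - W)" and x: "x \<in> K" "x \<in> closure (Sph - K)"
  shows "x \<notin> U"
proof
  assume "x \<in> U"
  then obtain W' where W': "W' \<in> components U" "x \<in> W'" using Union_components[of U] by blast
  have "x \<notin> W" using in_components_subset[OF K] x by blast
  then have "W' \<inter> W = {}" using components_nonoverlap[OF W'(1) W] W' by blast
  then have "W' \<subseteq> Sph - W" using component_props(5)[OF W'(1)] by blast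
  then have sub: "W' \<subseteq> K"
    by (rule components_maximal[OF K component_props(6)[OF W'(1)]]) (use x W' in blast)
  obtain O' where O': "open O'" "W' = Sph \<inter> O'" using component_props(1)[OF W'(1)] openin_open by blast
  have "x \<in> O'" using O' W' by blast
  then have "O' \<inter> (Sph - K) \<noteq> {}" using x(2) O'(1) closure_iff_nhds_not_empty[of x "Sph - K"] by blast
  then show False using O' sub by blast
qed

text \<open>On the boundary of \<open>K\<close> the height is 1 or -1, and this boundary is
  connected, so the sign cannot change.\<close>

lemma component_boundary_value:
  assumes W: "W \<in> components U" and K: "K \<in> components (Sph - W)"
  obtains v where "\<bar>v\<bar> = 1" "\<And>x. x \<in> K \<Longrightarrow> x \<in> closure (Sph - K) \<Longrightarrow> snd (F x) = v"
proof -
  let ?B = "K \<inter> closure (Sph - K)"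
  have BS: "?B \<subseteq> Sph" using in_components_subset[OF K] by blast
  have pm: "\<bar>snd (F x)\<bar> = 1" if "x \<in> ?B" for x
    using component_boundary_notin_U[OF W K, of x] that \<tau>_le[of x] BS unfolding U_def by fastforce
  have "connected ((\<lambda>x. snd (F x)) ` ?B)"
    by (rule connected_continuous_image[OF continuous_on_subset[OF cont_\<tau> BS]
        connected_component_boundary[OF component_props(1,6)[OF W] K]])
  then have no: "\<not> (-1 \<in> (\<lambda>x. snd (F x)) ` ?B \<and> 1 \<in> (\<lambda>x. snd (F x)) ` ?B)"
  proof (intro notI)
    assume c: "connected ((\<lambda>x. snd (F x)) ` ?B)" and a: "-1 \<in> (\<lambda>x. snd (F x)) ` ?B \<and> 1 \<in> (\<lambda>x. snd (F x)) ` ?B"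
    have "{-1..1} \<subseteq> (\<lambda>x. snd (F x)) ` ?B" by (rule connected_contains_Icc[OF c]) (use a in auto)
    then have "0 \<in> (\<lambda>x. snd (F x)) ` ?B" by (rule subsetD) simp
    then obtain x where "x \<in> ?B" "snd (F x) = 0" by auto
    then show False using pm[of x] by simp
  qed
  show thesis
  proof (cases "1 \<in> (\<lambda>x. snd (F x)) ` ?B")
    case True
    then have "snd (F x) = 1" if "x \<in> K" "x \<in> closure (Sph - K)" for x
      using no pm[of x] that by (force simp: abs_if split: if_splits)
    then show thesis using that[of 1] by simp
  next
    case False
    then have "snd (F x) = -1" if "x \<in> K" "x \<in> closure (Sph - K)" for x
      using pm[of x] that by (force simp: abs_if split: if_splits)
    then show thesis using that[of "-1"] by simp
  qed
qed

text \<open>The complement of \<open>H\<close> is connected, contains both poles and avoids the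
  loop.\<close>

lemma winding_0_off_poles:
  assumes W: "W \<in> components U" and H: "H \<in> components (Sph - W)" "H \<noteq> south W" "H \<noteq> north W"
    and \<gamma>: "path \<gamma>" "path_image \<gamma> \<subseteq> H" "pathfinish \<gamma> = pathstart \<gamma>"
  shows "log_var (fst \<circ> \<gamma>) = 0"
proof (rule loop_winding_0_if_avoids_connected[OF \<gamma>(1,3)])
  note p = south_north[OF W]
  show "path_image \<gamma> \<subseteq> Sph" using \<gamma>(2) in_components_subset[OF H(1)] by blast
  show "connected (Sph - H)"
    by (rule connected_complement_of_component[OF component_props(6)[OF W] component_props(5)[OF W] H(1)])
  have "H \<inter> south W = {}" "H \<inter> north W = {}"
    using components_nonoverlap[OF H(1) p(1)] components_nonoverlap[OF H(1) p(2)] H by auto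
  then show "(0, -1) \<in> Sph - H" "(0, 1) \<in> Sph - H" using p by auto
  show "(Sph - H) \<inter> path_image \<gamma> = {}" using \<gamma> by blast
qed auto

text \<open>For a component \<open>W\<close> of \<open>U\<close> this is \<open>W\<close> together
  with those holes, that is, components of its complement, that contain no pole.\<close>

definition ring where "ring W = Sph - south W - north W"

lemma winding_0_in_ring:
  assumes W: "W \<in> components U" and \<gamma>: "path \<gamma>" "path_image \<gamma> \<subseteq> ring W - W" "pathfinish \<gamma> = pathstart \<gamma>"
  shows "log_var (fst \<circ> \<gamma>) = 0"
proof -
  let ?H = "connected_component_set (Sph - W) (pathstart \<gamma>)"
  have sub: "path_image \<gamma> \<subseteq> Sph - W" using \<gamma>(2) by (auto simp: ring_def)
  have st: "pathstart \<gamma> \<in> path_image \<gamma>" by (rule pathstart_in_path_image)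
  have H: "?H \<in> components (Sph - W)" by (rule componentsI) (use st sub in blast)
  have sH: "pathstart \<gamma> \<in> ?H" using st sub by auto
  have st': "pathstart \<gamma> \<notin> south W" "pathstart \<gamma> \<notin> north W"
    using subsetD[OF \<gamma>(2) st] by (simp_all add: ring_def)
  have "path_image \<gamma> \<subseteq> ?H"
    by (rule connected_component_maximal[OF st connected_path_image[OF \<gamma>(1)] sub])
  moreover have "?H \<noteq> south W" "?H \<noteq> north W" using sH st' by blast+
  ultimately show ?thesis using winding_0_off_poles[OF W H _ _ \<gamma>(1) _ \<gamma>(3)] by blast
qed

lemma openin_ring: "W \<in> components U \<Longrightarrow> openin (top_of_set Sph) (ring W)"
proof -
  assume W: "W \<in> components U"
  have "closed (south W \<union> north W)"
    by (intro closed_Un closed_Sph_component[OF component_props(1)[OF W]] south_north[OF W])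
  moreover have "ring W = Sph \<inter> - (south W \<union> north W)" by (auto simp: ring_def)
  ultimately show ?thesis by (metis open_Compl openin_open)
qed

lemma component_subset_ring: "W \<in> components U \<Longrightarrow> W \<subseteq> ring W"
  using in_components_subset[OF south_north(1), of W] in_components_subset[OF south_north(2), of W]
    component_props(5)[of W] unfolding ring_def by blast

text \<open>A loop in this set stays in one hole of \<open>W\<close> without poles and hence does
  not wind; by the hypothesis on loops its image does not wind either, so both functions have
  continuous angles.\<close>

lemma angle_off_component:
  assumes W: "W \<in> components U"
  obtains \<theta> \<phi> where "continuous_on (U \<inter> ring W - W) \<theta>" "\<And>x. x \<in> U \<inter> ring W - W \<Longrightarrow> \<zeta> x = exp (\<i> * of_real (\<theta> x))"
    "continuous_on (U \<inter> ring W - W) \<phi>" "\<And>x. x \<in> U \<inter> ring W - W \<Longrightarrow> \<eta> x = exp (\<i> * of_real (\<phi> x))"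
proof -
  let ?V = "U \<inter> ring W - W"
  have "openin (top_of_set Sph) (ring W \<inter> (U - W))"
    by (intro openin_Int openin_ring openin_Diff_component openin_U W)
  moreover have "ring W \<inter> (U - W) = ?V" by blast
  ultimately have V: "openin (top_of_set Sph) ?V" by simp
  have VU: "?V \<subseteq> U" by blast
  have 0: "log_var (fst \<circ> \<gamma>) = 0" if "path \<gamma>" "path_image \<gamma> \<subseteq> ?V" "pathfinish \<gamma> = pathstart \<gamma>" for \<gamma>
    by (rule winding_0_in_ring[OF W that(1) _ that(3)]) (use that(2) in blast)
  have 1: "log_var ((\<lambda>x. fst (F x)) \<circ> \<gamma>) = 0" if "path \<gamma>" "path_image \<gamma> \<subseteq> ?V" "pathfinish \<gamma> = pathstart \<gamma>" for \<gamma>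
    by (rule loops[OF that(1) _ that(3) 0[OF that]]) (use that(2) VU in \<open>auto simp: U_def\<close>)
  obtain \<theta> where \<theta>: "continuous_on ?V \<theta>" "\<And>x. x \<in> ?V \<Longrightarrow> \<zeta> x = exp (\<i> * of_real (\<theta> x))"
    by (rule continuous_angle_of_loops[OF V continuous_on_subset[OF continuous_on_fst_U(1) VU] fst_nonzero(1)[OF subsetD[OF VU]] 0]) blast+
  obtain \<phi> where \<phi>: "continuous_on ?V \<phi>" "\<And>x. x \<in> ?V \<Longrightarrow> \<eta> x = exp (\<i> * of_real (\<phi> x))"
    by (rule continuous_angle_of_loops[OF V continuous_on_subset[OF continuous_on_fst_U(2) VU] fst_nonzero(2)[OF subsetD[OF VU]] 1]) blast+
  show thesis by (rule that[OF \<theta> \<phi>])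
qed

lemma deg_restr_mult_exp:
  assumes W: "openin (top_of_set U) W" "openin (top_of_set U) (U - W)"
    and u: "circle_map (restr W u)" and \<theta>: "continuous_on W \<theta>"
    and v: "\<And>x. x \<in> W \<Longrightarrow> v x = u x * exp (\<i> * of_real (\<theta> x))"
  shows "deg (restr W v) = deg (restr W u)"
proof (rule deg_mult_exp[OF u])
  show "continuous_on U (\<lambda>x. if x \<in> W then \<theta> x else 0)"
    by (intro continuous_on_if_clopen W \<theta> continuous_intros)
  show "restr W v x = restr W u x * exp (\<i> * complex_of_real (if x \<in> W then \<theta> x else 0))" if "x \<in> U" for x
    by (simp add: restr_def v)
qed

text \<open>The boundaries of the complementary components of \<open>W\<close> miss
  \<open>U\<close>, so the two that contain the poles meet \<open>U\<close> in relatively open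
  sets.\<close>

lemma openin_ring_parts:
  assumes W: "W \<in> components U"
  shows "openin (top_of_set U) (U \<inter> ring W - W)" "openin (top_of_set U) (U - (U \<inter> ring W - W))"
proof -
  have US: "U \<subseteq> Sph" by (auto simp: U_def)
  have "openin (top_of_set Sph) (ring W \<inter> (U - W))"
    by (intro openin_Int openin_ring openin_Diff_component openin_U W)
  moreover have "ring W \<inter> (U - W) = U \<inter> ring W - W" by blast
  ultimately have "openin (top_of_set Sph) (U \<inter> ring W - W)" by simp
  then show "openin (top_of_set U) (U \<inter> ring W - W)" by (rule openin_subset_trans) (use US in auto)
  have op: "openin (top_of_set U) (U \<inter> K)" if K: "K \<in> components (Sph - W)" for K
  proof -
    have "U \<inter> K = U \<inter> - closure (Sph - K)"
      using component_boundary_notin_U[OF W K] closure_subset[of "Sph - K"] US by blast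
    moreover have "openin (top_of_set U) (U \<inter> - closure (Sph - K))" by (intro openin_open_Int open_Compl closed_closure)
    ultimately show ?thesis by argo
  qed
  have "U - (U \<inter> ring W - W) = W \<union> (U \<inter> south W \<union> U \<inter> north W)"
    using US component_props(4)[OF W] unfolding ring_def by blast
  then show "openin (top_of_set U) (U - (U \<inter> ring W - W))"
    using component_props(2)[OF W] op south_north(1,2)[OF W] by auto
qed

end

context loop_attracting
begin

text \<open>Deforming the height to the constants \<open>v0\<close>, \<open>v1\<close> on the two complementary components that contain the
  poles makes the angular part irrelevant there, so that it may be replaced by \<open>\<zeta>\<close> everywhere.\<close>

lemma restr_\<zeta>_deg_bound:
  assumes W: "W \<in> components U" and ne: "south W \<noteq> north W"
    and v0: "\<bar>v0\<bar> = 1" "\<And>x. x \<in> south W \<Longrightarrow> x \<in> closure (Sph - south W) \<Longrightarrow> snd (F x) = v0"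
    and v1: "\<bar>v1\<bar> = 1" "\<And>x. x \<in> north W \<Longrightarrow> x \<in> closure (Sph - north W) \<Longrightarrow> snd (F x) = v1"
  shows "\<bar>deg (restr W \<zeta>)\<bar> \<le> 1" "v0 = v1 \<Longrightarrow> deg (restr W \<zeta>) = 0"
proof -
  define K0 where "K0 = south W"
  define K1 where "K1 = north W"
  note cp = component_props[OF W] and sn = south_north[OF W, folded K0_def K1_def]
  have K: "closed K0" "closed K1" by (rule closed_Sph_component[OF cp(1)], rule sn)+
  have KS: "K0 \<subseteq> Sph" "K1 \<subseteq> Sph" using in_components_subset[OF sn(1)] in_components_subset[OF sn(2)] by auto
  have dK: "K0 \<inter> K1 = {}"
    using components_nonoverlap[OF sn(1,2)] ne unfolding K0_def K1_def by blast
  have US: "U \<subseteq> Sph" by (auto simp: U_def)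
  obtain \<theta> \<phi> where \<theta>: "continuous_on (U \<inter> ring W - W) \<theta>" "\<And>x. x \<in> U \<inter> ring W - W \<Longrightarrow> \<zeta> x = exp (\<i> * of_real (\<theta> x))"
    using angle_off_component[OF W] by metis
  define u where "u = restr (U \<inter> ring W) \<zeta>"
  have cW: "circle_map (restr W \<zeta>)"
    by (rule circle_map_restr[OF cp(2,3)])
      (use circle_map_\<zeta>_\<eta>(1) cp(4) in \<open>auto simp: circle_map_def intro: continuous_on_subset\<close>)
  \<comment> \<open>On the other components of \<open>U\<close> inside the ring
    \<open>\<zeta>\<close> has a continuous angle, so putting \<open>\<zeta>\<close> there in place
    of 1 leaves the degree unchanged.\<close>
  have du: "deg u = deg (restr W \<zeta>)"
  proof (rule deg_mult_exp[OF cW])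
    show "continuous_on U (\<lambda>x. if x \<in> U \<inter> ring W - W then \<theta> x else 0)"
      by (intro continuous_on_if_clopen openin_ring_parts[OF W] \<theta> continuous_intros)
    show "u x = restr W \<zeta> x * exp (\<i> * complex_of_real (if x \<in> U \<inter> ring W - W then \<theta> x else 0))" if "x \<in> U" for x
      using \<theta>(2)[of x] that component_subset_ring[OF W] by (auto simp: u_def restr_def)
  qed
  \<comment> \<open>The change of height that makes it constant on \<open>K0\<close> and on
    \<open>K1\<close>; it vanishes on their boundaries, hence it is continuous.\<close>
  define g where "g = (\<lambda>x. (if x \<in> K0 then v0 - snd (F x) else 0) + (if x \<in> K1 then v1 - snd (F x) else 0))"
  have cg: "continuous_on Sph g"
    unfolding g_def
    by (intro continuous_on_add continuous_on_if_boundary K KS continuous_on_diff continuous_on_const continuous_on_subset[OF cont_\<tau>])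
      (use v0 v1 in \<open>auto simp: K0_def K1_def\<close>)
  have v01: "v0 = 1 \<or> v0 = -1" "v1 = 1 \<or> v1 = -1" using v0(1) v1(1) by linarith+
  have g1: "\<bar>snd (F x) + g x\<bar> \<le> 1" if "x \<in> Sph" for x
    using \<tau>_le[OF that] v0(1) v1(1) dK by (auto simp: g_def)
  define T where "T = (\<lambda>p. snd (F (snd p)) + fst p * g (snd p))"
  \<comment> \<open>Every point whose height has modulus below 1 at some time of the deformation
    lies in \<open>Q\<close>. The part inside the ring and the interiors of \<open>K0\<close> and
    \<open>K1\<close> are disjoint and open, and \<open>u\<close> is \<open>\<zeta>\<close> on the
    first and 1 on the others, hence continuous on \<open>Q\<close>.\<close>
  define Q where "Q = (U \<inter> ring W) \<union> ((Sph \<inter> - closure (Sph - K0)) \<union> (Sph \<inter> - closure (Sph - K1)))"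
  have Q12: "Q - (U \<inter> ring W) = (Sph \<inter> - closure (Sph - K0)) \<union> (Sph \<inter> - closure (Sph - K1))"
    using closure_subset[of "Sph - K0"] closure_subset[of "Sph - K1"]
    unfolding Q_def ring_def K0_def K1_def by blast
  have QS: "Q \<subseteq> Sph" using US unfolding Q_def by blast
  have "continuous_on Q u"
    unfolding u_def restr_def[abs_def]
  proof (rule continuous_on_if_clopen)
    have "openin (top_of_set Sph) (U \<inter> ring W)" by (intro openin_Int openin_U openin_ring W)
    then show "openin (top_of_set Q) (U \<inter> ring W)"
      by (rule openin_subset_trans) (use QS in \<open>auto simp: Q_def\<close>)
    have "openin (top_of_set Sph) (Sph \<inter> - closure (Sph - K0))" "openin (top_of_set Sph) (Sph \<inter> - closure (Sph - K1))"
      by (intro openin_open_Int open_Compl closed_closure)+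
    then have "openin (top_of_set Sph) (Q - (U \<inter> ring W))" unfolding Q12 by (rule openin_Un)
    then show "openin (top_of_set Q) (Q - (U \<inter> ring W))" by (rule openin_subset_trans) (use QS in auto)
    show "continuous_on (U \<inter> ring W) \<zeta>"
      using circle_map_\<zeta>_\<eta>(1) by (auto simp: circle_map_def intro: continuous_on_subset)
  qed (intro continuous_intros)
  have "sph_degree (susp (\<lambda>x. T (0, x)) u) = sph_degree (susp (\<lambda>x. T (1, x)) u)"
  proof (rule deg_homotopic[where u = "\<lambda>p. u (snd p)", simplified])
    show "continuous_on ({0..1} \<times> Sph) T"
      unfolding T_def by (intro continuous_intros continuous_on_compose2[OF cont_\<tau>] continuous_on_compose2[OF cg]) auto
    show "\<bar>T p\<bar> \<le> 1" if "p \<in> {0..1} \<times> Sph" for p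
      unfolding T_def by (rule abs_convex_le_1) (use that \<tau>_le g1 in auto)
    have inQ: "snd p \<in> Q" if "p \<in> {0..1} \<times> Sph" "\<bar>T p\<bar> < 1" for p
    proof -
      have xS: "snd p \<in> Sph" using that by auto
      consider "snd p \<in> K0" | "snd p \<in> K1" | "snd p \<in> ring W"
        using xS unfolding ring_def K0_def K1_def by blast
      then show ?thesis
      proof cases
        case 1
        then have "snd p \<notin> K1" using dK by blast
        have "snd p \<notin> closure (Sph - K0)"
        proof
          assume "snd p \<in> closure (Sph - K0)"
          then have "snd (F (snd p)) = v0" using v0(2) 1 unfolding K0_def by blast
          then have "T p = v0" using \<open>snd p \<notin> K1\<close> 1 by (simp add: T_def g_def)
          then show False using that(2) v0(1) by simp
        qed
        then show ?thesis using xS by (simp add: Q_def)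
      next
        case 2
        then have "snd p \<notin> K0" using dK by blast
        have "snd p \<notin> closure (Sph - K1)"
        proof
          assume "snd p \<in> closure (Sph - K1)"
          then have "snd (F (snd p)) = v1" using v1(2) 2 unfolding K1_def by blast
          then have "T p = v1" using \<open>snd p \<notin> K0\<close> 2 by (simp add: T_def g_def)
          then show False using that(2) v1(1) by simp
        qed
        then show ?thesis using xS by (simp add: Q_def)
      next
        case 3
        then have "g (snd p) = 0" by (simp add: g_def ring_def K0_def K1_def)
        then have "\<bar>snd (F (snd p))\<bar> < 1" using that(2) by (simp add: T_def)
        then show ?thesis using xS 3 by (simp add: Q_def U_def)
      qed
    qed
    show "continuous_on {p \<in> {0..1} \<times> Sph. \<bar>T p\<bar> < 1} (\<lambda>p. u (snd p))"
      by (rule continuous_on_compose2[OF \<open>continuous_on Q u\<close> continuous_on_snd[OF continuous_on_id]]) (use inQ in blast)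
    show "cmod (u (snd p)) = 1" if "p \<in> {0..1} \<times> Sph" "\<bar>T p\<bar> < 1" for p
      using fst_nonzero(1)[of "snd p"] by (auto simp: u_def restr_def norm_sgn)
  qed
  then have "deg u = sph_degree (susp (\<lambda>x. T (1, x)) u)" by (simp add: deg_def T_def)
  \<comment> \<open>At the end all points outside \<open>U \<inter> ring W\<close> have height 1 or
    -1, so the direction may be changed there at will.\<close>
  also have "\<dots> = sph_degree (susp (\<lambda>x. T (1, x)) \<zeta>)"
  proof (rule sph_degree_cong)
    fix x assume x: "x \<in> Sph"
    show "susp (\<lambda>x. T (1, x)) u x = susp (\<lambda>x. T (1, x)) \<zeta> x"
    proof (cases "x \<in> U \<inter> ring W")
      case True
      then show ?thesis by (simp add: susp_def u_def restr_def)
    next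
      case False
      have "\<bar>T (1, x)\<bar> = 1"
      proof (cases "x \<in> ring W")
        case True
        then have "x \<notin> U" "g x = 0" using False by (auto simp: g_def ring_def K0_def K1_def)
        then show ?thesis using x \<tau>_le[OF x] by (simp add: T_def U_def)
      next
        case False
        then have "x \<in> K0 \<and> x \<notin> K1 \<or> x \<in> K1 \<and> x \<notin> K0" using x dK unfolding ring_def K0_def K1_def by blast
        then show ?thesis using v0(1) v1(1) by (auto simp: T_def g_def)
      qed
      then have "(T (1, x))\<^sup>2 = 1" using v01 by (simp add: abs_square_eq_1)
      then show ?thesis by (simp add: susp_def)
    qed
  qed
  finally have d: "deg u = sph_degree (susp (\<lambda>x. T (1, x)) \<zeta>)" .
  have cT: "continuous_on Sph (\<lambda>x. T (1, x))"
    unfolding T_def by (simp, intro continuous_on_add cg cont_\<tau>)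
  have T1: "\<bar>T (1, x)\<bar> \<le> 1" if "x \<in> Sph" for x using g1[OF that] by (simp add: T_def)
  have "(0, -1) \<notin> K1" "(0, 1) \<notin> K0" using sn dK by auto
  then have Tp: "T (1, (0, -1)) = v0" "T (1, (0, 1)) = v1" using sn by (simp_all add: T_def g_def)
  show "v0 = v1 \<Longrightarrow> deg (restr W \<zeta>) = 0"
    using sph_degree_susp_sgn_0[OF cT T1, of v0] Tp v0 d du by simp
  have "\<bar>sph_degree (susp (\<lambda>x. T (1, x)) \<zeta>)\<bar> \<le> 1"
    using sph_degree_susp_sgn_0[OF cT T1, of v0] sph_degree_susp_sgn_pos[OF cT T1] sph_degree_susp_sgn_neg[OF cT T1] Tp v01
    by (auto simp del: split_paired_All)
  then show "\<bar>deg (restr W \<zeta>)\<bar> \<le> 1" using d du by simp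
qed

lemma deg_restr_\<zeta>_eq_0:
  assumes W: "W \<in> components U"
    and 0: "\<And>\<gamma>. \<lbrakk>path \<gamma>; path_image \<gamma> \<subseteq> W; pathfinish \<gamma> = pathstart \<gamma>\<rbrakk> \<Longrightarrow> log_var (fst \<circ> \<gamma>) = 0"
  shows "deg (restr W \<zeta>) = 0"
proof -
  note cp = component_props[OF W]
  obtain \<theta> where \<theta>: "continuous_on W \<theta>" "\<And>x. x \<in> W \<Longrightarrow> \<zeta> x = exp (\<i> * of_real (\<theta> x))"
    by (rule continuous_angle_of_loops[OF cp(1) continuous_on_subset[OF continuous_on_fst_U(1) cp(4)] fst_nonzero(1)[OF subsetD[OF cp(4)]] 0]) blast+
  have r1: "restr W (\<lambda>_. 1) = (\<lambda>_. 1)" by (auto simp: restr_def)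
  have "deg (restr W \<zeta>) = deg (restr W (\<lambda>_. 1))"
    by (rule deg_restr_mult_exp[OF cp(2,3) _ \<theta>(1)]) (use \<theta>(2) in \<open>auto simp: r1\<close>)
  then show ?thesis by (simp add: r1)
qed

text \<open>A component of the complement of \<open>W\<close> containing both poles would be a
  connected set that joins them off \<open>W\<close>, and then no loop in \<open>W\<close> could
  wind.\<close>

lemma essential_imp_separates:
  assumes W: "W \<in> components U" and "deg (restr W \<zeta>) \<noteq> 0"
  shows "south W \<noteq> north W"
proof
  assume eq: "south W = north W"
  note sn = south_north[OF W]
  have sub: "south W \<subseteq> Sph - W" by (rule in_components_subset[OF sn(1)])
  have "deg (restr W \<zeta>) = 0"
  proof (rule deg_restr_\<zeta>_eq_0[OF W])
    fix \<gamma> assume \<gamma>: "path \<gamma>" "path_image \<gamma> \<subseteq> W" "pathfinish \<gamma> = pathstart \<gamma>"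
    show "log_var (fst \<circ> \<gamma>) = 0"
      by (rule loop_winding_0_if_avoids_connected[OF \<gamma>(1,3) _ in_components_connected[OF sn(1)]])
        (use \<gamma>(2) sub sn(3,4) eq component_props(5)[OF W] in \<open>blast+\<close>)
  qed
  then show False using assms(2) by simp
qed

text \<open>In any other complementary component of \<open>W\<close> no loop winds, which would make
  the degree of \<open>\<zeta>\<close> on \<open>W'\<close> zero.\<close>

lemma essential_in_south_or_north:
  assumes W: "W \<in> components U" and W': "W' \<in> components U" "W' \<noteq> W" and "deg (restr W' \<zeta>) \<noteq> 0"
  shows "W' \<subseteq> south W \<or> W' \<subseteq> north W"
proof (rule ccontr)
  assume no: "\<not> ?thesis"
  obtain z where z: "z \<in> W'" using component_props(7)[OF W'(1)] by blast
  have sub: "W' \<subseteq> Sph - W" using components_nonoverlap[OF W'(1) W] W'(2) component_props(5)[OF W'(1)] by blast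
  let ?H = "connected_component_set (Sph - W) z"
  have H: "?H \<in> components (Sph - W)" by (rule componentsI) (use z sub in blast)
  have W'H: "W' \<subseteq> ?H" by (rule connected_component_maximal[OF z component_props(6)[OF W'(1)] sub])
  have "deg (restr W' \<zeta>) = 0"
  proof (rule deg_restr_\<zeta>_eq_0[OF W'(1)])
    fix \<gamma> assume \<gamma>: "path \<gamma>" "path_image \<gamma> \<subseteq> W'" "pathfinish \<gamma> = pathstart \<gamma>"
    show "log_var (fst \<circ> \<gamma>) = 0"
      by (rule winding_0_off_poles[OF W H _ _ \<gamma>(1) _ \<gamma>(3)]) (use W'H no \<gamma>(2) in blast)+
  qed
  then show False using assms(4) by simp
qed

text \<open>If \<open>W'\<close> lies in \<open>south W\<close>, then \<open>Sph - south W\<close>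
  is connected, avoids \<open>W'\<close> and contains \<open>(0, 1)\<close>, so it is part of
  \<open>north W'\<close>. It contains \<open>ring W\<close>, while \<open>ring W'\<close> is
  disjoint from \<open>north W'\<close>. The other case is symmetric.\<close>

lemma rings_disjoint:
  assumes W: "W \<in> components U" and W': "W' \<in> components U" "W' \<noteq> W" and e': "deg (restr W \<zeta>) \<noteq> 0" and e: "deg (restr W' \<zeta>) \<noteq> 0"
  shows "ring W \<inter> ring W' = {}"
proof -
  note sn = south_north[OF W]
  have sep: "south W \<inter> north W = {}" if "south W \<noteq> north W"
    using components_nonoverlap[OF sn(1,2)] that by blast
  have con: "connected (Sph - K)" if "K \<in> components (Sph - W)" for K
    by (rule connected_complement_of_component[OF component_props(6)[OF W] component_props(5)[OF W] that])
  note ne = essential_imp_separates[OF W e']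
  consider "W' \<subseteq> south W" | "W' \<subseteq> north W" using essential_in_south_or_north[OF W W' e] by blast
  then show ?thesis
  proof cases
    case 1
    have "Sph - south W \<subseteq> north W'"
      by (rule connected_component_maximal[OF _ con[OF sn(1)]]) (use 1 sn sep[OF ne] pole_in_Sph in blast)+
    then show ?thesis unfolding ring_def by blast
  next
    case 2
    have "Sph - north W \<subseteq> south W'"
      by (rule connected_component_maximal[OF _ con[OF sn(2)]]) (use 2 sn sep[OF ne] pole_in_Sph in blast)+
    then show ?thesis unfolding ring_def by blast
  qed
qed

end

section \<open>Fixed points contributed by one component, and the total count\<close>

lemma exp_powi: "exp (\<i> * of_real t) powi n = exp (\<i> * of_real (of_int n * t))"
  by (simp only: exp_power_int of_real_mult of_real_of_int_eq mult.left_commute)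

lemma sgn_power_complex: "sgn (z ^ n) = sgn z ^ n" for z :: complex
  by (induction n) (simp_all add: sgn_mult)

lemma sgn_powi_complex: "sgn (z powi n) = sgn z powi n" for z :: complex
proof -
  have "sgn (inverse z) = inverse (sgn z)"
    by (simp add: sgn_eq norm_inverse divide_inverse)
  then show ?thesis by (simp add: power_int_def sgn_power_complex)
qed

context loop_attracting
begin

text \<open>The last conclusion records that only components on which \<open>\<zeta>\<close> has
  nonzero degree receive a nonempty set; their rings are pairwise disjoint, so no fixed point is
  counted twice.\<close>

lemma component_fixed_points:
  assumes W: "W \<in> components U"
  obtains Z where "finite Z" "Z \<subseteq> {x \<in> ring W. F x = x}"
    "\<bar>deg (restr W \<eta>) - deg (restr W \<zeta>)\<bar> \<le> int (card Z)"
    "Z \<noteq> {} \<Longrightarrow> deg (restr W \<zeta>) \<noteq> 0"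
proof -
  note cp = component_props[OF W] and sn = south_north[OF W]
  have US: "U \<subseteq> Sph" by (auto simp: U_def)
  have lpc: "locally path_connected W" by (rule locally_path_connected_Sph_open[OF cp(1)])
  have pc: "path_connected W" by (rule path_connected_if_connected[OF cp(6) lpc])
  have lw: "log_var ((\<lambda>x. fst (F x)) \<circ> \<gamma>) = 0"
    if "path \<gamma>" "path_image \<gamma> \<subseteq> W" "pathfinish \<gamma> = pathstart \<gamma>" "log_var (fst \<circ> \<gamma>) = 0" for \<gamma>
    by (rule loops[OF that(1) _ that(3,4)]) (use that(2) cp(4) in \<open>auto simp: U_def\<close>)
  obtain k :: nat and a :: int and r g h where k: "k > 0" and r: "continuous_on W r" "\<And>x. x \<in> W \<Longrightarrow> r x \<noteq> 0"
    and gh: "continuous_on W g" "continuous_on W h"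
    and p: "\<And>x. x \<in> W \<Longrightarrow> fst x = r x ^ k * exp (g x)" and q: "\<And>x. x \<in> W \<Longrightarrow> fst (F x) = r x powi a * exp (h x)"
    by (rule common_root_of_loops[OF pc lpc cp(7)
          continuous_on_subset[OF continuous_on_fst_U(1) cp(4)] fst_nonzero(1)[OF subsetD[OF cp(4)]]
          continuous_on_subset[OF continuous_on_fst_U(2) cp(4)] fst_nonzero(2)[OF subsetD[OF cp(4)]] lw]) blast+
  define \<rho> where "\<rho> = (\<lambda>x. sgn (r x))"
  define G where "G = (\<lambda>x. Im (g x))"
  define H where "H = (\<lambda>x. Im (h x))"
  have cGH: "continuous_on W G" "continuous_on W H" unfolding G_def H_def by (intro continuous_intros gh)+
  have \<rho>: "circle_map (restr W \<rho>)"
    by (rule circle_map_restr[OF cp(2,3)]) (use r in \<open>auto simp: \<rho>_def norm_sgn intro!: continuous_on_sgn\<close>)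
  have \<zeta>\<rho>: "\<zeta> x = \<rho> x ^ k * exp (\<i> * of_real (G x))" if "x \<in> W" for x
    by (simp add: p[OF that] sgn_mult sgn_power_complex sgn_exp \<rho>_def G_def)
  have \<eta>\<rho>: "\<eta> x = \<rho> x powi a * exp (\<i> * of_real (H x))" if "x \<in> W" for x
    by (simp add: q[OF that] sgn_mult sgn_powi_complex sgn_exp \<rho>_def H_def)
  define t where "t = deg (restr W \<rho>)"
  have rk: "restr W (\<lambda>x. \<rho> x ^ k) = (\<lambda>x. restr W \<rho> x ^ k)" and ra: "restr W (\<lambda>x. \<rho> x powi a) = (\<lambda>x. restr W \<rho> x powi a)"
    by (auto simp: restr_def)
  have d\<zeta>: "deg (restr W \<zeta>) = int k * t"
    using deg_restr_mult_exp[OF cp(2,3) _ cGH(1) \<zeta>\<rho>, unfolded rk, OF circle_map_power[OF \<rho>]]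
    by (simp add: deg_power[OF \<rho>] t_def)
  have d\<eta>: "deg (restr W \<eta>) = a * t"
    using deg_restr_mult_exp[OF cp(2,3) _ cGH(2) \<eta>\<rho>, unfolded ra, OF circle_map_power_int[OF \<rho>]]
    by (simp add: deg_power_int[OF \<rho>] t_def)
  show thesis
  \<comment> \<open>In these cases the empty set suffices: the two degrees are a t and k t, so they
    both vanish or coincide.\<close>
  proof (cases "t = 0 \<or> a = 1 \<and> k = 1")
    case True
    then show thesis using that[of "{}"] d\<zeta> d\<eta> by auto
  next
    case False
    then have t0: "deg (restr W \<zeta>) \<noteq> 0" using d\<zeta> k by simp
    note ne = essential_imp_separates[OF W t0]
    obtain v0 where v0: "\<bar>v0\<bar> = 1" "\<And>x. x \<in> south W \<Longrightarrow> x \<in> closure (Sph - south W) \<Longrightarrow> snd (F x) = v0"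
      using component_boundary_value[OF W sn(1)] by metis
    obtain v1 where v1: "\<bar>v1\<bar> = 1" "\<And>x. x \<in> north W \<Longrightarrow> x \<in> closure (Sph - north W) \<Longrightarrow> snd (F x) = v1"
      using component_boundary_value[OF W sn(2)] by metis
    note b = restr_\<zeta>_deg_bound[OF W ne v0 v1]
    have "\<bar>int k * t\<bar> = 1" using b(1) t0 unfolding d\<zeta> by linarith
    then have "\<bar>int k\<bar> * \<bar>t\<bar> = 1" by (simp only: abs_mult)
    then have kt: "k = 1" "\<bar>t\<bar> = 1" by (simp_all add: zmult_eq_1_iff)
    then have a: "a \<noteq> 1" using False by simp
    have v01: "v0 = -1 \<and> v1 = 1 \<or> v0 = 1 \<and> v1 = -1" using b(2) t0 v0(1) v1(1) by linarith
    obtain \<theta> \<phi> where \<theta>: "continuous_on (U \<inter> ring W - W) \<theta>" "\<And>x. x \<in> U \<inter> ring W - W \<Longrightarrow> \<zeta> x = exp (\<i> * of_real (\<theta> x))"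
      and \<phi>: "continuous_on (U \<inter> ring W - W) \<phi>" "\<And>x. x \<in> U \<inter> ring W - W \<Longrightarrow> \<eta> x = exp (\<i> * of_real (\<phi> x))"
      using angle_off_component[OF W] by metis
    \<comment> \<open>The angle of \<open>\<eta>\<close> relative to the a-th power of
      \<open>\<zeta>\<close>, on all of \<open>U\<close> inside the ring. On \<open>W\<close> it
      comes from the common root, which is \<open>\<zeta>\<close> up to a factor with a continuous
      angle since k = 1; elsewhere both functions have angles of their own.\<close>
    define \<psi> where "\<psi> = (\<lambda>x. if x \<in> W then H x - of_int a * G x else \<phi> x - of_int a * \<theta> x)"
    have eqU: "{x \<in> Sph - south W - north W. \<bar>snd (F x)\<bar> < 1} = U \<inter> ring W" by (auto simp: U_def ring_def)
    have WU: "W \<subseteq> U \<inter> ring W" using cp(4) component_subset_ring[OF W] by blast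
    have IU: "U \<inter> ring W \<subseteq> U" by blast
    have c\<psi>: "continuous_on (U \<inter> ring W) \<psi>"
      unfolding \<psi>_def
    proof (rule continuous_on_if_clopen)
      show "openin (top_of_set (U \<inter> ring W)) W" by (rule openin_subset_trans[OF cp(2) WU IU])
      show "openin (top_of_set (U \<inter> ring W)) (U \<inter> ring W - W)"
        by (rule openin_subset_trans[OF openin_ring_parts(1)[OF W]]) auto
      show "continuous_on W (\<lambda>x. H x - of_int a * G x)" by (intro continuous_intros cGH)
      show "continuous_on (U \<inter> ring W - W) (\<lambda>x. \<phi> x - of_int a * \<theta> x)" by (intro continuous_intros \<theta> \<phi>)
    qed
    have key: "\<eta> x = \<zeta> x powi a * exp (\<i> * of_real (\<psi> x))" if x: "x \<in> U \<inter> ring W" for x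
    proof (cases "x \<in> W")
      case True
      have "\<zeta> x powi a = \<rho> x powi a * exp (\<i> * of_real (of_int a * G x))"
        by (simp only: \<zeta>\<rho>[OF True] kt(1) power_one_right power_int_mult_distrib exp_powi)
      then have "\<zeta> x powi a * exp (\<i> * of_real (\<psi> x)) = \<rho> x powi a * exp (\<i> * of_real (of_int a * G x) + \<i> * of_real (H x - of_int a * G x))"
        using True by (simp add: \<psi>_def exp_add mult.assoc)
      also have "\<i> * of_real (of_int a * G x) + \<i> * of_real (H x - of_int a * G x) = \<i> * of_real (H x)"
        by (simp add: algebra_simps)
      finally show ?thesis by (simp only: \<eta>\<rho>[OF True])
    next
      case False
      then have x': "x \<in> U \<inter> ring W - W" using x by blast
      have "\<zeta> x powi a * exp (\<i> * of_real (\<psi> x)) = exp (\<i> * of_real (of_int a * \<theta> x) + \<i> * of_real (\<phi> x - of_int a * \<theta> x))"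
        using False by (simp only: \<theta>(2)[OF x'] exp_powi exp_add) (simp add: \<psi>_def)
      also have "\<i> * of_real (of_int a * \<theta> x) + \<i> * of_real (\<phi> x - of_int a * \<theta> x) = \<i> * of_real (\<phi> x)"
        by (simp add: algebra_simps)
      finally show ?thesis by (simp only: \<phi>(2)[OF x'])
    qed
    have cl: "closed (south W)" "closed (north W)" by (rule closed_Sph_component[OF cp(1)], rule sn)+
    have dK: "south W \<inter> north W = {}" using components_nonoverlap[OF sn(1,2)] ne by blast
    have KS: "south W \<subseteq> Sph" "north W \<subseteq> Sph" using in_components_subset[OF sn(1)] in_components_subset[OF sn(2)] by auto
    obtain Z where Z: "Z \<subseteq> {x \<in> Sph - south W - north W. F x = x}" "finite Z" "card Z = nat \<bar>a - 1\<bar>"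
    proof (rule ring_fixed_points[OF cl dK KS sn(3,4) v0(2) v1(2) v01, unfolded eqU, OF _ _ _ _ c\<psi> _ a])
      show "sgn (fst (F x)) = sgn (fst x) powi a * exp (\<i> * of_real (\<psi> x))"
        if "x \<in> Sph - south W - north W" "\<bar>snd (F x)\<bar> < 1" for x
        by (rule key) (use that in \<open>simp add: U_def ring_def\<close>)
    qed auto
    have "deg (restr W \<eta>) - deg (restr W \<zeta>) = (a - 1) * t" by (simp add: d\<zeta> d\<eta> kt(1) algebra_simps)
    then have "\<bar>deg (restr W \<eta>) - deg (restr W \<zeta>)\<bar> = int (card Z)" using Z(3) kt(2) by (simp add: abs_mult)
    then show thesis using that[OF Z(2) _ _ t0] Z(1) by (simp add: ring_def)
  qed
qed

theorem fixed_point_count: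
  assumes fin: "finite {x \<in> Sph. F x = x}"
  shows "\<bar>sph_degree F - 1\<bar> \<le> int (card {x \<in> Sph. F x = x})"
proof -
  let ?C = zero_components
  have C: "W \<in> components U" if "W \<in> ?C" for W using that by (simp add: zero_components_def)
  have ex: "\<exists>Z. finite Z \<and> Z \<subseteq> {x \<in> ring W. F x = x} \<and>
      \<bar>deg (restr W \<eta>) - deg (restr W \<zeta>)\<bar> \<le> int (card Z) \<and> (Z \<noteq> {} \<longrightarrow> deg (restr W \<zeta>) \<noteq> 0)"
    if W: "W \<in> ?C" for W
    by (rule component_fixed_points[OF C[OF W]]) blast
  have "\<exists>Z. \<forall>W\<in>?C. finite (Z W) \<and> Z W \<subseteq> {x \<in> ring W. F x = x} \<and>
      \<bar>deg (restr W \<eta>) - deg (restr W \<zeta>)\<bar> \<le> int (card (Z W)) \<and> (Z W \<noteq> {} \<longrightarrow> deg (restr W \<zeta>) \<noteq> 0)"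
    by (rule bchoice, rule ballI, rule ex)
  then obtain Z where "\<forall>W\<in>?C. finite (Z W) \<and> Z W \<subseteq> {x \<in> ring W. F x = x} \<and>
      \<bar>deg (restr W \<eta>) - deg (restr W \<zeta>)\<bar> \<le> int (card (Z W)) \<and> (Z W \<noteq> {} \<longrightarrow> deg (restr W \<zeta>) \<noteq> 0)" ..
  then have Z: "\<And>W. W \<in> ?C \<Longrightarrow> finite (Z W)" "\<And>W. W \<in> ?C \<Longrightarrow> Z W \<subseteq> {x \<in> ring W. F x = x}"
    "\<And>W. W \<in> ?C \<Longrightarrow> \<bar>deg (restr W \<eta>) - deg (restr W \<zeta>)\<bar> \<le> int (card (Z W))"
    "\<And>W. W \<in> ?C \<Longrightarrow> Z W \<noteq> {} \<Longrightarrow> deg (restr W \<zeta>) \<noteq> 0"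
    by blast+
  have disj: "Z W \<inter> Z W' = {}" if "W \<in> ?C" "W' \<in> ?C" "W \<noteq> W'" for W W'
  proof (rule ccontr)
    assume n: "Z W \<inter> Z W' \<noteq> {}"
    then have "ring W \<inter> ring W' = {}"
      using Z(4)[OF that(1)] Z(4)[OF that(2)] by (intro rings_disjoint C that) (use that in blast)+
    then show False using n Z(2)[OF that(1)] Z(2)[OF that(2)] by blast
  qed
  have "sph_degree F - 1 = (\<Sum>W\<in>?C. deg (restr W \<eta>) - deg (restr W \<zeta>))"
    using deg_sum_components[OF circle_map_\<zeta>_\<eta>(1)] deg_sum_components[OF circle_map_\<zeta>_\<eta>(2)] deg_\<zeta> deg_\<eta>
    by (simp add: sum_subtractf)
  then have "\<bar>sph_degree F - 1\<bar> \<le> (\<Sum>W\<in>?C. \<bar>deg (restr W \<eta>) - deg (restr W \<zeta>)\<bar>)" by (simp add: sum_abs)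
  also have "\<dots> \<le> (\<Sum>W\<in>?C. int (card (Z W)))" by (rule sum_mono[OF Z(3)])
  also have "\<dots> = int (card (\<Union>W\<in>?C. Z W))"
    using card_UN_disjoint[OF finite_zero_components, of Z] Z(1) disj by auto
  also have "\<dots> \<le> int (card {x \<in> Sph. F x = x})"
  proof -
    have "(\<Union>W\<in>?C. Z W) \<subseteq> {x \<in> Sph. F x = x}" using Z(2) unfolding ring_def by blast
    then show ?thesis using card_mono[OF fin] by simp
  qed
  finally show ?thesis .
qed

end

section \<open>Transfer to the library sphere\<close>

abbreviation Sph_A :: "(complex \<times> real) set"
  where "Sph_A \<equiv> Sph - {(0, -1), (0, 1)}"

lemma Sph_A_iff: "x \<in> Sph \<Longrightarrow> x \<in> Sph_A \<longleftrightarrow> \<bar>snd x\<bar> < 1"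
  using Sph_snd_less[of x] by auto

lemma Sph_A_fst: "x \<in> Sph_A \<Longrightarrow> fst x \<noteq> 0"
  using Sph_fst_eq_0[of x] by auto

lemma winding_0_iff_null_homotopic:
  assumes "path p" "0 \<notin> path_image p"
  shows "log_var p = 0 \<longleftrightarrow> (\<exists>a. homotopic_loops (-{0}) p (\<lambda>t. a))"
  using log_var_winding_number[OF assms] winding_number_homotopic_loops_null_eq[OF assms] by simp

text \<open>The two functions differ by a positive factor depending on the height, whose real
  logarithm returns to its start along a loop.\<close>

lemma log_var_stereo:
  assumes \<gamma>: "path \<gamma>" "path_image \<gamma> \<subseteq> Sph_A" "pathfinish \<gamma> = pathstart \<gamma>"
  shows "log_var (stereo \<circ> \<gamma>) = log_var (fst \<circ> \<gamma>)"
proof -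
  have in_A: "\<gamma> t \<in> Sph_A" if "t \<in> {0..1}" for t
    by (rule subsetD[OF \<gamma>(2)]) (use that in \<open>unfold path_image_def, rule imageI\<close>)
  have lt: "snd (\<gamma> t) < 1" if "t \<in> {0..1}" for t
    using in_A[OF that] Sph_A_iff[of "\<gamma> t"] by auto
  have c\<gamma>: "continuous_on {0..1} \<gamma>" using \<gamma>(1) by (simp add: path_def)
  let ?s = "\<lambda>t. of_real (- ln (1 - snd (\<gamma> t))) :: complex"
  have cs: "continuous_on {0..1} ?s"
    by (intro continuous_intros c\<gamma>) (use lt in force)
  have e: "exp (?s t) = inverse (of_real (1 - snd (\<gamma> t)))" if "t \<in> {0..1}" for t
    using lt[OF that] by (simp only: exp_of_real exp_minus exp_ln of_real_inverse diff_gt_0_iff_gt)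
  have "log_var (\<lambda>t. exp (?s t)) = ?s 1 - ?s 0" by (rule log_var_eq[OF cs refl])
  also have "\<dots> = 0" using \<gamma>(3) by (simp add: pathfinish_def pathstart_def)
  finally have 0: "log_var (\<lambda>t. exp (?s t)) = 0" .
  have cf: "continuous_on {0..1} (fst \<circ> \<gamma>)" by (intro continuous_intros c\<gamma> continuous_on_compose)
  obtain g where g: "continuous_on {0..1} g" "\<And>t. t \<in> {0..1} \<Longrightarrow> (fst \<circ> \<gamma>) t = exp (g t)"
    by (rule continuous_log_on_interval[OF cf]) (use Sph_A_fst[OF in_A] in auto)
  have "log_var (fst \<circ> \<gamma>) = g 1 - g 0" by (rule log_var_eq[OF g])
  moreover have "log_var (stereo \<circ> \<gamma>) = (g 1 + ?s 1) - (g 0 + ?s 0)"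
  proof (rule log_var_eq)
    show "continuous_on {0..1} (\<lambda>t. g t + ?s t)" by (intro continuous_on_add g(1) cs)
    show "(stereo \<circ> \<gamma>) t = exp (g t + ?s t)" if "t \<in> {0..1}" for t
      using g(2)[OF that] by (simp only: exp_add e[OF that] stereo_def divide_inverse comp_apply)
  qed
  ultimately show ?thesis using \<gamma>(3) by (simp add: pathfinish_def pathstart_def)
qed

text \<open>Stereographic projection identifies \<open>Sph_A\<close> with the punctured plane, where
  a loop is contractible exactly when its winding number about 0 vanishes.\<close>

lemma null_homotopic_Sph_A_iff:
  assumes \<gamma>: "path \<gamma>" "path_image \<gamma> \<subseteq> Sph_A" "pathfinish \<gamma> = pathstart \<gamma>"
  shows "(\<exists>a. homotopic_loops Sph_A \<gamma> (\<lambda>_. a)) \<longleftrightarrow> log_var (fst \<circ> \<gamma>) = 0"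
proof -
  have cst: "continuous_on Sph_A stereo"
    by (rule continuous_on_subset[OF continuous_on_stereo]) (use Sph_A_iff in force)
  have lt: "snd x < 1" if "x \<in> Sph_A" for x using Sph_A_iff[of x] that by auto
  have st0: "stereo x \<noteq> 0" if "x \<in> Sph_A" for x
    using stereo_eq_0[OF lt[OF that]] Sph_A_fst[OF that] by simp
  have p: "path (stereo \<circ> \<gamma>)" by (rule path_continuous_image[OF \<gamma>(1) continuous_on_subset[OF cst \<gamma>(2)]])
  have n0: "0 \<notin> path_image (stereo \<circ> \<gamma>)" using \<gamma>(2) st0 by (force simp: path_image_compose)
  note iff = winding_0_iff_null_homotopic[OF p n0, unfolded log_var_stereo[OF \<gamma>]]
  show ?thesis
  proof
    assume "\<exists>a. homotopic_loops Sph_A \<gamma> (\<lambda>_. a)"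
    then obtain a where "homotopic_loops Sph_A \<gamma> (\<lambda>_. a)" by blast
    then have "homotopic_loops (-{0}) (stereo \<circ> \<gamma>) (stereo \<circ> (\<lambda>_. a))"
      by (rule homotopic_loops_continuous_image[OF _ cst]) (use st0 in blast)
    then show "log_var (fst \<circ> \<gamma>) = 0" unfolding iff by (auto simp: comp_def)
  next
    assume "log_var (fst \<circ> \<gamma>) = 0"
    then obtain a where "homotopic_loops (-{0}) (stereo \<circ> \<gamma>) (\<lambda>_. a)" unfolding iff by blast
    then have "homotopic_loops Sph_A (istereo \<circ> (stereo \<circ> \<gamma>)) (istereo \<circ> (\<lambda>_. a))"
    proof (rule homotopic_loops_continuous_image[OF _ continuous_on_istereo])
      show "istereo \<in> -{0} \<rightarrow> Sph_A"
        using abs_snd_istereo Sph_A_iff[OF istereo_in_Sph] by blast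
    qed
    moreover have "homotopic_loops Sph_A \<gamma> (istereo \<circ> (stereo \<circ> \<gamma>))"
    proof (rule homotopic_loops_eq[OF \<gamma>])
      fix t :: real assume "t \<in> {0..1}"
      then have "\<gamma> t \<in> path_image \<gamma>" unfolding path_image_def by (rule imageI)
      then have "\<gamma> t \<in> Sph_A" by (rule subsetD[OF \<gamma>(2)])
      then show "\<gamma> t = (istereo \<circ> (stereo \<circ> \<gamma>)) t" using istereo_stereo[of "\<gamma> t"] lt by auto
    qed
    ultimately show "\<exists>a. homotopic_loops Sph_A \<gamma> (\<lambda>_. a)"
      using homotopic_loops_trans by (fastforce simp: comp_def)
  qed
qed

section \<open>Moving two points of the sphere to the poles\<close>

lemma recentred_sphere_homeomorphism:
  fixes c :: "'a::euclidean_space"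
  assumes c: "norm c < 1"
  obtains g where "homeomorphism (sphere 0 1) (sphere 0 1) (\<lambda>x. (x - c) /\<^sub>R norm (x - c)) g"
proof -
  let ?f = "\<lambda>x. (x - c) /\<^sub>R norm (x - c)"
  have ne: "norm (x - c) \<noteq> 0" if "x \<in> sphere 0 1" for x using that c by auto
  have c1: "c \<bullet> c < 1" using c by (simp add: dot_square_norm abs_square_less_1)
  have "\<exists>g. homeomorphism (sphere 0 1) (sphere 0 1) ?f g"
  proof (rule homeomorphism_compact)
    show "compact (sphere (0::'a) 1)" by simp
    show "continuous_on (sphere 0 1) ?f" by (intro continuous_intros) (use ne in auto)
    show "inj_on ?f (sphere 0 1)"
    proof (rule inj_onI)
      fix x y :: 'a assume xy: "x \<in> sphere 0 1" "y \<in> sphere 0 1" "?f x = ?f y"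
      define s t w where "s = norm (x - c)" and "t = norm (y - c)" and "w = ?f x"
      have st: "s > 0" "t > 0" using ne[OF xy(1)] ne[OF xy(2)] by (simp_all add: s_def t_def)
      have x: "x = c + s *\<^sub>R w" using ne[OF xy(1)] by (simp add: s_def w_def)
      have y: "y = c + t *\<^sub>R w" unfolding w_def xy(3) using ne[OF xy(2)] by (simp add: t_def)
      have w1: "w \<bullet> w = 1" using ne[OF xy(1)] by (simp add: dot_square_norm w_def)
      have "x \<bullet> x = 1" "y \<bullet> y = 1" using xy(1,2) by (simp_all add: dot_square_norm)
      then have e: "c \<bullet> c + 2 * s * (c \<bullet> w) + s * s = 1" "c \<bullet> c + 2 * t * (c \<bullet> w) + t * t = 1"
        unfolding x y using w1 by (simp_all add: inner_add_left inner_add_right inner_commute algebra_simps)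
      \<comment> \<open>Both distances are positive roots of s^2 + 2 s (c . w) = 1 - |c|^2. The
        right side is positive, so the roots have opposite signs and the positive one is unique;
        this combination eliminates c . w.\<close>
      have "t * (c \<bullet> c + 2 * s * (c \<bullet> w) + s * s) - s * (c \<bullet> c + 2 * t * (c \<bullet> w) + t * t) = t - s"
        unfolding e by simp
      then have "(s - t) * ((1 - c \<bullet> c) + s * t) = 0" by (simp add: algebra_simps)
      moreover have "(1 - c \<bullet> c) + s * t > 0" using c1 st by (simp add: add_pos_pos)
      ultimately have "s = t" by simp
      then show "x = y" using x y by simp
    qed
    show "?f ` sphere 0 1 = sphere 0 1"
    proof
      show "?f ` sphere 0 1 \<subseteq> sphere 0 1" using ne by auto
      show "sphere 0 1 \<subseteq> ?f ` sphere 0 1"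
      proof
        fix v :: 'a assume "v \<in> sphere 0 1"
        then have v: "norm v = 1" by simp
        have "\<exists>s. 0 \<le> s \<and> s \<le> 2 \<and> norm (c + s *\<^sub>R v) = 1"
        proof (rule IVT')
          show "norm (c + 0 *\<^sub>R v) \<le> 1" using c by simp
          have "norm (2 *\<^sub>R v) \<le> norm (c + 2 *\<^sub>R v) + norm c"
            using norm_triangle_ineq4[of "c + 2 *\<^sub>R v" c] by simp
          then show "1 \<le> norm (c + 2 *\<^sub>R v)" using v c by simp
          show "continuous_on {0..2} (\<lambda>s. norm (c + s *\<^sub>R v))" by (intro continuous_intros)
        qed simp
        then obtain s where s: "0 \<le> s" "norm (c + s *\<^sub>R v) = 1" by blast
        have "s \<noteq> 0" using s(2) c by auto
        then have "?f (c + s *\<^sub>R v) = v" using s(1) v by simp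
        then show "v \<in> ?f ` sphere 0 1" using s(2) by (intro image_eqI[of _ _ "c + s *\<^sub>R v"]) auto
      qed
    qed
  qed
  then show thesis using that by blast
qed

text \<open>The reflection in the hyperplane orthogonal to \<open>w\<close>; for
  \<open>w = 0\<close> it is the identity.\<close>

definition reflect :: "'a::real_inner \<Rightarrow> 'a \<Rightarrow> 'a"
  where "reflect w x = x - (2 * (x \<bullet> w) / (w \<bullet> w)) *\<^sub>R w"

lemma reflect_reflect: "reflect w (reflect w x) = x"
proof (cases "w = 0")
  case False
  then have "w \<bullet> w \<noteq> 0" by simp
  then have "(reflect w x) \<bullet> w = - (x \<bullet> w)" by (simp add: reflect_def inner_diff_left)
  then show ?thesis by (simp add: reflect_def[of w "reflect w x"]) (simp add: reflect_def)
qed (simp add: reflect_def)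

lemma norm_reflect: "norm (reflect w x) = norm x"
proof (cases "w = 0")
  case False
  then have "w \<bullet> w \<noteq> 0" by simp
  then have "reflect w x \<bullet> reflect w x = x \<bullet> x"
    unfolding reflect_def by (simp add: inner_diff_left inner_diff_right inner_commute)
  then show ?thesis by (simp add: norm_eq_sqrt_inner)
qed (simp add: reflect_def)

lemma reflect_minus: "reflect w (- x) = - reflect w x"
  by (simp add: reflect_def)

lemma reflect_diff:
  assumes "norm a = norm b"
  shows "reflect (a - b) a = b"
proof (cases "a = b")
  case False
  have ab: "a \<bullet> a = b \<bullet> b" using assms by (simp add: dot_square_norm)
  have "(a - b) \<bullet> (a - b) = 2 * (a \<bullet> (a - b))"
    using ab by (simp add: inner_diff_left inner_diff_right inner_commute)
  moreover have "(a - b) \<bullet> (a - b) \<noteq> 0" using False by simp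
  ultimately have "2 * (a \<bullet> (a - b)) / ((a - b) \<bullet> (a - b)) = 1" by simp
  then show ?thesis by (simp only: reflect_def) simp
qed (simp add: reflect_def)

text \<open>Seen from the midpoint of their chord the two points lie in opposite directions, so
  radial projection from there makes them antipodal; one reflection then moves the pair to the
  poles.\<close>

lemma Sph_homeomorphism_poles:
  assumes p: "p \<in> Sph" "q \<in> Sph" "p \<noteq> q"
  obtains \<Psi> \<Psi>' where "homeomorphism Sph Sph \<Psi> \<Psi>'" "\<Psi> p = (0, -1)" "\<Psi> q = (0, 1)"
proof -
  define c where "c = midpoint p q"
  have n: "norm p = 1" "norm q = 1" using p by (auto simp: Sph_def)
  have "norm (p + q) < norm p + norm q"
  proof -
    have "norm (p + q) \<noteq> norm p + norm q" using norm_triangle_eq[of p q] n p(3) by auto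
    then show ?thesis using norm_triangle_ineq[of p q] by linarith
  qed
  then have "norm c < 1" using n by (simp add: c_def midpoint_def)
  then obtain g where g: "homeomorphism Sph Sph (\<lambda>x. (x - c) /\<^sub>R norm (x - c)) g"
    using recentred_sphere_homeomorphism[of c] unfolding Sph_def by blast
  define a where "a = (p - c) /\<^sub>R norm (p - c)"
  have qc: "q - c = - (p - c)" by (simp add: c_def midpoint_def algebra_simps flip: scaleR_left_distrib)
  have "p - c \<noteq> 0" using n \<open>norm c < 1\<close> by auto
  then have na: "norm a = 1" by (simp add: a_def)
  define w where "w = a - (0, -1)"
  have "continuous_on Sph (reflect w)" unfolding reflect_def[abs_def] divide_inverse
    by (intro continuous_on_diff continuous_on_id continuous_on_scaleR continuous_on_const continuous_on_mult continuous_on_inner)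
  moreover have "reflect w x \<in> Sph" if "x \<in> Sph" for x using that norm_reflect[of w x] by (simp add: Sph_def)
  ultimately have "homeomorphism Sph Sph (reflect w) (reflect w)"
    by (intro homeomorphismI) (auto simp: reflect_reflect simp del: split_paired_All)
  from homeomorphism_compose[OF g this]
  have "homeomorphism Sph Sph (reflect w \<circ> (\<lambda>x. (x - c) /\<^sub>R norm (x - c))) (g \<circ> reflect w)" .
  moreover have rw: "reflect w a = (0, -1)" unfolding w_def by (rule reflect_diff) (simp add: na norm_Pair)
  moreover have "(q - c) /\<^sub>R norm (q - c) = - a" unfolding qc a_def norm_minus_cancel scaleR_minus_right ..
  ultimately show thesis
    using that[of "reflect w \<circ> (\<lambda>x. (x - c) /\<^sub>R norm (x - c))" "g \<circ> reflect w"]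
    by (simp add: reflect_minus flip: a_def)
qed

lemma continuous_map_nsphere_2:
  "continuous_map (nsphere 2) (top_of_set T) g \<Longrightarrow> continuous_on S2 g"
  "continuous_map (top_of_set T) (nsphere 2) g' \<Longrightarrow> continuous_on T g'"
  "continuous_map (nsphere 2) (nsphere 2) h \<Longrightarrow> continuous_on S2 h"
  unfolding nsphere_2_euclidean by auto

lemma S2_poles_homeomorphism:
  assumes "N \<in> S2" "S \<in> S2" "N \<noteq> S"
  obtains \<Theta> \<Theta>' where "homeomorphic_maps (nsphere 2) (top_of_set Sph) \<Theta> \<Theta>'" "\<Theta> N = (0, -1)" "\<Theta> S = (0, 1)"
proof -
  have "nsphere_to_Sph N \<noteq> nsphere_to_Sph S"
    using Sph_to_nsphere_inverse[OF assms(1)] Sph_to_nsphere_inverse[OF assms(2)] assms(3) by metis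
  then obtain \<Psi> \<Psi>' where \<Psi>: "homeomorphism Sph Sph \<Psi> \<Psi>'" "\<Psi> (nsphere_to_Sph N) = (0, -1)" "\<Psi> (nsphere_to_Sph S) = (0, 1)"
    using Sph_homeomorphism_poles[OF nsphere_to_Sph_in[OF assms(1)] nsphere_to_Sph_in[OF assms(2)]] by metis
  have "homeomorphic_maps (top_of_set Sph) (top_of_set Sph) \<Psi> \<Psi>'"
    using \<Psi>(1) by (auto simp: homeomorphic_maps_def homeomorphism_def)
  from homeomorphic_maps_compose[OF conjI[OF homeomorphic_maps_nsphere_Sph this]]
  show thesis by (rule that) (simp_all add: \<Psi>)
qed

text \<open>The homeomorphism may reverse orientation, but it and its inverse have the same degree,
  1 or -1, and these two factors cancel.\<close>

lemma sph_degree_conjugate: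
  assumes \<Theta>: "homeomorphic_maps (nsphere 2) (top_of_set Sph) \<Theta> \<Theta>'"
    and h: "continuous_map (nsphere 2) (nsphere 2) h"
  shows "sph_degree (\<Theta> \<circ> h \<circ> \<Theta>') = Brouwer_degree2 2 h"
proof -
  define A where "A = Sph_to_nsphere \<circ> \<Theta>"
  define B where "B = \<Theta>' \<circ> nsphere_to_Sph"
  have hm: "homeomorphic_maps (nsphere 2) (nsphere 2) A B"
    unfolding A_def B_def
  proof (rule homeomorphic_maps_compose[OF conjI[OF \<Theta>]])
    show "homeomorphic_maps (top_of_set Sph) (nsphere 2) Sph_to_nsphere nsphere_to_Sph"
      using homeomorphic_maps_nsphere_Sph homeomorphic_maps_sym by blast
  qed
  have cA: "continuous_map (nsphere 2) (nsphere 2) A" and cB: "continuous_map (nsphere 2) (nsphere 2) B"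
    using hm by (auto simp: homeomorphic_maps_def)
  have "\<bar>Brouwer_degree2 2 A\<bar> = 1 \<and> Brouwer_degree2 2 B = Brouwer_degree2 2 A"
    by (rule Brouwer_degree2_homeomorphic_maps[OF hm]) blast
  then have AB: "Brouwer_degree2 2 A * Brouwer_degree2 2 B = 1"
    by (metis abs_mult_self_eq mult_1)
  have "sph_degree (\<Theta> \<circ> h \<circ> \<Theta>') = Brouwer_degree2 2 (A \<circ> (h \<circ> B))"
    by (simp add: sph_degree_def A_def B_def comp_assoc)
  also have "\<dots> = Brouwer_degree2 2 A * (Brouwer_degree2 2 h * Brouwer_degree2 2 B)"
    by (simp add: Brouwer_degree2_compose cA cB h continuous_map_compose[OF cB h])
  also have "\<dots> = Brouwer_degree2 2 h" using AB by (simp add: mult.left_commute)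
  finally show ?thesis .
qed

text \<open>The image of the closure of the component is connected, lies in \<open>G\<close> and
  contains the fixed point \<open>p\<close>, so it stays in the component of \<open>p\<close>. This
  supplies the connected neighbourhoods that \<open>attracting_poles\<close> asks for.\<close>

lemma attracting_component:
  assumes F: "continuous_on Sph F" "\<And>x. x \<in> Sph \<Longrightarrow> F x \<in> Sph" and p: "F p = p"
    and G: "openin (top_of_set Sph) G" "p \<in> G" "F ` (top_of_set Sph closure_of G) \<subseteq> G"
  shows "openin (top_of_set Sph) (connected_component_set G p)" "connected (connected_component_set G p)"
    "p \<in> connected_component_set G p"
    "x \<in> closure (connected_component_set G p) \<Longrightarrow> F x \<in> connected_component_set G p"
proof -
  let ?C = "connected_component_set G p"
  have C: "?C \<in> components G" by (rule componentsI[OF G(2)])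
  show "openin (top_of_set Sph) ?C" by (rule openin_Sph_component[OF G(1) C])
  show "connected ?C" by simp
  show pC: "p \<in> ?C" using G(2) by simp
  have sub: "?C \<subseteq> G" by (rule connected_component_subset)
  have GS: "G \<subseteq> Sph" by (rule openin_imp_subset[OF G(1)])
  have clS: "closure ?C \<subseteq> Sph" by (rule closure_subset_Sph) (use sub GS in blast)
  have "closure ?C \<subseteq> top_of_set Sph closure_of G"
  proof -
    have "closure ?C \<subseteq> closure (Sph \<inter> G)" by (rule closure_mono) (use sub GS in blast)
    then show ?thesis using clS by (simp add: closure_of_subtopology)
  qed
  then have im: "F ` closure ?C \<subseteq> G" using G(3) by blast
  have "connected (F ` closure ?C)"
    by (intro connected_continuous_image continuous_on_subset[OF F(1) clS] connected_imp_connected_closure) simp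
  moreover have "p \<in> F ` closure ?C" using pC closure_subset[of ?C] p by (metis imageI subsetD)
  ultimately have "F ` closure ?C \<subseteq> ?C" using connected_component_maximal[OF _ _ im] by blast
  then show "x \<in> closure ?C \<Longrightarrow> F x \<in> ?C" by blast
qed

lemma conjugate_attracting:
  assumes \<Theta>: "homeomorphic_maps X Y \<Theta> \<Theta>'" and U: "openin X U" "h ` (X closure_of U) \<subseteq> U"
  shows "openin Y (\<Theta> ` U)" "(\<Theta> \<circ> h \<circ> \<Theta>') ` (Y closure_of (\<Theta> ` U)) \<subseteq> \<Theta> ` U"
proof -
  have c: "continuous_map X Y \<Theta>" "continuous_map Y X \<Theta>'" and inv: "\<And>x. x \<in> topspace X \<Longrightarrow> \<Theta>' (\<Theta> x) = x"
    using \<Theta> by (auto simp: homeomorphic_maps_def)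
  have "homeomorphic_map X Y \<Theta>" using \<Theta> homeomorphic_map_maps by blast
  then show "openin Y (\<Theta> ` U)" using U(1) homeomorphic_imp_open_map open_map_def by blast
  have UX: "U \<subseteq> topspace X" by (rule openin_subset[OF U(1)])
  have eq: "\<Theta>' ` \<Theta> ` U = U"
    unfolding image_image by (rule trans[OF image_cong[OF refl] image_ident]) (use inv UX in blast)
  have "\<Theta>' ` (Y closure_of (\<Theta> ` U)) \<subseteq> X closure_of U"
    using continuous_map_image_closure_subset[OF c(2), of "\<Theta> ` U"] unfolding eq .
  then show "(\<Theta> \<circ> h \<circ> \<Theta>') ` (Y closure_of (\<Theta> ` U)) \<subseteq> \<Theta> ` U"
    unfolding image_comp[symmetric] using U(2) by blast
qed

theorem S2_fixed_point_count:
  assumes h: "continuous_map (nsphere 2) (nsphere 2) h"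
    and NS: "N \<in> S2" "S \<in> S2" "N \<noteq> S" and att: "attracting_fixed_pair (nsphere 2) h N S"
    and loops: "\<And>\<gamma>. loop_in {x \<in> S2. h x \<in> S2 - {N, S}} \<gamma> \<Longrightarrow> homotopically_trivial_in (S2 - {N, S}) \<gamma>
           \<Longrightarrow> homotopically_trivial_in (S2 - {N, S}) (h \<circ> \<gamma>)"
    and fin: "finite {x \<in> S2. h x = x}"
  shows "\<bar>Brouwer_degree2 2 h - 1\<bar> \<le> int (card {x \<in> S2. h x = x})"
proof -
  let ?A = "S2 - {N, S}"
  obtain \<Theta> \<Theta>' where \<Theta>: "homeomorphic_maps (nsphere 2) (top_of_set Sph) \<Theta> \<Theta>'"
    and \<Theta>N: "\<Theta> N = (0, -1)" and \<Theta>S: "\<Theta> S = (0, 1)"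
    using S2_poles_homeomorphism[OF NS] .
  have c\<Theta>: "continuous_map (nsphere 2) (top_of_set Sph) \<Theta>" "continuous_map (top_of_set Sph) (nsphere 2) \<Theta>'"
    and inv: "\<And>x. x \<in> S2 \<Longrightarrow> \<Theta>' (\<Theta> x) = x" and inv': "\<And>y. y \<in> Sph \<Longrightarrow> \<Theta> (\<Theta>' y) = y"
    using \<Theta> by (auto simp: homeomorphic_maps_def simp del: split_paired_All)
  have in\<Theta>: "\<Theta> x \<in> Sph" if "x \<in> S2" for x
    using continuous_map_funspace[OF c\<Theta>(1)] that by auto
  have in\<Theta>': "\<Theta>' y \<in> S2" if "y \<in> Sph" for y
    using continuous_map_funspace[OF c\<Theta>(2)] that by auto
  have inh: "h x \<in> S2" if "x \<in> S2" for x using continuous_map_funspace[OF h] that by auto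
  have con: "continuous_on S2 \<Theta>" "continuous_on Sph \<Theta>'" "continuous_on S2 h"
    by (rule continuous_map_nsphere_2, fact c\<Theta> h)+
  have AS: "\<Theta> x \<in> Sph_A \<longleftrightarrow> x \<in> ?A" if "x \<in> S2" for x
    using in\<Theta>[OF that] inv[OF that] inv[OF NS(1)] inv[OF NS(2)] \<Theta>N \<Theta>S that by (metis Diff_iff insert_iff empty_iff)
  have SA: "\<Theta>' y \<in> ?A \<longleftrightarrow> y \<in> Sph_A" if "y \<in> Sph" for y
    using AS[OF in\<Theta>'[OF that]] inv'[OF that] by simp
  define F where "F = \<Theta> \<circ> h \<circ> \<Theta>'"
  have F: "continuous_on Sph F" unfolding F_def
    by (intro continuous_on_compose con(2) continuous_on_subset[OF con(3)] continuous_on_subset[OF con(1)])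
      (use in\<Theta>' inh in auto)
  have FS: "F x \<in> Sph" if "x \<in> Sph" for x using that in\<Theta> in\<Theta>' inh by (simp add: F_def)
  obtain V V' where V: "openin (nsphere 2) V" "openin (nsphere 2) V'" "V \<inter> V' = {}" "N \<in> V" "S \<in> V'"
    "h ` (nsphere 2 closure_of V) \<subseteq> V" "h ` (nsphere 2 closure_of V') \<subseteq> V'"
    using att unfolding attracting_fixed_pair_def by blast
  have hNS: "h N = N" "h S = S" using att unfolding attracting_fixed_pair_def by auto
  have Fp: "F (0, -1) = (0, -1)" "F (0, 1) = (0, 1)"
    using inv[OF NS(1)] inv[OF NS(2)] \<Theta>N \<Theta>S hNS by (simp_all add: F_def)
  note G = conjugate_attracting[OF \<Theta> V(1,6), folded F_def] and G' = conjugate_attracting[OF \<Theta> V(2,7), folded F_def]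
  have poles: "(0, -1) \<in> \<Theta> ` V" "(0, 1) \<in> \<Theta> ` V'"
    using V(4,5) \<Theta>N \<Theta>S by (metis imageI)+
  have "V \<subseteq> S2" "V' \<subseteq> S2" using V(1,2) openin_subset by blast+
  then have dis: "\<Theta> ` V \<inter> \<Theta> ` V' = {}" 
  proof (intro equals0I)
    fix y assume "y \<in> \<Theta> ` V \<inter> \<Theta> ` V'"
    then obtain x x' where x: "x \<in> V" "x' \<in> V'" "\<Theta> x = \<Theta> x'" by auto
    then have "x = x'" using inv[of x] inv[of x'] \<open>V \<subseteq> S2\<close> \<open>V' \<subseteq> S2\<close> by (metis subsetD)
    then show False using x V(3) by blast
  qed
  let ?VN = "connected_component_set (\<Theta> ` V) (0, -1)" and ?VS = "connected_component_set (\<Theta> ` V') (0, 1)"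
  note cN = attracting_component[OF F FS Fp(1) G(1) poles(1) G(2)]
    and cS = attracting_component[OF F FS Fp(2) G'(1) poles(2) G'(2)]
  interpret loop_attracting F ?VN ?VS
  proof
    show "?VN \<inter> ?VS = {}"
      using dis connected_component_subset[of "\<Theta> ` V" "(0, -1)"] connected_component_subset[of "\<Theta> ` V'" "(0, 1)"] by blast
    fix \<gamma> assume \<gamma>: "path \<gamma>" "path_image \<gamma> \<subseteq> {x \<in> Sph. \<bar>snd (F x)\<bar> < 1}" "pathfinish \<gamma> = pathstart \<gamma>" "log_var (fst \<circ> \<gamma>) = 0"
    have gS: "path_image \<gamma> \<subseteq> Sph" using \<gamma>(2) by blast
    have FA: "F x \<in> Sph_A" if "x \<in> path_image \<gamma>" for x
      using Sph_A_iff[OF FS[of x]] \<gamma>(2) that by blast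
    \<comment> \<open>The poles are fixed, so a point that F sends to neither pole is not a pole
      itself.\<close>
    have gA: "path_image \<gamma> \<subseteq> Sph_A"
    proof
      fix x assume x: "x \<in> path_image \<gamma>"
      then have "x \<noteq> (0, -1)" "x \<noteq> (0, 1)" using FA[OF x] Fp by auto
      then show "x \<in> Sph_A" using gS x by blast
    qed
    \<comment> \<open>The loop is carried over to \<open>nsphere 2\<close>, where the hypothesis
      speaks of homotopies; winding numbers and contractibility are exchanged before and after
      applying \<open>h\<close>.\<close>
    define \<delta> where "\<delta> = \<Theta>' \<circ> \<gamma>"
    have "loop_in {x \<in> S2. h x \<in> ?A} \<delta>"
      unfolding loop_in_def
    proof (intro conjI)
      show "path \<delta>" unfolding \<delta>_def by (rule path_continuous_image[OF \<gamma>(1) continuous_on_subset[OF con(2) gS]])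
      show "pathfinish \<delta> = pathstart \<delta>" using \<gamma>(3) by (simp add: \<delta>_def pathfinish_compose pathstart_compose)
      show "path_image \<delta> \<subseteq> {x \<in> S2. h x \<in> ?A}"
      proof -
        have "h (\<Theta>' x) \<in> ?A" if "x \<in> path_image \<gamma>" for x
          using FA[OF that] AS[OF inh[OF in\<Theta>'[of x]]] gS that by (auto simp: F_def simp del: Diff_iff)
        then show ?thesis using gS in\<Theta>' unfolding \<delta>_def path_image_compose by blast
      qed
    qed
    moreover have "homotopically_trivial_in ?A \<delta>"
    proof -
      obtain a where "homotopic_loops Sph_A \<gamma> (\<lambda>_. a)"
        using null_homotopic_Sph_A_iff[OF \<gamma>(1) gA \<gamma>(3)] \<gamma>(4) by blast
      then have "homotopic_loops ?A (\<Theta>' \<circ> \<gamma>) (\<Theta>' \<circ> (\<lambda>_. a))"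
        by (rule homotopic_loops_continuous_image) (use SA in \<open>auto intro: continuous_on_subset[OF con(2)] simp del: Diff_iff\<close>)
      then show ?thesis unfolding homotopically_trivial_in_def \<delta>_def comp_def by blast
    qed
    ultimately have "homotopically_trivial_in ?A (h \<circ> \<delta>)" by (rule loops)
    then obtain a where "homotopic_loops ?A (h \<circ> \<delta>) (\<lambda>_. a)" unfolding homotopically_trivial_in_def by blast
    then have "homotopic_loops Sph_A (\<Theta> \<circ> (h \<circ> \<delta>)) (\<Theta> \<circ> (\<lambda>_. a))"
      by (rule homotopic_loops_continuous_image) (use AS in \<open>auto intro: continuous_on_subset[OF con(1)] simp del: Diff_iff\<close>)
    then have "homotopic_loops Sph_A (F \<circ> \<gamma>) (\<lambda>_. \<Theta> a)" by (simp add: F_def \<delta>_def comp_def)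
    then have "log_var (fst \<circ> (F \<circ> \<gamma>)) = 0"
      using null_homotopic_Sph_A_iff[of "F \<circ> \<gamma>"] homotopic_loops_imp_path homotopic_loops_imp_subset homotopic_loops_imp_loop
      by meson
    then show "log_var ((\<lambda>x. fst (F x)) \<circ> \<gamma>) = 0" by (simp add: comp_def)
  qed (use F FS cN cS Fp in blast)+
  have eq: "{x \<in> Sph. F x = x} = \<Theta> ` {x \<in> S2. h x = x}"
  proof (rule Set.set_eqI, rule iffI)
    fix y assume y: "y \<in> {x \<in> Sph. F x = x}"
    then have yS: "y \<in> Sph" and "\<Theta> (h (\<Theta>' y)) = y" by (simp_all add: F_def)
    then have "h (\<Theta>' y) = \<Theta>' y" using inv[OF inh[OF in\<Theta>'[OF yS]]] by simp
    then show "y \<in> \<Theta> ` {x \<in> S2. h x = x}" using inv'[OF yS] in\<Theta>'[OF yS] by (intro image_eqI[of _ _ "\<Theta>' y"]) auto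
  next
    fix y assume "y \<in> \<Theta> ` {x \<in> S2. h x = x}"
    then obtain x where "y = \<Theta> x" "x \<in> S2" "h x = x" by blast
    then show "y \<in> {x \<in> Sph. F x = x}" using in\<Theta> inv by (simp add: F_def)
  qed
  have inj: "inj_on \<Theta> {x \<in> S2. h x = x}" using inv by (metis (no_types, lifting) inj_onI mem_Collect_eq)
  have "\<bar>sph_degree F - 1\<bar> \<le> int (card {x \<in> Sph. F x = x})"
    by (rule fixed_point_count) (simp only: eq finite_imageI[OF fin])
  then show ?thesis
    unfolding eq card_image[OF inj] by (simp add: F_def sph_degree_conjugate[OF \<Theta> h])
qed

section \<open>Iterates and the growth rate\<close>

lemma attracting_fixed_pair_funpow:
  assumes "attracting_fixed_pair X f p q" "n > 0"
  shows "attracting_fixed_pair X (f ^^ n) p q"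
proof -
  obtain U V where UV: "f p = p" "f q = q" "openin X U" "openin X V" "U \<inter> V = {}" "p \<in> U" "q \<in> V"
    "f ` (X closure_of U) \<subseteq> U" "f ` (X closure_of V) \<subseteq> V"
    using assms(1) unfolding attracting_fixed_pair_def by blast
  have pow: "(f ^^ n) ` (X closure_of W) \<subseteq> W" if W: "openin X W" "f ` (X closure_of W) \<subseteq> W" for W
    using \<open>n > 0\<close>
  proof (induction n rule: nat_induct_non_zero)
    case 1
    then show ?case using W(2) by simp
  next
    case (Suc n)
    have "W \<subseteq> X closure_of W" by (rule closure_of_subset[OF openin_subset[OF W(1)]])
    then show ?case using Suc.IH W(2) by fastforce
  qed
  have fx: "(f ^^ n) p = p" "(f ^^ n) q = q" using UV(1,2) by (induction n) auto
  then show ?thesis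
    unfolding attracting_fixed_pair_def using fx UV(3-7) pow[OF UV(3,8)] pow[OF UV(4,9)] by blast
qed

lemma Brouwer_degree2_funpow:
  assumes "continuous_map (nsphere p) (nsphere p) f"
  shows "continuous_map (nsphere p) (nsphere p) (f ^^ n)" "Brouwer_degree2 p (f ^^ n) = Brouwer_degree2 p f ^ n"
proof -
  show c: "continuous_map (nsphere p) (nsphere p) (f ^^ n)" for n
  proof (induction n)
    case 0
    then show ?case using continuous_map_id by simp
  next
    case (Suc n)
    from continuous_map_compose[OF this assms] show ?case by (simp only: funpow.simps)
  qed
  show "Brouwer_degree2 p (f ^^ n) = Brouwer_degree2 p f ^ n"
  proof (induction n)
    case 0
    then show ?case by (simp only: funpow.simps Brouwer_degree2_id power_0)
  next
    case (Suc n)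
    then show ?case by (simp only: funpow.simps Brouwer_degree2_compose[OF c assms] power_Suc)
  qed
qed

text \<open>Since \<open>N\<close> and \<open>S\<close> are fixed, the preimage of \<open>A\<close>
  under \<open>f ^^ Suc n\<close> lies in that under \<open>f ^^ n\<close>. So the induction
  hypothesis makes the intermediate loop contractible in \<open>A\<close>, and this loop lies in the
  preimage of \<open>A\<close> under \<open>f\<close>, where the hypothesis on \<open>f\<close>
  applies.\<close>

lemma homotopically_trivial_funpow:
  assumes f: "continuous_map (nsphere 2) (nsphere 2) f" and fixed: "f N = N" "f S = S"
    and A: "A = S2 - {N, S}"
    and loops: "\<And>\<gamma>. loop_in {x \<in> S2. f x \<in> A} \<gamma> \<Longrightarrow> homotopically_trivial_in A \<gamma>
           \<Longrightarrow> homotopically_trivial_in A (f \<circ> \<gamma>)"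
    and \<gamma>: "loop_in {x \<in> S2. (f ^^ n) x \<in> A} \<gamma>" "homotopically_trivial_in A \<gamma>"
  shows "homotopically_trivial_in A ((f ^^ n) \<circ> \<gamma>)"
  using \<gamma>
proof (induction n)
  case 0
  then show ?case by simp
next
  case (Suc n)
  have fS: "f x \<in> S2" if "x \<in> S2" for x using continuous_map_funspace[OF f] that by auto
  have pS: "(f ^^ n) x \<in> S2" if "x \<in> S2" for x
    using continuous_map_funspace[OF Brouwer_degree2_funpow(1)[OF f, of n]] that by auto
  have pull: "x \<in> A" if "x \<in> S2" "f x \<in> A" for x using that fixed unfolding A by auto
  have mid: "(f ^^ n) x \<in> A" if "x \<in> S2" "(f ^^ Suc n) x \<in> A" for x
    using pull[OF pS[OF that(1)]] that(2) by simp
  have lp: "path \<gamma>" "path_image \<gamma> \<subseteq> {x \<in> S2. (f ^^ Suc n) x \<in> A}" "pathfinish \<gamma> = pathstart \<gamma>"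
    using Suc.prems(1) unfolding loop_in_def by auto
  then have sub: "path_image \<gamma> \<subseteq> {x \<in> S2. (f ^^ n) x \<in> A}" using mid by blast
  then have tr: "homotopically_trivial_in A ((f ^^ n) \<circ> \<gamma>)"
    using Suc.IH Suc.prems(2) lp unfolding loop_in_def by blast
  have "loop_in {x \<in> S2. f x \<in> A} ((f ^^ n) \<circ> \<gamma>)"
    unfolding loop_in_def
  proof (intro conjI)
    have "continuous_on S2 (f ^^ n)" by (rule continuous_map_nsphere_2(3)[OF Brouwer_degree2_funpow(1)[OF f]])
    then show "path ((f ^^ n) \<circ> \<gamma>)" using lp(1) sub by (auto intro!: path_continuous_image elim: continuous_on_subset)
    show "path_image ((f ^^ n) \<circ> \<gamma>) \<subseteq> {x \<in> S2. f x \<in> A}"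
      using lp(2) pS unfolding path_image_compose by auto
    show "pathfinish ((f ^^ n) \<circ> \<gamma>) = pathstart ((f ^^ n) \<circ> \<gamma>)"
      using lp(3) by (simp add: pathfinish_compose pathstart_compose)
  qed
  from loops[OF this tr] show ?case by (simp only: funpow.simps comp_assoc)
qed

theorem theoremA:
  fixes f :: "(nat \<Rightarrow> real) \<Rightarrow> (nat \<Rightarrow> real)"
    and d :: int
    and N S :: "nat \<Rightarrow> real"
    and A :: "(nat \<Rightarrow> real) set"
  assumes "continuous_map (nsphere 2) (nsphere 2) f"
    and "Brouwer_degree2 2 f = d"
    and "\<bar>d\<bar> > 1"
    and "N \<in> S2" and "S \<in> S2" and "N \<noteq> S"
    and "attracting_fixed_pair (nsphere 2) f N S"
    and "A = S2 - {N, S}"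
    and "\<And>\<gamma>. loop_in {x \<in> S2. f x \<in> A} \<gamma> \<Longrightarrow> homotopically_trivial_in A \<gamma>
           \<Longrightarrow> homotopically_trivial_in A (f \<circ> \<gamma>)"
  shows "limsup (\<lambda>n. ereal (1 / real n) * log_card (periodic_points S2 f n))
           \<ge> ereal (ln (real_of_int \<bar>d\<bar>))"
proof -
  let ?P = "periodic_points S2 f" and ?l = "ln (real_of_int \<bar>d\<bar>)"
  have fixed: "f N = N" "f S = S" using assms(7) by (auto simp: attracting_fixed_pair_def)
  \<comment> \<open>For n > 0 the power |d|^n is at least 2, so |d^n - 1| is at least half of it.
    The factor 2 costs only ln 2 / n after taking logarithms.\<close>
  have count: "\<bar>d\<bar> ^ n \<le> 2 * int (card (?P n))" if n: "n > 0" and fin: "finite (?P n)" for n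
  proof -
    have P: "?P n = {x \<in> S2. (f ^^ n) x = x}" by (simp add: periodic_points_def)
    have "\<bar>Brouwer_degree2 2 (f ^^ n) - 1\<bar> \<le> int (card {x \<in> S2. (f ^^ n) x = x})"
    proof (rule S2_fixed_point_count)
      show "continuous_map (nsphere 2) (nsphere 2) (f ^^ n)" by (rule Brouwer_degree2_funpow(1)[OF assms(1)])
      show "attracting_fixed_pair (nsphere 2) (f ^^ n) N S" by (rule attracting_fixed_pair_funpow[OF assms(7) n])
      show "finite {x \<in> S2. (f ^^ n) x = x}" using fin by (simp add: P)
      show "homotopically_trivial_in (S2 - {N, S}) (f ^^ n \<circ> \<gamma>)"
        if \<gamma>: "loop_in {x \<in> S2. (f ^^ n) x \<in> S2 - {N, S}} \<gamma>" "homotopically_trivial_in (S2 - {N, S}) \<gamma>" for \<gamma>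
      proof (rule homotopically_trivial_funpow[OF assms(1) fixed refl _ \<gamma>])
        fix \<delta> assume "loop_in {x \<in> S2. f x \<in> S2 - {N, S}} \<delta>" "homotopically_trivial_in (S2 - {N, S}) \<delta>"
        then show "homotopically_trivial_in (S2 - {N, S}) (f \<circ> \<delta>)" using assms(9)[of \<delta>] unfolding assms(8) by blast
      qed
    qed (fact assms)+
    then have "\<bar>d ^ n - 1\<bar> \<le> int (card (?P n))"
      using assms(2) by (simp only: P Brouwer_degree2_funpow(2)[OF assms(1)])
    moreover have "\<bar>d\<bar> ^ n = \<bar>d ^ n\<bar>" by (simp add: power_abs)
    moreover have "\<bar>d\<bar> ^ 1 \<le> \<bar>d\<bar> ^ n" using n assms(3) by (intro power_increasing) auto
    ultimately show ?thesis using assms(3) by simp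
  qed
  have bound: "ereal (?l - ln 2 / real n) \<le> ereal (1 / real n) * log_card (?P n)" if n: "n > 0" for n
  proof (cases "finite (?P n)")
    case False
    then show ?thesis using n by (simp add: log_card_def)
  next
    case True
    have d0: "real_of_int \<bar>d\<bar> > 0" using assms(3) by simp
    have "real_of_int (\<bar>d\<bar> ^ n) \<le> real_of_int (2 * int (card (?P n)))"
      using count[OF n True] by (simp only: of_int_le_iff)
    then have c: "real_of_int \<bar>d\<bar> ^ n \<le> 2 * real (card (?P n))"
      by (simp only: of_int_power of_int_mult of_int_numeral of_int_of_nat_eq)
    then have pos: "real (card (?P n)) > 0" using zero_less_power[OF d0, of n] by linarith
    then have "?P n \<noteq> {}" by auto
    have "real n * ?l = ln (real_of_int \<bar>d\<bar> ^ n)" using d0 by (simp add: ln_realpow)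
    also have "\<dots> \<le> ln (2 * real (card (?P n)))" using c zero_less_power[OF d0, of n] pos by simp
    also have "\<dots> = ln 2 + ln (real (card (?P n)))" using pos by (simp add: ln_mult)
    finally have "real n * ?l / real n \<le> (ln 2 + ln (real (card (?P n)))) / real n" by (rule divide_right_mono) simp
    then have "?l - ln 2 / real n \<le> ln (real (card (?P n))) / real n" using n by (simp add: add_divide_distrib)
    then show ?thesis using True \<open>?P n \<noteq> {}\<close> by (simp add: log_card_def)
  qed
  have "(\<lambda>n. ?l - ln 2 / real n) \<longlonglongrightarrow> ?l - 0" by (intro tendsto_intros lim_const_over_n)
  then have "(\<lambda>n. ereal (?l - ln 2 / real n)) \<longlonglongrightarrow> ereal ?l" by simp
  then have "ereal ?l = limsup (\<lambda>n. ereal (?l - ln 2 / real n))"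
    by (intro lim_imp_Limsup[symmetric]) simp_all
  also have "\<dots> \<le> limsup (\<lambda>n. ereal (1 / real n) * log_card (?P n))"
    \<comment> \<open>The bound is available for positive n only, which is enough for a
      limsup.\<close>
    by (intro Limsup_mono eventually_mono[OF eventually_gt_at_top[of 0]] bound)
  finally show ?thesis .
qed

end
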